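(* Let $\alpha,\beta$ be nonzero real numbers and $\omega$ a nontrivial cube root of unity. In each case below let $\Lambda\subset\mathbb{C}$ be the stated lattice, let $\wp(z)=\wp(z;\Lambda)$, and let $G$ be the group generated by the translations by elements of $\Lambda$, the stated rotations, and the reflexion $z\mapsto\bar z$ in the real axis. Then $G$ is the wallpaper group of the named type, and the meromorphic functions $f:\mathbb{C}\to\mathbb{CP}^1$ invariant under the modified action of $G$ are exactly those of the stated form, where $R,S$ are rational functions with $R(w),S(w)$ real for real $w$: (pm) $\Lambda=\mathbb{Z}\alpha+\mathbb{Z}\beta i$, no rotation: $f=R(\wp)+S(\wp)\,\wp'$. (p2mm) $\Lambda=\mathbb{Z}\alpha+\mathbb{Z}\beta i$, rotation $z\mapsto -z$: $f=R(\wp)$. (p4mm) $\Lambda=\mathbb{Z}\alpha+\mathbb{Z}\alpha i$, rotation $z\mapsto iz$: $f=R(\wp^2)$. (p31m) $\Lambda=\mathbb{Z}\alpha+\mathbb{Z}\alpha\omega$, rotation $z\mapsto\omega z$: $f=R(\wp')$. (p6mm) $\Lambda=\mathbb{Z}\alpha+\mathbb{Z}\alpha\omega$, rotations $z\mapsto -z$ and $z\mapsto\omega z$: $f=R(\wp'^2)$, or equivalently $f=S(\wp^3)$. (cm) $\Lambda=\mathbb{Z}(\alpha+\beta i)+\mathbb{Z}(\alpha-\beta i)$, no rotation: $f=R(\wp)+S(\wp)\,\wp'$. (c2mm) $\Lambda=\mathbb{Z}(\alpha+\beta i)+\mathbb{Z}(\alpha-\beta i)$, rotation $z\mapsto -z$: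 $f=R(\wp)$. (p3m1) $\Lambda=\mathbb{Z}(\alpha+\alpha\sqrt3\,i)+\mathbb{Z}(\alpha-\alpha\sqrt3\,i)$, rotation $z\mapsto\omega z$: $f=R(\wp')$.
   Context: A wallpaper group is a group of rigid motions of the plane $\mathbb{C}$ containing two non-parallel translations; the names pm, p2mm, p4mm, p31m, p6mm, cm, c2mm, p3m1 are the standard crystallographic names of types of wallpaper groups. Modified action: a sense-preserving $g\in G$, $g.z=az+b$, sends $f$ to $z\mapsto f(g.z)$; a sense-reversing $m\in G$, $m.z=a\bar z+b$, sends $f$ to $z\mapsto\overline{f(m.z)}$ (with $\overline{\infty}=\infty$). The function $f$ is invariant if it is unchanged by the modified action of every element of $G$. The Weierstrass function of a lattice $\Lambda$ is $\wp(z;\Lambda)=\frac1{z^2}+\sum_{\lambda\in\Lambda\setminus\{0\}}\left(\frac1{(z-\lambda)^2}-\frac1{\lambda^2}\right)$. "Real for real $w$" means that $R(w)\in\mathbb{R}\cup\{\infty\}$ for all $w\in\mathbb{R}$, and likewise for $S$.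
   Formalization: In case (p3m1) the printed lattice gives a group of type p31m, so type p3m1 with f=R(℘') is claimed for Λ=Z(α+(α/√3)i)+Z(α−(α/√3)i) instead; for the printed lattice the form f=R(℘') is kept, with the type stated as p31m. *)

theory Defs
  imports "HOL-Complex_Analysis.Complex_Analysis" "HOL-Algebra.Bij" "HOL-Algebra.Generated_Groups"
begin

section \<open>Meromorphic functions as maps to the Riemann sphere\<close>

datatype sphere = Fin complex | Infty

fun sphere_cnj :: "sphere \<Rightarrow> sphere" where
  "sphere_cnj (Fin z) = Fin (cnj z)"
| "sphere_cnj Infty = Infty"

text \<open>The library represents a meromorphic function by a complex-valued function whose values at
  poles and removable singularities carry no information. The map below fills in these values: it
  is \<open>Infty\<close> at poles and the limit of \<open>f\<close> elsewhere. Hence an equation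
  \<open>F = sphere_map f\<close> is an equation in the field of meromorphic functions.\<close>

definition sphere_map :: "(complex \<Rightarrow> complex) \<Rightarrow> complex \<Rightarrow> sphere" where
  "sphere_map f z = (if is_pole f z then Infty else Fin (remove_sings f z))"

text \<open>As usual, the constant \<open>Infty\<close> is not a meromorphic function.\<close>

definition meromorphic_to_sphere :: "(complex \<Rightarrow> sphere) \<Rightarrow> bool" where
  "meromorphic_to_sphere F \<longleftrightarrow> (\<exists>f. f meromorphic_on UNIV \<and> F = sphere_map f)"

definition rational_fun :: "(complex \<Rightarrow> complex) \<Rightarrow> bool" where
  "rational_fun R \<longleftrightarrow> (\<exists>p q :: complex poly. q \<noteq> 0 \<and> R = (\<lambda>w. poly p w / poly q w))"

definition real_for_real :: "(complex \<Rightarrow> complex) \<Rightarrow> bool" where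
  "real_for_real R \<longleftrightarrow> (\<forall>w\<in>\<real>. sphere_map R w \<in> insert Infty (Fin ` \<real>))"

definition real_rational :: "(complex \<Rightarrow> complex) set" where
  "real_rational = {R. rational_fun R \<and> real_for_real R}"


section \<open>Lattices and the Weierstrass function\<close>

definition lattice :: "complex \<Rightarrow> complex \<Rightarrow> complex set" where
  "lattice u v = {of_int m * u + of_int n * v | m n :: int. True}"

definition weierstrass_p :: "complex set \<Rightarrow> complex \<Rightarrow> complex" where
  "weierstrass_p \<Lambda> z =
     1 / z ^ 2 + (\<Sum>\<^sub>\<infinity>w\<in>\<Lambda> - {0}. 1 / (z - w) ^ 2 - 1 / w ^ 2)"


section \<open>Rigid motions, the modified action, wallpaper groups\<close>

definition sense_preserving :: "(complex \<Rightarrow> complex) \<Rightarrow> bool" where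
  "sense_preserving g \<longleftrightarrow> (\<exists>a b. norm a = 1 \<and> g = (\<lambda>z. a * z + b))"

definition sense_reversing :: "(complex \<Rightarrow> complex) \<Rightarrow> bool" where
  "sense_reversing g \<longleftrightarrow> (\<exists>a b. norm a = 1 \<and> g = (\<lambda>z. a * cnj z + b))"

definition rigid_motion :: "(complex \<Rightarrow> complex) \<Rightarrow> bool" where
  "rigid_motion g \<longleftrightarrow> sense_preserving g \<or> sense_reversing g"

definition modified_action ::
    "(complex \<Rightarrow> complex) \<Rightarrow> (complex \<Rightarrow> sphere) \<Rightarrow> complex \<Rightarrow> sphere" where
  "modified_action g F =
     (if sense_preserving g then (\<lambda>z. F (g z)) else (\<lambda>z. sphere_cnj (F (g z))))"

definition invariant_meromorphic :: "(complex \<Rightarrow> complex) set \<Rightarrow> (complex \<Rightarrow> sphere) set" where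
  "invariant_meromorphic G =
     {F. meromorphic_to_sphere F \<and> (\<forall>g\<in>G. modified_action g F = F)}"

definition nonparallel :: "complex \<Rightarrow> complex \<Rightarrow> bool" where
  "nonparallel u v \<longleftrightarrow> (\<forall>s t :: real. of_real s * u + of_real t * v = 0 \<longrightarrow> s = 0 \<and> t = 0)"

definition wallpaper_group :: "(complex \<Rightarrow> complex) set \<Rightarrow> bool" where
  "wallpaper_group G \<longleftrightarrow>
     subgroup G (BijGroup UNIV) \<and> (\<forall>g\<in>G. rigid_motion g) \<and>
     (\<exists>u v. nonparallel u v \<and> (\<lambda>z. z + u) \<in> G \<and> (\<lambda>z. z + v) \<in> G)"

definition motion_group :: "complex set \<Rightarrow> complex set \<Rightarrow> (complex \<Rightarrow> complex) set" where
  "motion_group \<Lambda> rots =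
     generate (BijGroup UNIV)
       ((\<lambda>w z. z + w) ` \<Lambda> \<union> (\<lambda>\<rho> z. \<rho> * z) ` rots \<union> {cnj})"


section \<open>Crystallographic types\<close>

text \<open>A type is an affine equivalence class of wallpaper groups, and the names are attached to
  the classes by the standard descriptions in the International Tables for Crystallography (Vol. A):
  each group is listed by its general positions, in coordinates with respect to a conventional
  cell, modulo integer translations and, for the symbols beginning with c, the centring
  translation (1/2, 1/2). In the hexagonal cases the basis vectors have equal length and enclose
  an angle of 120 degrees; this is forced by the group consisting of rigid motions.

  The types p31m and p3m1 differ in the position of the mirrors relative to the lattice: in p31m
  the mirrors through the origin run along shortest lattice vectors, in p3m1 they are perpendicular
  to shortest lattice vectors. With the real axis as mirror and \<open>\<alpha>\<close> real, the hexagonal lattice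
  spanned by \<open>\<alpha> \<plusminus> \<alpha> \<surd>3 \<i>\<close> (which contains \<open>2\<alpha>\<close>, of the same length as the generators) therefore
  belongs to p31m, and the hexagonal lattice spanned by \<open>\<alpha> \<plusminus> (\<alpha>/\<surd>3) \<i>\<close> belongs to p3m1.\<close>

datatype wallpaper_type = pm | cm | p2mm | c2mm | p4mm | p3m1 | p31m | p6mm

fun general_positions :: "wallpaper_type \<Rightarrow> (real \<times> real \<Rightarrow> real \<times> real) set" where
  "general_positions pm = {\<lambda>(x, y). (x, y), \<lambda>(x, y). (- x, y)}"
| "general_positions cm = {\<lambda>(x, y). (x, y), \<lambda>(x, y). (- x, y)}"
| "general_positions p2mm =
     {\<lambda>(x, y). (x, y), \<lambda>(x, y). (- x, - y), \<lambda>(x, y). (- x, y), \<lambda>(x, y). (x, - y)}"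
| "general_positions c2mm =
     {\<lambda>(x, y). (x, y), \<lambda>(x, y). (- x, - y), \<lambda>(x, y). (- x, y), \<lambda>(x, y). (x, - y)}"
| "general_positions p4mm =
     {\<lambda>(x, y). (x, y), \<lambda>(x, y). (- x, - y), \<lambda>(x, y). (- y, x), \<lambda>(x, y). (y, - x),
      \<lambda>(x, y). (- x, y), \<lambda>(x, y). (x, - y), \<lambda>(x, y). (y, x), \<lambda>(x, y). (- y, - x)}"
| "general_positions p3m1 =
     {\<lambda>(x, y). (x, y), \<lambda>(x, y). (- y, x - y), \<lambda>(x, y). (- x + y, - x),
      \<lambda>(x, y). (- y, - x), \<lambda>(x, y). (- x + y, y), \<lambda>(x, y). (x, x - y)}"
| "general_positions p31m =
     {\<lambda>(x, y). (x, y), \<lambda>(x, y). (- y, x - y), \<lambda>(x, y). (- x + y, - x),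
      \<lambda>(x, y). (y, x), \<lambda>(x, y). (x - y, - y), \<lambda>(x, y). (- x, - x + y)}"
| "general_positions p6mm =
     {\<lambda>(x, y). (x, y), \<lambda>(x, y). (- y, x - y), \<lambda>(x, y). (- x + y, - x),
      \<lambda>(x, y). (- x, - y), \<lambda>(x, y). (y, - x + y), \<lambda>(x, y). (x - y, x),
      \<lambda>(x, y). (- y, - x), \<lambda>(x, y). (- x + y, y), \<lambda>(x, y). (x, x - y),
      \<lambda>(x, y). (y, x), \<lambda>(x, y). (x - y, - y), \<lambda>(x, y). (- x, - x + y)}"

definition centring :: "wallpaper_type \<Rightarrow> (real \<times> real) set" where
  "centring T = (if T = cm \<or> T = c2mm then {(0, 0), (1 / 2, 1 / 2)} else {(0, 0)})"

definition standard_group :: "wallpaper_type \<Rightarrow> (real \<times> real \<Rightarrow> real \<times> real) set" where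
  "standard_group T =
     {\<lambda>xy. h xy + c + (of_int m, of_int n) | h c m n. h \<in> general_positions T \<and> c \<in> centring T}"

definition affine_frame :: "complex \<Rightarrow> complex \<Rightarrow> complex \<Rightarrow> real \<times> real \<Rightarrow> complex" where
  "affine_frame p a b = (\<lambda>(x, y). p + of_real x * a + of_real y * b)"

definition wallpaper_group_of_type :: "wallpaper_type \<Rightarrow> (complex \<Rightarrow> complex) set \<Rightarrow> bool" where
  "wallpaper_group_of_type T G \<longleftrightarrow>
     wallpaper_group G \<and>
     (\<exists>p a b. nonparallel a b \<and>
        G = {g. \<exists>h\<in>standard_group T. g \<circ> affine_frame p a b = affine_frame p a b \<circ> h})"

end

(* Let h be one of the functions \<wp>, \<wp>^2, \<wp>^3, \<wp>', \<wp>'^2 that is invariant under the rotations of the group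
   in question. It has poles only at lattice points, of an order d that equals the order of the group of
   rotations. If f has the same periods and rotations, multiply it by a polynomial in h to remove all
   poles off the lattice. The Laurent expansion of the product at 0 only involves powers of z^d, so
   subtracting a polynomial in h removes the remaining poles, and by Liouville's theorem only a
   constant is left. Hence f = p(h)/q(h). As h commutes with conjugation, the invariance of f under the reflection
   means that p/q equals its complex conjugate, i.e. is real on the real line. Without rotations, split
   f into an even part and \<wp>' times an even function first. *)

theory Submission
  imports Defs
begin

section \<open>Lattices\<close>

text \<open>The values of a meromorphic function at its singularities are arbitrary, so functional
  equations are stated almost everywhere, i.e. for the cosparse filter; \<open>sphere_map\<close>
  turns them into equations at every point. Laurent expansions are replaced by limits of
  \<open>z ^ n * f z\<close>: comparing such a limit along z and along \<zeta> z shows that a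
  nonzero one forces \<zeta> ^ n = 1, and this ties the pole order of h to the order of the rotation
  \<zeta>. Since \<wp> ^ k has pole order 2k and \<wp>' ^ k has pole order 3k, the former serves the
  rotation groups of order 2, 4, 6 and the latter those of order 3 and 6; order 6 has two
  descriptions because 3 * 2 = 2 * 3. For the trivial rotation group h would need one simple pole
  per cell, and no such elliptic function exists; hence the splitting into even and odd parts there.
  All hexagonal lattices are brought to the form spanned by a and \<omega> a with a real or purely
  imaginary, and this alternative alone separates p31m from p3m1.\<close>

lemma nonparallel_iff: "nonparallel u v \<longleftrightarrow> Im (cnj u * v) \<noteq> 0"
proof
  assume np: "nonparallel u v"
  show "Im (cnj u * v) \<noteq> 0"
  proof
    assume D: "Im (cnj u * v) = 0"
    \<comment> \<open>\<open>Im (cnj u * v)\<close> is the determinant of u and v. If it vanishes,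
      \<open>cnj u * v\<close> is real, and the identity
      \<open>(cnj u * v) * u = (u * cnj u) * v\<close> becomes a real linear relation.\<close>
    have "of_real (Re (cnj u * v)) * u + of_real (- (norm u)\<^sup>2) * v = (cnj u * v) * u - (u * cnj u) * v"
      unfolding complex_norm_square[symmetric]
      using D by (simp add: complex_eq_iff algebra_simps power2_eq_square cmod_def)
    also have "\<dots> = 0" by simp
    finally have "norm u = 0" using np unfolding nonparallel_def by fastforce
    hence "of_real 1 * u + of_real 0 * v = 0" by simp
    with np show False unfolding nonparallel_def by (metis zero_neq_one)
  qed
next
  assume D: "Im (cnj u * v) \<noteq> 0"
  show "nonparallel u v" unfolding nonparallel_def
  proof (intro allI impI)
    fix s t :: real assume "of_real s * u + of_real t * v = 0"
    hence 1: "s * Re u + t * Re v = 0" and 2: "s * Im u + t * Im v = 0"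
      by (auto simp: complex_eq_iff)
    \<comment> \<open>Cramer's rule for the two real equations.\<close>
    have "s * Im (cnj u * v) = (s * Re u + t * Re v) * Im v - (s * Im u + t * Im v) * Re v"
      "t * Im (cnj u * v) = (s * Im u + t * Im v) * Re u - (s * Re u + t * Re v) * Im u"
      by (simp_all add: algebra_simps)
    hence "s * Im (cnj u * v) = 0" "t * Im (cnj u * v) = 0" unfolding 1 2 by simp_all
    with D show "s = 0 \<and> t = 0" by (simp only: mult_eq_0_iff) blast
  qed
qed

lemma lattice_add: "w \<in> lattice u v \<Longrightarrow> w' \<in> lattice u v \<Longrightarrow> w + w' \<in> lattice u v"
proof -
  assume "w \<in> lattice u v" "w' \<in> lattice u v"
  then obtain m n m' n' :: int where "w = of_int m * u + of_int n * v" "w' = of_int m' * u + of_int n' * v"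
    by (auto simp: lattice_def)
  hence "w + w' = of_int (m + m') * u + of_int (n + n') * v" by (simp add: algebra_simps)
  thus ?thesis unfolding lattice_def by blast
qed

lemma lattice_uminus: "w \<in> lattice u v \<Longrightarrow> - w \<in> lattice u v"
proof -
  assume "w \<in> lattice u v"
  then obtain m n :: int where "w = of_int m * u + of_int n * v" by (auto simp: lattice_def)
  hence "- w = of_int (- m) * u + of_int (- n) * v" by (simp add: algebra_simps)
  thus ?thesis unfolding lattice_def by blast
qed

lemma lattice_uminus_iff [simp]: "- w \<in> lattice u v \<longleftrightarrow> w \<in> lattice u v"
  using lattice_uminus[of w] lattice_uminus[of "- w"] by auto

lemma lattice_diff: "w \<in> lattice u v \<Longrightarrow> w' \<in> lattice u v \<Longrightarrow> w - w' \<in> lattice u v"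
  using lattice_add[of w u v "- w'"] by simp

lemma lattice_add_iff: "w \<in> lattice u v \<Longrightarrow> z + w \<in> lattice u v \<longleftrightarrow> z \<in> lattice u v"
  using lattice_add[of z u v w] lattice_diff[of "z + w" u v w] by auto

lemma lattice_0 [simp, intro]: "0 \<in> lattice u v"
proof -
  have "0 = of_int 0 * u + of_int 0 * v" by simp
  thus ?thesis unfolding lattice_def by blast
qed

lemma lattice_basis1: "u \<in> lattice u v"
proof -
  have "u = of_int 1 * u + of_int 0 * v" by simp
  thus ?thesis unfolding lattice_def by blast
qed

lemma lattice_basis2: "v \<in> lattice u v"
proof -
  have "v = of_int 0 * u + of_int 1 * v" by simp
  thus ?thesis unfolding lattice_def by blast
qed

lemma lattice_of_int: "w \<in> lattice u v \<Longrightarrow> of_int k * w \<in> lattice u v"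
proof -
  assume "w \<in> lattice u v"
  then obtain m n :: int where "w = of_int m * u + of_int n * v" by (auto simp: lattice_def)
  hence "of_int k * w = of_int (k * m) * u + of_int (k * n) * v" by (simp add: algebra_simps)
  thus ?thesis unfolding lattice_def by blast
qed

lemma lattice_subset:
  assumes "a \<in> lattice u v" "b \<in> lattice u v"
  shows "lattice a b \<subseteq> lattice u v"
  using assms by (auto simp: lattice_def[of a b] intro!: lattice_add lattice_of_int)

lemma lattice_eqI:
  assumes "a \<in> lattice u v" "b \<in> lattice u v" "u \<in> lattice a b" "v \<in> lattice a b"
  shows "lattice a b = lattice u v"
  using assms lattice_subset by blast

text \<open>Additivity makes f linear over the integers, so the generators decide. Complex linearity
  is not asked for because conjugation has to be covered besides the rotations.\<close>

lemma lattice_linear: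
  assumes "Modules.additive f" "f u \<in> lattice u v" "f v \<in> lattice u v" "w \<in> lattice u v"
  shows "f w \<in> lattice u v"
proof -
  interpret Modules.additive f by fact
  have nat: "f (of_nat n * z) = of_nat n * f z" for n z
    by (induction n) (simp_all add: zero add algebra_simps)
  have int: "f (of_int n * z) = of_int n * f z" for n z
    by (cases n rule: int_cases2) (simp_all add: nat minus)
  obtain m n :: int where "w = of_int m * u + of_int n * v" using assms(4) by (auto simp: lattice_def)
  hence "f w = of_int m * f u + of_int n * f v" by (simp only: add int)
  thus ?thesis using assms(2,3) by (auto intro: lattice_add lattice_of_int)
qed

lemma nonparallel_span:
  assumes "nonparallel u v"
  obtains s t :: real where "z = of_real s * u + of_real t * v"
proof
  define D where "D = Im (cnj u * v)"
  have D: "D \<noteq> 0" using assms by (simp add: D_def nonparallel_iff)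
  \<comment> \<open>Cramer's rule: the coordinates of z are determinants of z with one generator,
    divided by D.\<close>
  have "of_real D * z = of_real (Im (cnj z * v)) * u + of_real (Im (cnj u * z)) * v"
    by (simp add: complex_eq_iff D_def algebra_simps)
  hence "z = (of_real (Im (cnj z * v)) * u + of_real (Im (cnj u * z)) * v) / of_real D"
    using D by (metis nonzero_mult_div_cancel_left of_real_eq_0_iff)
  thus "z = of_real (Im (cnj z * v) / D) * u + of_real (Im (cnj u * z) / D) * v"
    by (simp add: add_divide_distrib)
qed

text \<open>By Cramer's rule D s and D t are determinants involving z, hence bounded by |z| |v| and
  |u| |z|. This gives the constant explicitly, without a compactness argument.\<close>

lemma nonparallel_norm_bound:
  assumes "nonparallel u v"
  obtains c :: real where "c > 0"
    "\<And>s t :: real. c * (\<bar>s\<bar> + \<bar>t\<bar>) \<le> norm (of_real s * u + of_real t * v)"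
proof
  define D where "D = Im (cnj u * v)"
  have D: "D \<noteq> 0" using assms by (simp add: D_def nonparallel_iff)
  have uv: "norm u + norm v > 0" using D by (auto simp: D_def add_nonneg_eq_0_iff less_le)
  show "\<bar>D\<bar> / (norm u + norm v) > 0" using D uv by simp
  fix s t :: real
  define z where "z = of_real s * u + of_real t * v"
  have "D * s = Im (cnj z * v)" "D * t = Im (cnj u * z)"
    by (simp_all add: z_def D_def algebra_simps)
  hence "\<bar>D\<bar> * \<bar>s\<bar> \<le> norm z * norm v" "\<bar>D\<bar> * \<bar>t\<bar> \<le> norm u * norm z"
    using abs_Im_le_cmod[of "cnj z * v"] abs_Im_le_cmod[of "cnj u * z"]
    by (simp_all add: norm_mult abs_mult flip: abs_mult)
  hence "\<bar>D\<bar> * (\<bar>s\<bar> + \<bar>t\<bar>) \<le> norm z * (norm u + norm v)" by (simp add: algebra_simps)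
  thus "\<bar>D\<bar> / (norm u + norm v) * (\<bar>s\<bar> + \<bar>t\<bar>) \<le> norm (of_real s * u + of_real t * v)"
    using uv by (simp add: z_def field_simps)
qed

lemma nonparallel_inj:
  assumes "nonparallel u v"
  shows "inj (\<lambda>(m :: int, n :: int). of_int m * u + of_int n * v)"
proof (rule injI, clarify)
  fix m n m' n' :: int
  assume "of_int m * u + of_int n * v = of_int m' * u + of_int n' * v"
  hence "of_real (of_int (m - m')) * u + of_real (of_int (n - n')) * v = 0"
    by (simp add: algebra_simps)
  hence "of_int (m - m') = (0 :: real) \<and> of_int (n - n') = (0 :: real)"
    using assms unfolding nonparallel_def by blast
  thus "m = m' \<and> n = n'" by simp
qed

lemma lattice_eq_image: "lattice u v = range (\<lambda>(m :: int, n :: int). of_int m * u + of_int n * v)"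
  by (auto simp: lattice_def image_iff)

lemma finite_lattice_cball:
  assumes "nonparallel u v"
  shows "finite (lattice u v \<inter> cball 0 R)"
proof -
  obtain c where c: "c > 0" 
    "\<And>s t :: real. c * (\<bar>s\<bar> + \<bar>t\<bar>) \<le> norm (of_real s * u + of_real t * v)"
    using nonparallel_norm_bound[OF assms] by blast
  define N where "N = \<lceil>R / c\<rceil>"
  have "lattice u v \<inter> cball 0 R \<subseteq> (\<lambda>(m, n). of_int m * u + of_int n * v) ` ({-N..N} \<times> {-N..N})"
  proof
    fix w assume w: "w \<in> lattice u v \<inter> cball 0 R"
    then obtain m n :: int where mn: "w = of_int m * u + of_int n * v" by (auto simp: lattice_def)
    have "c * (\<bar>of_int m\<bar> + \<bar>of_int n\<bar>) \<le> R" using c(2)[of "of_int m" "of_int n"] w mn by simp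
    hence "\<bar>of_int m\<bar> + \<bar>of_int n\<bar> \<le> R / c" using c by (simp add: field_simps)
    hence "\<bar>m\<bar> \<le> N" "\<bar>n\<bar> \<le> N" unfolding N_def by linarith+
    thus "w \<in> (\<lambda>(m, n). of_int m * u + of_int n * v) ` ({-N..N} \<times> {-N..N})"
      unfolding mn by (intro image_eqI[of _ _ "(m, n)"]) auto
  qed
  thus ?thesis by (rule finite_subset) auto
qed

lemma lattice_isolated:
  assumes "nonparallel u v"
  obtains e :: real where "e > 0" "\<And>w. w \<in> lattice u v \<Longrightarrow> w \<noteq> z \<Longrightarrow> e \<le> dist z w"
proof -
  \<comment> \<open>Lattice points outside this disc are more than 1 away from z, so finitely many
    remain. Removing z makes the bound usable at lattice points too.\<close>
  define F where "F = lattice u v \<inter> cball 0 (norm z + 1) - {z}"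
  have "finite F" unfolding F_def using finite_lattice_cball[OF assms] by blast
  then obtain d where d: "d > 0" "\<forall>w\<in>F. w \<noteq> z \<longrightarrow> d \<le> dist z w"
    using finite_set_avoid by blast
  show ?thesis
  proof (rule that[of "min d 1"])
    fix w assume w: "w \<in> lattice u v" "w \<noteq> z"
    show "min d 1 \<le> dist z w"
    proof (cases "norm w \<le> norm z + 1")
      case True thus ?thesis using w d by (auto simp: F_def min_le_iff_disj)
    next
      case False
      thus ?thesis using norm_triangle_ineq2[of w z] by (simp add: dist_norm norm_minus_commute)
    qed
  qed (use d in auto)
qed

lemma eventually_not_in_lattice:
  assumes "nonparallel u v"
  shows "\<forall>\<^sub>F w in at z. w \<notin> lattice u v"
proof -
  obtain e :: real where "e > 0" "\<And>w. w \<in> lattice u v \<Longrightarrow> w \<noteq> z \<Longrightarrow> e \<le> dist z w"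
    using lattice_isolated[OF assms] by metis
  thus ?thesis unfolding eventually_at by (intro exI[of _ e]) (fastforce simp: dist_commute)
qed

section \<open>Summability of inverse cubes over a lattice\<close>

lemma summable_int_powr: "(\<lambda>m :: int. (1 + \<bar>of_int m\<bar>) powr (-3/2) :: real) summable_on UNIV"
proof -
  have "summable (\<lambda>n. real n powr (-3/2))" by (subst summable_real_powr_iff) simp
  hence "summable (\<lambda>n. real (Suc n) powr (-3/2))" by (rule summable_ignore_initial_segment[where k = 1, simplified])
  hence *: "(\<lambda>n :: nat. (1 + real n) powr (-3/2)) summable_on UNIV"
    by (intro summable_nonneg_imp_summable_on) (simp_all add: add.commute)
  have 1: "(\<lambda>m :: int. (1 + \<bar>of_int m\<bar>) powr (-3/2) :: real) summable_on {0..}"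
    by (subst summable_on_reindex_bij_witness[where S = "{0..}" and T = UNIV and i = int and j = nat
          and h = "\<lambda>n. (1 + real n) powr (-3/2)"]) (use * in auto)
  have 2: "(\<lambda>m :: int. (1 + \<bar>of_int m\<bar>) powr (-3/2) :: real) summable_on {..0}"
    by (subst summable_on_reindex_bij_witness[where S = "{..0}" and T = UNIV and i = "\<lambda>n. - int n" and j = "\<lambda>n. nat (- n)"
          and h = "\<lambda>n. (1 + real n) powr (-3/2)"]) (use * in auto)
  have 3: "(\<lambda>m :: int. (1 + \<bar>of_int m\<bar>) powr (-3/2) :: real) summable_on {..<0}"
    by (rule summable_on_subset_banach[OF 2]) auto
  have "{0..} \<union> {..<0 :: int} = UNIV" "{0..} \<inter> {..<0 :: int} = {}" by auto
  thus ?thesis using summable_on_Un_disjoint[OF 1 3] by simp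
qed

text \<open>The norm is at least c (|m| + |n|), and the inverse cube of |m| + |n| is dominated by a
  product of a function of m and a function of n. Splitting the exponent 3 evenly leaves 3/2 for
  each coordinate, which still exceeds 1.\<close>

lemma summable_lattice_cubes:
  assumes "nonparallel u v"
  shows "(\<lambda>w. 1 / norm w ^ 3) summable_on lattice u v"
proof -
  obtain c where c: "c > 0"
    "\<And>s t :: real. c * (\<bar>s\<bar> + \<bar>t\<bar>) \<le> norm (of_real s * u + of_real t * v)"
    using nonparallel_norm_bound[OF assms] by blast
  let ?g = "\<lambda>m :: int. (1 + \<bar>of_int m\<bar>) powr (-3/2) :: real"
  let ?f = "\<lambda>(m :: int, n :: int). of_int m * u + of_int n * v"
  have "(\<lambda>(m, n). ?g m * ?g n) summable_on UNIV \<times> UNIV"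
    by (rule Infinite_Sum.abs_summable_summable, subst Infinite_Sum.abs_summable_on_Sigma_iff)
      (use summable_int_powr in \<open>auto simp: abs_mult infsum_cmult_right' infsum_nonneg
        intro!: summable_on_cmult_right summable_on_cmult_left\<close>)
  hence prod: "(\<lambda>mn. (3 / c) ^ 3 * (case mn of (m, n) \<Rightarrow> ?g m * ?g n)) summable_on UNIV"
    by (intro summable_on_cmult_right) simp
  have "(\<lambda>mn. 1 / norm (?f mn) ^ 3) summable_on UNIV"
  proof (rule summable_on_comparison_test[OF prod])
    fix mn :: "int \<times> int"
    obtain m n where mn: "mn = (m, n)" by (cases mn)
    show "1 / norm (?f mn) ^ 3 \<le> (3 / c) ^ 3 * (case mn of (m, n) \<Rightarrow> ?g m * ?g n)"
    \<comment> \<open>At the origin the left side is 0 because 1 / 0 = 0; elsewhere |m| + |n| \<ge>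
      1.\<close>
    proof (cases "mn = (0, 0)")
      case True thus ?thesis using c by simp
    next
      case False
      define x y :: real where "x = \<bar>of_int m\<bar>" and "y = \<bar>of_int n\<bar>"
      have xy: "x \<ge> 0" "y \<ge> 0" "x + y \<ge> 1" using False mn by (auto simp: x_def y_def)
      have "c * (x + y) \<le> norm (?f mn)" using c(2)[of "of_int m" "of_int n"] by (simp add: mn x_def y_def)
      hence "(c * (x + y)) ^ 3 \<le> norm (?f mn) ^ 3" using c xy by (intro power_mono) auto
      hence "1 / norm (?f mn) ^ 3 \<le> 1 / (c * (x + y)) ^ 3"
        using c xy by (intro frac_le) auto
      also have "\<dots> \<le> (3 / c) ^ 3 * (1 / (3 * (x + y)) ^ 3)" by (simp add: power_mult_distrib power_divide del: distrib_left_numeral)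
      also have "1 / (3 * (x + y)) ^ 3 \<le> (1 + x) powr (-3/2) * (1 + y) powr (-3/2)"
      proof -
        \<comment> \<open>As x + y \<ge> 1, each of 1, x + y and x y is at most (x + y)^2. The
          factor 9 instead of 3 makes the bound a square, whose power -3/2 is an inverse
          cube.\<close>
        have "(1 + x) * (1 + y) \<le> (3 * (x + y))\<^sup>2"
        proof -
          have "x * y \<le> (x + y)\<^sup>2" "x + y \<le> (x + y)\<^sup>2" "1 \<le> (x + y)\<^sup>2"
            using xy self_le_power[of "x + y" 2] mult_mono[of 1 "x + y" 1 "x + y"]
            by (auto simp: power2_eq_square algebra_simps)
          hence "1 + (x + y) + x * y \<le> 9 * (x + y)\<^sup>2" by linarith
          thus ?thesis by (simp add: power2_eq_square algebra_simps)
        qed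
        hence "((3 * (x + y))\<^sup>2) powr (-3/2) \<le> ((1 + x) * (1 + y)) powr (-3/2)"
          using xy by (intro powr_mono2') (auto intro!: add_pos_nonneg mult_pos_pos)
        also have "((3 * (x + y))\<^sup>2) powr (-3/2) = (3 * (x + y)) powr (-3)"
          using xy by (simp add: powr_powr flip: powr_numeral)
        also have "\<dots> = 1 / (3 * (x + y)) ^ 3"
          using xy by (simp add: powr_minus_divide powr_numeral flip: powr_numeral)
        finally show ?thesis using xy by (simp add: powr_mult)
      qed
      finally show ?thesis using c by (simp add: mn x_def y_def mult_left_mono)
    qed
  qed auto
  hence "((\<lambda>w. 1 / norm w ^ 3) \<circ> ?f) summable_on UNIV" by (simp add: o_def case_prod_unfold)
  thus ?thesis
    by (subst lattice_eq_image, subst summable_on_reindex) (use nonparallel_inj[OF assms] in auto)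
qed


section \<open>The Weierstrass function\<close>

text \<open>As \<open>1 / 0 = 0\<close>, the term for \<open>w = 0\<close> is \<open>1 / z\<^sup>2\<close>, so that \<open>\<wp>\<close> is the sum of these terms over the
  whole lattice.\<close>

definition wp_term :: "complex \<Rightarrow> complex \<Rightarrow> complex" where
  "wp_term z w = 1 / (z - w)\<^sup>2 - 1 / w\<^sup>2"

text \<open>Subtracting 1 / w^2 gains one power of w: over a common denominator the numerator is z
  (2 w - z). Here |z| \<le> |w| / 2, so |2 w - z| \<le> 5/2 |w| and |z - w| \<ge> |w| / 2, whence 10
  = 5/2 * 4.\<close>

lemma norm_wp_term_le:
  assumes "R > 0" "norm z \<le> R" "norm w \<ge> 2 * R"
  shows "norm (wp_term z w) \<le> 10 * R * (1 / norm w ^ 3)"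
proof -
  have w: "norm w > 0" using assms by linarith
  have zw: "norm (z - w) \<ge> norm w / 2"
    using norm_triangle_ineq2[of w z] assms by (simp add: norm_minus_commute)
  hence ne: "w \<noteq> 0" "z - w \<noteq> 0" using w by auto
  have "wp_term z w = z * (2 * w - z) / (w\<^sup>2 * (z - w)\<^sup>2)"
    using ne by (simp add: wp_term_def field_simps) (simp add: power2_eq_square algebra_simps)
  hence "norm (wp_term z w) = norm z * norm (2 * w - z) / ((norm w)\<^sup>2 * (norm (z - w))\<^sup>2)"
    by (simp add: norm_mult norm_divide norm_power)
  also have "\<dots> \<le> (R * (5 / 2 * norm w)) / ((norm w)\<^sup>2 * (norm w / 2)\<^sup>2)"
  proof (intro frac_le mult_mono mult_left_mono power_mono zw)
    show "norm (2 * w - z) \<le> 5 / 2 * norm w"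
      using norm_triangle_ineq4[of "2 * w" z] assms by (simp add: norm_mult)
  qed (use w assms in auto)
  also have "\<dots> = 10 * R * (1 / norm w ^ 3)" using w by (simp add: field_simps power2_eq_square power3_eq_cube)
  finally show ?thesis .
qed

text \<open>Unordered summability allows the value to be computed along the intervals from -N to N -
  1, over which the sum collapses to \<open>a (- N) - a N\<close>.\<close>

lemma infsum_int_telescope:
  fixes a :: "int \<Rightarrow> complex"
  assumes "(\<lambda>m. a m - a (m + 1)) summable_on UNIV" "(a \<longlongrightarrow> 0) at_top" "(a \<longlongrightarrow> 0) at_bot"
  shows "infsum (\<lambda>m. a m - a (m + 1)) UNIV = 0"
proof -
  let ?S = "\<lambda>N :: nat. {- int N..<int N}"
  have "((\<lambda>F. \<Sum>m\<in>F. a m - a (m + 1)) \<longlongrightarrow> infsum (\<lambda>m. a m - a (m + 1)) UNIV) (finite_subsets_at_top UNIV)"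
    using has_sum_infsum[OF assms(1)] by (simp add: has_sum_def)
  moreover have "filterlim ?S (finite_subsets_at_top UNIV) sequentially"
    unfolding filterlim_finite_subsets_at_top
  proof (intro allI impI)
    fix X :: "int set" assume X: "finite X \<and> X \<subseteq> UNIV"
    obtain N where N: "\<And>x. x \<in> X \<Longrightarrow> nat \<bar>x\<bar> \<le> N"
      using X by (metis finite_imageI finite_nat_set_iff_bounded_le image_eqI)
    have "X \<subseteq> ?S n" if "n > N" for n using N that by fastforce
    thus "\<forall>\<^sub>F y in sequentially. finite (?S y) \<and> X \<subseteq> ?S y \<and> ?S y \<subseteq> UNIV"
      by (intro eventually_mono[OF eventually_gt_at_top[of N]]) auto
  qed
  ultimately have lim: "(\<lambda>N. \<Sum>m\<in>?S N. a m - a (m + 1)) \<longlonglongrightarrow> infsum (\<lambda>m. a m - a (m + 1)) UNIV"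
    by (rule filterlim_compose)
  have sum: "(\<Sum>m\<in>?S N. a m - a (m + 1)) = a (- int N) - a (int N)" for N
  proof (induction N)
    case (Suc N)
    have "?S (Suc N) = insert (- 1 - int N) (insert (int N) (?S N))" by auto
    thus ?case using Suc by (simp add: algebra_simps)
  qed simp
  have top: "filterlim int at_top sequentially" by (rule filterlim_int_sequentially)
  have bot: "filterlim (\<lambda>n. - int n) at_bot sequentially"
    unfolding filterlim_at_bot
  proof
    fix Z :: int
    show "\<forall>\<^sub>F n in sequentially. - int n \<le> Z"
      by (rule eventually_mono[OF eventually_ge_at_top[of "nat (- Z)"]]) linarith
  qed
  have "(\<lambda>N. a (- int N) - a (int N)) \<longlonglongrightarrow> 0 - 0"
    by (intro tendsto_diff filterlim_compose[OF assms(2) top] filterlim_compose[OF assms(3) bot])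
  thus ?thesis using lim LIMSEQ_unique unfolding sum by auto
qed

locale plane_lattice =
  fixes u v :: complex
  assumes np: "nonparallel u v"
begin

abbreviation "L \<equiv> lattice u v"
abbreviation "wp \<equiv> weierstrass_p L"

section \<open>Convergence, analyticity and poles of \<wp>\<close>

lemma summable_wp_term_tail:
  assumes "R > 0" "norm z \<le> R"
  shows "wp_term z summable_on (L - cball 0 (2 * R))"
proof (rule Infinite_Sum.abs_summable_summable, rule Infinite_Sum.abs_summable_on_comparison_test')
  show "(\<lambda>w. 10 * R * (1 / norm w ^ 3)) summable_on (L - cball 0 (2 * R))"
    by (intro summable_on_cmult_right summable_on_subset_banach[OF summable_lattice_cubes[OF np]]) auto
  show "norm (wp_term z w) \<le> 10 * R * (1 / norm w ^ 3)" if "w \<in> L - cball 0 (2 * R)" for w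
    using that assms by (intro norm_wp_term_le) auto
qed

lemma summable_wp_term: "wp_term z summable_on L"
proof -
  have "wp_term z summable_on ((L - cball 0 (2 * (norm z + 1))) \<union> (L \<inter> cball 0 (2 * (norm z + 1))))"
    using finite_lattice_cball[OF np]
    by (intro summable_on_Un_disjoint summable_wp_term_tail) (auto intro: add_nonneg_pos)
  also have "(L - cball 0 (2 * (norm z + 1))) \<union> (L \<inter> cball 0 (2 * (norm z + 1))) = L" by auto
  finally show ?thesis .
qed

lemma wp_eq: "wp z = infsum (wp_term z) L"
proof -
  have s: "wp_term z summable_on (L - {0})" by (rule summable_on_subset_banach[OF summable_wp_term]) auto
  have "infsum (wp_term z) ({0} \<union> (L - {0})) = infsum (wp_term z) {0} + infsum (wp_term z) (L - {0})"
    using s by (intro infsum_Un_disjoint) auto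
  moreover have "{0} \<union> (L - {0}) = L" by auto
  moreover have "infsum (wp_term z) (L - {0}) = (\<Sum>\<^sub>\<infinity>w\<in>L - {0}. 1 / (z - w) ^ 2 - 1 / w ^ 2)"
    by (simp add: wp_term_def[abs_def])
  ultimately show ?thesis by (simp add: weierstrass_p_def wp_term_def)
qed

text \<open>The remainder after the finitely many terms with |w| \<le> 2 R. Those terms carry all
  singularities in the disc of radius R, and the factor 2 is what the majorant for the other terms
  requires.\<close>

definition wp_tail :: "real \<Rightarrow> complex \<Rightarrow> complex" where
  "wp_tail R z = infsum (wp_term z) (L - cball 0 (2 * R))"

lemma wp_split:
  assumes "R > 0" "norm z \<le> R"
  shows "wp z = (\<Sum>w\<in>L \<inter> cball 0 (2 * R). wp_term z w) + wp_tail R z"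
proof -
  have "infsum (wp_term z) ((L \<inter> cball 0 (2 * R)) \<union> (L - cball 0 (2 * R)))
      = infsum (wp_term z) (L \<inter> cball 0 (2 * R)) + wp_tail R z"
    unfolding wp_tail_def using finite_lattice_cball[OF np]
    by (intro infsum_Un_disjoint summable_wp_term_tail assms) auto
  thus ?thesis using finite_lattice_cball[OF np] by (simp add: wp_eq Int_Diff_Un)
qed

text \<open>The majorant of the terms does not depend on z, so the finite partial sums converge
  uniformly by the Weierstrass test.\<close>

lemma wp_tail_holomorphic:
  assumes "R > 0"
  shows "wp_tail R holomorphic_on ball 0 R"
proof -
  let ?X = "L - cball 0 (2 * R)"
  have sum: "(\<lambda>w. 10 * R * (1 / norm w ^ 3)) summable_on ?X"
    by (intro summable_on_cmult_right summable_on_subset_banach[OF summable_lattice_cubes[OF np]]) auto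
  have lim: "uniform_limit (cball 0 R) (\<lambda>X z. \<Sum>w\<in>X. wp_term z w) (wp_tail R) (finite_subsets_at_top ?X)"
    unfolding wp_tail_def
  proof (rule Weierstrass_m_test_general[OF _ sum])
    show "norm (wp_term z w) \<le> 10 * R * (1 / norm w ^ 3)" if "w \<in> ?X" "z \<in> cball 0 R" for w z
      using that assms by (intro norm_wp_term_le) auto
  qed
  have hol: "(\<lambda>z. \<Sum>w\<in>X. wp_term z w) holomorphic_on cball 0 R" if "X \<subseteq> ?X" for X
    unfolding wp_term_def using that assms by (intro holomorphic_intros) force+
  show ?thesis
  proof (rule holomorphic_uniform_limit[OF _ lim])
    show "\<forall>\<^sub>F X in finite_subsets_at_top ?X. continuous_on (cball 0 R) (\<lambda>z. \<Sum>w\<in>X. wp_term z w) \<and>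
            (\<lambda>z. \<Sum>w\<in>X. wp_term z w) holomorphic_on ball 0 R"
      by (rule eventually_finite_subsets_at_top_weakI)
        (auto intro!: holomorphic_on_imp_continuous_on hol intro: holomorphic_on_subset[OF hol])
  qed auto
qed

lemma wp_tail_analytic:
  assumes "norm z < R"
  shows "wp_tail R analytic_on {z}"
proof -
  have "R > 0" using assms norm_ge_zero[of z] by linarith
  hence "wp_tail R analytic_on ball 0 R" using wp_tail_holomorphic by (simp add: analytic_on_open)
  thus ?thesis by (rule analytic_on_subset) (use assms in auto)
qed

lemma eventually_norm_less: "norm (z :: complex) < R \<Longrightarrow> \<forall>\<^sub>F w in nhds z. norm w < R"
  by (rule order_tendstoD(2)[OF tendsto_norm[OF filterlim_ident]])

lemma wp_analytic:
  assumes "z \<notin> L"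
  shows "wp analytic_on {z}"
proof -
  define R where "R = norm z + 1"
  have R: "R > 0" "norm z < R" by (auto simp: R_def intro: add_nonneg_pos)
  have "(\<lambda>z. (\<Sum>w\<in>L \<inter> cball 0 (2 * R). wp_term z w) + wp_tail R z) analytic_on {z}"
    unfolding wp_term_def using assms
    by (intro analytic_intros wp_tail_analytic R) auto
  also have "?this \<longleftrightarrow> ?thesis"
    by (intro analytic_at_cong refl eventually_mono[OF eventually_norm_less[OF R(2)]])
      (use R in \<open>simp add: wp_split[of R]\<close>)
  finally show ?thesis .
qed

lemma wp_meromorphic: "wp meromorphic_on UNIV"
proof (subst meromorphic_on_meromorphic_at, rule ballI)
  fix z :: complex
  define R where "R = norm z + 1"
  have R: "R > 0" "norm z < R" by (auto simp: R_def intro: add_nonneg_pos)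
  have "(\<lambda>z. (\<Sum>w\<in>L \<inter> cball 0 (2 * R). wp_term z w) + wp_tail R z) meromorphic_on {z}"
    unfolding wp_term_def
    by (intro meromorphic_intros analytic_on_imp_meromorphic_on wp_tail_analytic R)
  also have "?this \<longleftrightarrow> wp meromorphic_on {z}"
  proof (intro meromorphic_on_cong refl)
    fix z' assume "z' \<in> {z}"
    thus "\<forall>\<^sub>F w in at z'. (\<Sum>wa\<in>L \<inter> cball 0 (2 * R). wp_term w wa) + wp_tail R w = wp w"
      using eventually_norm_less[OF R(2)] R
      by (auto simp: eventually_at_filter elim!: eventually_mono simp: wp_split[of R])
  qed
  finally show "wp meromorphic_on {z}" .
qed

text \<open>In the splitting for R = 1 only the term for w = 0 is singular at 0, and it equals 1 /
  z^2 because 1 / 0 = 0.\<close>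

lemma wp_near_0:
  obtains g where "g analytic_on {0}" "\<forall>\<^sub>F z in at 0. wp z = 1 / z\<^sup>2 + g z"
proof -
  define g where "g = (\<lambda>z. (\<Sum>w\<in>L \<inter> cball 0 2 - {0}. wp_term z w) + wp_tail 1 z)"
  have "g analytic_on {0}" unfolding g_def wp_term_def
    by (intro analytic_intros wp_tail_analytic) auto
  moreover have "wp z = 1 / z\<^sup>2 + g z" if "norm z < 1" for z
    using that finite_lattice_cball[OF np, of 2]
    by (simp add: wp_split[of 1] g_def sum.remove[of "L \<inter> cball 0 2" 0] wp_term_def)
  hence "\<forall>\<^sub>F z in at 0. wp z = 1 / z\<^sup>2 + g z"
    using eventually_norm_less[of 0 1] by (auto simp: eventually_at_filter elim!: eventually_mono)
  ultimately show ?thesis using that by blast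
qed

lemma wp_limit_0: "((\<lambda>z. z ^ 2 * wp z) \<longlongrightarrow> 1) (at 0)"
proof -
  obtain g where g: "g analytic_on {0}" "\<forall>\<^sub>F z in at 0. wp z = 1 / z\<^sup>2 + g z" by (rule wp_near_0)
  have "(g \<longlongrightarrow> g 0) (at 0)" using g(1) analytic_at_imp_isCont isContD by blast
  hence "((\<lambda>z. 1 + z ^ 2 * g z) \<longlongrightarrow> 1 + 0 ^ 2 * g 0) (at 0)" by (intro tendsto_intros)
  moreover have "\<forall>\<^sub>F z in at 0. 1 + z ^ 2 * g z = z ^ 2 * wp z"
    using g(2) eventually_neq_at_within[of 0 0 UNIV] by eventually_elim (simp add: field_simps)
  ultimately show ?thesis by (simp add: tendsto_cong)
qed

lemma wp'_limit_0: "((\<lambda>z. z ^ 3 * deriv wp z) \<longlongrightarrow> - 2) (at 0)"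
proof -
  obtain g where g: "g analytic_on {0}" "\<forall>\<^sub>F z in at 0. wp z = 1 / z\<^sup>2 + g z" by (rule wp_near_0)
  have g': "deriv g analytic_on {0}" by (intro analytic_intros g)
  \<comment> \<open>The derivative at z depends on \<wp> in a neighbourhood of z, so the expansion
    is needed around every z \<noteq> 0 near 0, not just at z.\<close>
  have "\<forall>\<^sub>F z in nhds 0. \<forall>\<^sub>F w in nhds z. w \<noteq> 0 \<longrightarrow> wp w = 1 / w\<^sup>2 + g w"
    using g(2) by (simp add: eventually_eventually eventually_at_filter)
  hence "\<forall>\<^sub>F z in at 0. \<forall>\<^sub>F w in nhds z. w \<noteq> 0 \<and> wp w = 1 / w\<^sup>2 + g w"
    unfolding eventually_at_filter
  proof (rule eventually_mono, intro impI)
    fix z :: complex assume "\<forall>\<^sub>F w in nhds z. w \<noteq> 0 \<longrightarrow> wp w = 1 / w\<^sup>2 + g w" "z \<noteq> 0"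
    thus "\<forall>\<^sub>F w in nhds z. w \<noteq> 0 \<and> wp w = 1 / w\<^sup>2 + g w"
      using t1_space_nhds[of z 0] by (auto elim: eventually_elim2)
  qed
  hence ev: "\<forall>\<^sub>F z in at 0. z ^ 3 * deriv wp z = - 2 + z ^ 3 * deriv g z"
  proof (rule eventually_elim2)
    show "\<forall>\<^sub>F z in at 0. g analytic_on {z}"
    proof -
      obtain S where S: "open S" "0 \<in> S" "g holomorphic_on S" using g(1) analytic_at by blast
      hence "\<forall>\<^sub>F z in at 0. z \<in> S" by (intro eventually_at_in_open')
      thus ?thesis by eventually_elim (use S analytic_at in blast)
    qed
    fix z assume z: "\<forall>\<^sub>F w in nhds z. w \<noteq> 0 \<and> wp w = 1 / w\<^sup>2 + g w" "g analytic_on {z}"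
    have z0: "z \<noteq> 0" using eventually_nhds_x_imp_x[OF z(1)] by blast
    have "(g has_field_derivative deriv g z) (at z)"
      using z(2) analytic_on_imp_differentiable_at DERIV_deriv_iff_field_differentiable by blast
    hence "((\<lambda>w. 1 / w\<^sup>2 + g w) has_field_derivative - 2 / z ^ 3 + deriv g z) (at z)"
      using z0 by (auto intro!: derivative_eq_intros simp: field_simps power2_eq_square power3_eq_cube)
    hence "deriv (\<lambda>w. 1 / w\<^sup>2 + g w) z = - 2 / z ^ 3 + deriv g z" by (rule DERIV_imp_deriv)
    moreover have "deriv wp z = deriv (\<lambda>w. 1 / w\<^sup>2 + g w) z"
      using z(1) by (intro deriv_cong_ev refl) (auto elim: eventually_mono)
    ultimately show "z ^ 3 * deriv wp z = - 2 + z ^ 3 * deriv g z"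
      using z0 by (simp add: field_simps)
  qed
  have "(deriv g \<longlongrightarrow> deriv g 0) (at 0)" using g' analytic_at_imp_isCont isContD by blast
  hence "((\<lambda>z. - 2 + z ^ 3 * deriv g z) \<longlongrightarrow> - 2 + 0 ^ 3 * deriv g 0) (at 0)" by (intro tendsto_intros)
  thus ?thesis using ev by (simp add: tendsto_cong)
qed

subsection \<open>Periodicity and symmetries\<close>

text \<open>The correction terms 1 / w^2 cancel in the difference \<wp>(z + u) - \<wp>(z), which
  leaves a double series with integer indices.\<close>

lemma wp_term_diff_summable:
  "(\<lambda>(m :: int, n :: int). 1 / (z + u - (of_int m * u + of_int n * v))\<^sup>2 - 1 / (z - (of_int m * u + of_int n * v))\<^sup>2)
      summable_on UNIV"
proof -
  have "(\<lambda>w. wp_term (z + u) w + - wp_term z w) summable_on L"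
    by (intro summable_on_add) (simp_all add: summable_wp_term summable_on_uminus)
  hence "((\<lambda>w. wp_term (z + u) w - wp_term z w) \<circ> (\<lambda>(m :: int, n :: int). of_int m * u + of_int n * v)) summable_on UNIV"
    unfolding lattice_eq_image by (subst (asm) summable_on_reindex) (use nonparallel_inj[OF np] in auto)
  thus ?thesis by (simp add: o_def case_prod_unfold wp_term_def)
qed

end

text \<open>The sum for \<open>\<wp>(z + u) - \<wp>(z)\<close> telescopes when it is taken along multiples of \<open>u\<close> first.\<close>

lemma wp_basis_period:
  assumes "nonparallel u v"
  shows "weierstrass_p (lattice u v) (z + u) = weierstrass_p (lattice u v) z"
proof -
  interpret plane_lattice u v by standard fact
  have "wp (z + u) - wp z = (\<Sum>\<^sub>\<infinity>w\<in>L. wp_term (z + u) w - wp_term z w)"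
    using infsum_add[of "wp_term (z + u)" L "\<lambda>w. - wp_term z w"]
    by (simp add: wp_eq summable_wp_term summable_on_uminus infsum_uminus)
  also have "\<dots> = infsum ((\<lambda>w. wp_term (z + u) w - wp_term z w) \<circ> (\<lambda>(m :: int, n :: int). of_int m * u + of_int n * v)) UNIV"
    unfolding lattice_eq_image by (rule infsum_reindex) (use nonparallel_inj[OF np] in auto)
  also have "\<dots> = infsum (\<lambda>(m :: int, n :: int). 1 / (z + u - (of_int m * u + of_int n * v))\<^sup>2
        - 1 / (z - (of_int m * u + of_int n * v))\<^sup>2) (UNIV \<times> UNIV)"
    by (simp add: o_def case_prod_unfold wp_term_def)
  also have "\<dots> = infsum (\<lambda>n :: int. infsum (\<lambda>m :: int. 1 / (z + u - (of_int m * u + of_int n * v))\<^sup>2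
        - 1 / (z - (of_int m * u + of_int n * v))\<^sup>2) UNIV) UNIV"
    (is "infsum (\<lambda>(m, n). ?T m n) _ = _")
  proof -
    \<comment> \<open>Summability on the product permits iterated sums in either order. The
      telescoping takes place in m, which therefore has to become the inner index.\<close>
    have S: "(\<lambda>(m, n). ?T m n) summable_on UNIV \<times> UNIV" using wp_term_diff_summable by simp
    have "infsum (\<lambda>(m, n). ?T m n) (UNIV \<times> UNIV) = (\<Sum>\<^sub>\<infinity>m. \<Sum>\<^sub>\<infinity>n. ?T m n)"
      by (rule infsum_Sigma'_banach[OF S, symmetric])
    also have "\<dots> = (\<Sum>\<^sub>\<infinity>n. \<Sum>\<^sub>\<infinity>m. ?T m n)" by (rule infsum_swap_banach[OF S])
    finally show ?thesis .
  qed
  also have "\<dots> = infsum (\<lambda>n :: int. 0) (UNIV :: int set)"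
  proof (rule infsum_cong)
    fix n :: int
    \<comment> \<open>Lowering z + u to z amounts to raising m by 1. This also holds when a
      denominator vanishes, so poles need no separate treatment.\<close>
    define a where "a = (\<lambda>m :: int. 1 / (z + u - (of_int m * u + of_int n * v))\<^sup>2)"
    have eq: "1 / (z + u - (of_int m * u + of_int n * v))\<^sup>2 - 1 / (z - (of_int m * u + of_int n * v))\<^sup>2
        = a m - a (m + 1)" for m by (simp add: a_def algebra_simps)
    have "(\<lambda>mn. case mn of (m, n) \<Rightarrow> 1 / (z + u - (of_int m * u + of_int n * v))\<^sup>2 - 1 / (z - (of_int m * u + of_int n * v))\<^sup>2)
       summable_on (\<lambda>m. (m, n)) ` UNIV"
      by (rule summable_on_subset_banach[OF wp_term_diff_summable]) auto
    hence "(\<lambda>m. a m - a (m + 1)) summable_on UNIV"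
      by (subst (asm) summable_on_reindex) (auto simp: inj_on_def o_def eq)
    moreover have u0: "u \<noteq> 0" using np by (auto simp: nonparallel_iff)
    \<comment> \<open>By the triangle inequality the norm is at least |m| |u| minus a constant, so
      it tends to infinity in both directions.\<close>
    have lim: "filterlim (\<lambda>m. norm (z + u - (of_int m * u + of_int n * v))) at_top F"
      if "filterlim (\<lambda>m. \<bar>of_int m :: real\<bar>) at_top F" for F
    proof (rule filterlim_at_top_mono)
      show "filterlim (\<lambda>m. - norm (z + u - of_int n * v) + norm u * \<bar>of_int m :: real\<bar>) at_top F"
        using u0 that by (intro filterlim_tendsto_add_at_top[OF tendsto_const] filterlim_tendsto_pos_mult_at_top[OF tendsto_const]) auto
      have "norm (of_int m * u) \<le> norm (z + u - of_int n * v) + norm (z + u - (of_int m * u + of_int n * v))" for m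
        using norm_triangle_ineq4[of "z + u - of_int n * v" "z + u - (of_int m * u + of_int n * v)"]
        by (simp add: algebra_simps)
      thus "\<forall>\<^sub>F m in F. - norm (z + u - of_int n * v) + norm u * \<bar>of_int m :: real\<bar>
          \<le> norm (z + u - (of_int m * u + of_int n * v))"
        by (intro always_eventually) (simp add: norm_mult algebra_simps)
    qed
    have "(a \<longlongrightarrow> 0) F" if F: "filterlim (\<lambda>m. \<bar>of_int m :: real\<bar>) at_top F" for F
    proof (rule tendsto_norm_zero_cancel)
      have "filterlim (\<lambda>m. norm (z + u - (of_int m * u + of_int n * v)) ^ 2) at_top F"
        by (intro filterlim_pow_at_top lim[OF F]) auto
      hence "((\<lambda>m. inverse (norm (z + u - (of_int m * u + of_int n * v)) ^ 2)) \<longlongrightarrow> 0) F"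
        by (rule tendsto_inverse_0_at_top)
      thus "((\<lambda>m. norm (a m)) \<longlongrightarrow> 0) F" by (simp add: a_def norm_inverse norm_power divide_inverse)
    qed
    moreover have "filterlim (\<lambda>m :: int. \<bar>of_int m :: real\<bar>) at_top at_top"
      by (rule filterlim_compose[OF filterlim_abs_real filterlim_real_of_int_at_top])
    moreover have "filterlim (\<lambda>m :: int. \<bar>of_int m :: real\<bar>) at_top at_bot"
      unfolding filterlim_at_top
    proof
      fix Z :: real
      show "\<forall>\<^sub>F m :: int in at_bot. Z \<le> \<bar>of_int m\<bar>"
        by (rule eventually_mono[OF eventually_le_at_bot[of "- \<lceil>Z\<rceil>"]]) linarith
    qed
    ultimately show "infsum (\<lambda>m :: int. 1 / (z + u - (of_int m * u + of_int n * v))\<^sup>2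
        - 1 / (z - (of_int m * u + of_int n * v))\<^sup>2) UNIV = 0"
      unfolding eq by (intro infsum_int_telescope) blast+
  qed
  finally show ?thesis by simp
qed

lemma lattice_commute: "lattice u v = lattice v u"
  by (rule lattice_eqI) (rule lattice_basis1 lattice_basis2)+

lemma nonparallel_commute: "nonparallel u v \<longleftrightarrow> nonparallel v u"
  by (simp add: nonparallel_iff algebra_simps) (auto simp: algebra_simps)

context plane_lattice
begin

lemma period_lattice:
  fixes f :: "complex \<Rightarrow> 'a"
  assumes "\<And>z. f (z + u) = f z" "\<And>z. f (z + v) = f z" "w \<in> L"
  shows "f (z + w) = f z"
proof -
  have per: "f (z + of_int m * p) = f z" if p: "\<And>z. f (z + p) = f z" for z p and m :: int
  proof -
    have nat: "f (z + of_nat n * p) = f z" for z n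
    proof (induction n)
      case (Suc n)
      thus ?case using p[of "z + of_nat n * p"] by (simp add: algebra_simps)
    qed simp
    show ?thesis
    proof (cases m rule: int_cases2)
      case (nonpos n)
      thus ?thesis using nat[of "z + of_int m * p" n] by simp
    qed (use nat in simp)
  qed
  obtain m n :: int where "w = of_int m * u + of_int n * v" using assms(3) by (auto simp: lattice_def)
  thus ?thesis using per[of v "z + of_int m * u" n] per[of u z m] assms by (simp add: add.assoc)
qed

text \<open>The period v is the first generator after swapping the generators. The equation holds at
  lattice points as well.\<close>

lemma wp_period: "w \<in> L \<Longrightarrow> wp (z + w) = wp z"
proof (rule period_lattice)
  show "wp (z + u) = wp z" for z by (rule wp_basis_period[OF np])
  show "wp (z + v) = wp z" for z
    using wp_basis_period[of v u z] np by (simp add: lattice_commute[of u v] nonparallel_commute)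
qed

lemma wp'_period: 
  assumes "w \<in> L"
  shows "deriv wp (z + w) = deriv wp z"
proof -
  \<comment> \<open>\<open>deriv\<close> is a choice from the values D satisfying this predicate.
    Equal predicates give equal choices, even at the poles.\<close>
  have "(wp has_field_derivative D) (at (z + w)) \<longleftrightarrow> (wp has_field_derivative D) (at z)" for D
    using DERIV_shift[of wp D z w] wp_period[OF assms] by simp
  thus ?thesis by (simp add: deriv_def)
qed

lemma wp'_meromorphic: "deriv wp meromorphic_on UNIV"
  by (intro meromorphic_intros wp_meromorphic)

lemma wp'_analytic: "z \<notin> L \<Longrightarrow> deriv wp analytic_on {z}"
  by (intro analytic_intros wp_analytic)

text \<open>Each term is homogeneous of degree -2 in z and w jointly, and multiplication by \<rho>
  permutes the lattice.\<close>

lemma wp_rotate: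
  assumes "\<And>w. \<rho> * w \<in> L \<longleftrightarrow> w \<in> L" "\<rho> \<noteq> 0"
  shows "wp (\<rho> * z) = wp z / \<rho>\<^sup>2"
proof -
  have bij: "bij_betw (\<lambda>w. \<rho> * w) L L"
    by (rule bij_betw_byWitness[where f' = "\<lambda>w. w / \<rho>"])
      (use assms(1)[of "w / \<rho>" for w] assms in auto)
  have "wp (\<rho> * z) = (\<Sum>\<^sub>\<infinity>w\<in>L. wp_term (\<rho> * z) (\<rho> * w))"
    unfolding wp_eq by (rule infsum_reindex_bij_betw[OF bij, symmetric])
  also have "\<dots> = (\<Sum>\<^sub>\<infinity>w\<in>L. wp_term z w * (1 / \<rho>\<^sup>2))"
  proof (rule infsum_cong)
    fix w
    have eq: "\<rho> * z - \<rho> * w = \<rho> * (z - w)" by (simp add: algebra_simps)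
    show "wp_term (\<rho> * z) (\<rho> * w) = wp_term z w * (1 / \<rho>\<^sup>2)"
      unfolding wp_term_def eq power_mult_distrib by (simp add: diff_divide_distrib mult.commute)
  qed
  also have "\<dots> = wp z / \<rho>\<^sup>2" unfolding infsum_cmult_left' wp_eq by simp
  finally show ?thesis .
qed

lemma wp_cnj:
  assumes "\<And>w. cnj w \<in> L \<longleftrightarrow> w \<in> L"
  shows "wp (cnj z) = cnj (wp z)"
proof -
  have bij: "bij_betw cnj L L"
    by (rule bij_betw_byWitness[where f' = cnj]) (use assms in auto)
  have "wp (cnj z) = (\<Sum>\<^sub>\<infinity>w\<in>L. wp_term (cnj z) (cnj w))"
    unfolding wp_eq by (rule infsum_reindex_bij_betw[OF bij, symmetric])
  also have "\<dots> = (\<Sum>\<^sub>\<infinity>w\<in>L. cnj (wp_term z w))"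
    by (rule infsum_cong) (simp add: wp_term_def)
  also have "\<dots> = cnj (wp z)" by (simp add: wp_eq)
  finally show ?thesis .
qed

text \<open>Differentiate the equation for \<wp>; the chain rule contributes the third power. The
  point is kept off the lattice so that both derivatives exist.\<close>

lemma wp'_rotate:
  assumes "\<And>w. \<rho> * w \<in> L \<longleftrightarrow> w \<in> L" "\<rho> \<noteq> 0" "z \<notin> L"
  shows "deriv wp (\<rho> * z) = deriv wp z / \<rho> ^ 3"
proof -
  have "(wp has_field_derivative deriv wp (\<rho> * z)) (at (\<rho> * z))"
    using wp_analytic[of "\<rho> * z"] assms analytic_on_imp_differentiable_at DERIV_deriv_iff_field_differentiable by blast
  hence "((\<lambda>z. wp (\<rho> * z)) has_field_derivative deriv wp (\<rho> * z) * \<rho>) (at z)"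
    by (rule DERIV_chain2) (auto intro!: derivative_eq_intros)
  hence 1: "((\<lambda>z. wp z / \<rho>\<^sup>2) has_field_derivative deriv wp (\<rho> * z) * \<rho>) (at z)"
    using wp_rotate[OF assms(1,2)] by simp
  have "(wp has_field_derivative deriv wp z) (at z)"
    using wp_analytic[of z] assms analytic_on_imp_differentiable_at DERIV_deriv_iff_field_differentiable by blast
  hence "((\<lambda>z. wp z / \<rho>\<^sup>2) has_field_derivative deriv wp z / \<rho>\<^sup>2) (at z)"
    by (rule DERIV_cdivide)
  with 1 have "deriv wp (\<rho> * z) * \<rho> = deriv wp z / \<rho>\<^sup>2" by (rule DERIV_unique)
  thus ?thesis using assms(2) by (simp add: field_simps power2_eq_square power3_eq_cube)
qed

lemma wp'_cnj:
  assumes "\<And>w. cnj w \<in> L \<longleftrightarrow> w \<in> L" "z \<notin> L"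
  shows "deriv wp (cnj z) = cnj (deriv wp z)"
proof -
  have "(wp has_field_derivative deriv wp z) (at z)"
    using wp_analytic[of z] assms analytic_on_imp_differentiable_at DERIV_deriv_iff_field_differentiable by blast
  hence "((cnj \<circ> wp \<circ> cnj) has_field_derivative cnj (deriv wp z)) (at (cnj z))"
    by (simp add: has_field_derivative_cnj_cnj)
  moreover have "cnj \<circ> wp \<circ> cnj = wp" using wp_cnj[OF assms(1)] by auto
  ultimately show ?thesis by (simp add: DERIV_imp_deriv)
qed

end


section \<open>Equality almost everywhere and local behaviour of meromorphic functions\<close>

text \<open>Almost everywhere thus means on a punctured neighbourhood of every point, which is the
  form in which limits can use it.\<close>

lemma ae_iff: "(\<forall>\<^sub>\<approx>z. P z) \<longleftrightarrow> (\<forall>x. eventually P (at x))"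
  by (simp add: eventually_cosparse_open_eq)

lemma ae_at: "(\<forall>\<^sub>\<approx>z. P z) \<Longrightarrow> eventually P (at x)"
  by (simp add: ae_iff)

text \<open>Injectivity makes g map punctured neighbourhoods into punctured neighbourhoods.\<close>

lemma ae_compose:
  fixes g :: "complex \<Rightarrow> complex"
  assumes "\<forall>\<^sub>\<approx>z. P z" "continuous_on UNIV g" "inj g"
  shows "\<forall>\<^sub>\<approx>z. P (g z)"
  unfolding ae_iff
proof
  fix x
  have "g \<midarrow>x\<rightarrow> g x" using assms(2) by (simp add: continuous_on_eq_continuous_at isContD)
  moreover have "\<forall>\<^sub>F z in at x. g z \<noteq> g x"
    using eventually_neq_at_within[of x x UNIV] by eventually_elim (use assms(3) in \<open>auto dest: injD\<close>)
  ultimately have "filterlim g (at (g x)) (at x)" by (simp add: filterlim_at)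
  thus "\<forall>\<^sub>F z in at x. P (g z)"
    by (rule eventually_compose_filterlim[OF ae_at[OF assms(1)]])
qed

lemma ae_affine:
  fixes a b :: complex
  assumes "\<forall>\<^sub>\<approx>z. P z" "a \<noteq> 0"
  shows "\<forall>\<^sub>\<approx>z. P (a * z + b)"
  by (rule ae_compose[OF assms(1)]) (use assms(2) in \<open>auto intro!: continuous_intros injI\<close>)

lemma ae_scale: "\<forall>\<^sub>\<approx>z. P z \<Longrightarrow> a \<noteq> 0 \<Longrightarrow> \<forall>\<^sub>\<approx>z :: complex. P (a * z)"
  using ae_affine[of P a 0] by simp

lemma ae_cnj: "\<forall>\<^sub>\<approx>z. P z \<Longrightarrow> \<forall>\<^sub>\<approx>z. P (cnj z)"
  by (rule ae_compose) (auto intro!: continuous_intros injI)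

lemma ae_exists: "\<forall>\<^sub>\<approx>z :: complex. P z \<Longrightarrow> \<exists>z. P z"
  by (meson ae_at at_neq_bot eventually_happens')

text \<open>The limit l \<noteq> 0 is the leading Laurent coefficient at a pole; pole orders are
  handled through such limits only.\<close>

lemma meromorphic_limit_or_pole_order:
  assumes "f meromorphic_on {a}"
  shows "(\<exists>l. f \<midarrow>a\<rightarrow> l) \<or> (\<exists>n l. n > 0 \<and> l \<noteq> 0 \<and> (\<lambda>z. (z - a) ^ n * f z) \<midarrow>a\<rightarrow> l)"
proof (cases "is_pole f a")
  case False
  thus ?thesis using assms by (auto simp: meromorphic_at_iff not_essential_def)
next
  case True
  from assms obtain S where S: "open S" "a \<in> S" "f holomorphic_on S - {a}"
    by (metis analytic_imp_holomorphic isolated_singularity_at_iff_analytic_nhd meromorphic_at_iff)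
  define n where "n = nat (- zorder f a)"
  define g where "g = zor_poly f a"
  from zorder_exist_pole[OF S(3,1,2) True] obtain r where r: "zorder f a < 0" "g a \<noteq> 0" "r > 0"
    "g holomorphic_on cball a r" "\<forall>w\<in>cball a r - {a}. f w = g w / (w - a) ^ n \<and> g w \<noteq> 0"
    unfolding g_def n_def by blast
  have "g holomorphic_on ball a r" using r(4) by (rule holomorphic_on_subset) auto
  hence "isCont g a" using r(3) 
    by (metis analytic_at_imp_isCont centre_in_ball holomorphic_on_imp_analytic_at open_ball)
  hence "g \<midarrow>a\<rightarrow> g a" by (rule isContD)
  moreover have "\<forall>\<^sub>F w in at a. g w = (w - a) ^ n * f w"
    using eventually_at_ball'[OF r(3), of a UNIV] by eventually_elim (use r(5) in auto)
  ultimately have "(\<lambda>z. (z - a) ^ n * f z) \<midarrow>a\<rightarrow> g a" by (rule Lim_transform_eventually)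
  moreover have "n > 0" using r(1) by (simp add: n_def)
  ultimately show ?thesis using r(2) by blast
qed

lemma meromorphic_cancel_pole:
  assumes "f meromorphic_on {a}"
  obtains n :: nat and l where "(\<lambda>z. (z - a) ^ n * f z) \<midarrow>a\<rightarrow> l"
proof -
  from meromorphic_limit_or_pole_order[OF assms] show ?thesis
  proof
    assume "\<exists>l. f \<midarrow>a\<rightarrow> l"
    then obtain l where "f \<midarrow>a\<rightarrow> l" by blast
    thus ?thesis using that[of 0] by simp
  qed (use that in blast)
qed

text \<open>At a pole of order n, (z - a)^n f would have a nonzero limit, yet it is (z - a)^(n - 1)
  times a function tending to 0. This serves to lower an exponent by one.\<close>

lemma meromorphic_removable:
  assumes "f meromorphic_on {a}" "(\<lambda>z. (z - a) * f z) \<midarrow>a\<rightarrow> 0"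
  shows "\<exists>l. f \<midarrow>a\<rightarrow> l"
  using meromorphic_limit_or_pole_order[OF assms(1)]
proof
  assume "\<exists>n l. n > 0 \<and> l \<noteq> 0 \<and> (\<lambda>z. (z - a) ^ n * f z) \<midarrow>a\<rightarrow> l"
  then obtain n l where nl: "n > 0" "l \<noteq> 0" "(\<lambda>z. (z - a) ^ n * f z) \<midarrow>a\<rightarrow> l" by blast
  have "(\<lambda>z. (z - a) ^ (n - 1) * ((z - a) * f z)) \<midarrow>a\<rightarrow> (a - a) ^ (n - 1) * 0"
    by (intro tendsto_mult tendsto_power tendsto_diff tendsto_const tendsto_ident_at assms(2))
  moreover have "(z - a) ^ (n - 1) * ((z - a) * f z) = (z - a) ^ n * f z" for z
    using nl(1) by (cases n) simp_all
  ultimately have "(\<lambda>z. (z - a) ^ n * f z) \<midarrow>a\<rightarrow> 0" by (simp only: mult_zero_right)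
  with nl have False using LIM_unique by blast
  thus ?thesis ..
qed

lemma meromorphic_on_poly: "f meromorphic_on A \<Longrightarrow> (\<lambda>z. poly p (f z)) meromorphic_on A"
  by (induction p) (auto intro!: meromorphic_intros)

lemma meromorphic_on_rational:
  "f meromorphic_on A \<Longrightarrow> (\<lambda>z. poly p (f z) / poly q (f z)) meromorphic_on A"
  by (intro meromorphic_intros meromorphic_on_poly)

lemma meromorphic_at_subset: "f meromorphic_on UNIV \<Longrightarrow> f meromorphic_on A"
  by (rule meromorphic_on_subset) auto

lemma meromorphic_on_affine: "f meromorphic_on UNIV \<Longrightarrow> (\<lambda>z. f (a * z + b)) meromorphic_on UNIV"
  by (rule meromorphic_on_compose) (auto intro!: analytic_intros)


section \<open>Functions periodic with respect to a lattice\<close>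

context plane_lattice
begin

text \<open>The period parallelogram is taken closed: compactness matters, uniqueness of
  representatives does not.\<close>

definition cell :: "complex set" where
  "cell = (\<lambda>(s, t). of_real s * u + of_real t * v) ` ({0..1} \<times> {0..1})"

lemma compact_cell: "compact cell"
  unfolding cell_def case_prod_unfold
  by (intro compact_continuous_image compact_Times continuous_intros) auto

lemma lattice_shift_into_cell: obtains w where "w \<in> L" "z + w \<in> cell"
proof -
  obtain s t :: real where st: "z = of_real s * u + of_real t * v" by (rule nonparallel_span[OF np])
  define w where "w = of_int (- \<lfloor>s\<rfloor>) * u + of_int (- \<lfloor>t\<rfloor>) * v"
  have "z + w = of_real (frac s) * u + of_real (frac t) * v"
    by (simp add: st w_def frac_def algebra_simps)
  hence "z + w \<in> cell" unfolding cell_def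
    by (intro image_eqI[of _ _ "(frac s, frac t)"]) (auto simp: frac_lt_1 less_imp_le)
  moreover have "w \<in> L" unfolding w_def lattice_def by blast
  ultimately show ?thesis using that by blast
qed

text \<open>The exceptional set may depend on the period w.\<close>

definition ae_periodic :: "(complex \<Rightarrow> complex) \<Rightarrow> bool" where
  "ae_periodic f \<longleftrightarrow> (\<forall>w\<in>L. \<forall>\<^sub>\<approx>z. f (z + w) = f z)"

text \<open>The function g may depend on z so that factors such as (z - a)^n are translated along
  with f.\<close>

lemma ae_periodic_tendsto:
  assumes "ae_periodic f" "w \<in> L" "((\<lambda>z. g z (f z)) \<longlongrightarrow> l) (at (a + w))"
  shows "((\<lambda>z. g (z + w) (f z)) \<longlongrightarrow> l) (at a)"
proof -
  have "((\<lambda>z. g (z + w) (f (z + w))) \<longlongrightarrow> l) (at a)"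
    using LIM_offset[OF assms(3), of w] by simp
  moreover have "\<forall>\<^sub>F z in at a. g (z + w) (f (z + w)) = g (z + w) (f z)"
    using ae_at[of "\<lambda>z. f (z + w) = f z" a] assms(1,2) unfolding ae_periodic_def
    by (auto elim: eventually_mono)
  ultimately show ?thesis by (rule Lim_transform_eventually)
qed

text \<open>Removing the singularities gives an entire function that is periodic at every point. Its
  values are those on the compact cell, so it is bounded and Liouville's theorem applies.\<close>

lemma ae_periodic_no_poles_const:
  assumes mero: "f meromorphic_on UNIV" and per: "ae_periodic f" and lim: "\<And>a. \<exists>l. f \<midarrow>a\<rightarrow> l"
  shows "\<exists>c. \<forall>\<^sub>\<approx>z. f z = c"
proof -
  define G where "G = remove_sings f"
  have iso: "isolated_singularity_at f a" for a
    using meromorphic_at_subset[OF mero, of "{a}"] by (simp add: meromorphic_at_iff)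
  have "G analytic_on {a}" for a
    unfolding G_def using remove_sings_analytic_at[OF iso] lim[of a] by blast
  hence hol: "G holomorphic_on UNIV"
    using analytic_imp_holomorphic analytic_on_analytic_at by blast
  have G_per: "G (a + w) = G a" if "w \<in> L" for a w
  proof -
    obtain l where l: "f \<midarrow>a + w\<rightarrow> l" using lim by blast
    hence "f \<midarrow>a\<rightarrow> l" using ae_periodic_tendsto[OF per that, of "\<lambda>_ x. x" l a] by simp
    thus ?thesis using l unfolding G_def by (metis remove_sings_eqI)
  qed
  have "range G \<subseteq> G ` cell"
  proof
    fix y assume "y \<in> range G"
    then obtain z where z: "y = G z" by blast
    obtain w where "w \<in> L" "z + w \<in> cell" by (rule lattice_shift_into_cell)
    thus "y \<in> G ` cell" using z G_per by (metis image_eqI)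
  qed
  moreover have "compact (G ` cell)"
    using compact_cell hol by (intro compact_continuous_image)
      (auto intro: continuous_on_subset holomorphic_on_imp_continuous_on)
  ultimately have "bounded (range G)" using compact_imp_bounded bounded_subset by blast
  then obtain c where "\<And>z. G z = c" using Liouville_theorem[OF hol] unfolding constant_on_def by blast
  moreover have "\<forall>\<^sub>\<approx>z. G z = f z" unfolding G_def by (rule eventually_remove_sings_eq[OF mero])
  ultimately have "\<forall>\<^sub>\<approx>z. f z = c" by (auto elim: eventually_mono)
  thus ?thesis by blast
qed

end

text \<open>The following locale captures what \<open>\<wp>\<close>, \<open>\<wp>'\<close> and their powers have in common.\<close>

locale lattice_function = plane_lattice +
  fixes h :: "complex \<Rightarrow> complex" and d :: nat and c :: complex
  assumes h_mero: "h meromorphic_on UNIV"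
    and h_analytic: "z \<notin> L \<Longrightarrow> h analytic_on {z}"
    and h_period: "w \<in> L \<Longrightarrow> h (z + w) = h z"
    and h_limit: "(\<lambda>z. z ^ d * h z) \<midarrow>0\<rightarrow> c" and c_nz: "c \<noteq> 0" and d_pos: "d > 0"
begin

lemma h_at_infinity: "filterlim h at_infinity (at 0)"
proof -
  have "filterlim (\<lambda>z. (z ^ d * h z) / z ^ d) at_infinity (at 0)"
  proof (rule filterlim_divide_at_infinity[OF h_limit _ c_nz])
    have "(\<lambda>z :: complex. z ^ d) \<midarrow>0\<rightarrow> 0 ^ d" by (intro tendsto_intros)
    hence "(\<lambda>z :: complex. z ^ d) \<midarrow>0\<rightarrow> 0" unfolding zero_power[OF d_pos] .
    moreover have "\<forall>\<^sub>F z in at (0 :: complex). z ^ d \<noteq> 0"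
      using eventually_neq_at_within[of 0 0 UNIV] by (rule eventually_mono) simp
    ultimately show "filterlim (\<lambda>z :: complex. z ^ d) (at 0) (at 0)" by (rule filterlim_atI)
  qed
  moreover have "\<forall>\<^sub>F z in at 0. (z ^ d * h z) / z ^ d = h z"
    using eventually_neq_at_within[of 0 0 UNIV] by eventually_elim simp
  ultimately show ?thesis by (rule filterlim_cong[OF refl refl, THEN iffD1, rotated])
qed

text \<open>This says that h is transcendental over the constants: h tends to infinity at 0, while
  the roots of q are bounded.\<close>

lemma ae_poly_h_nonzero:
  assumes "q \<noteq> 0"
  shows "\<forall>\<^sub>\<approx>z. poly q (h z) \<noteq> 0"
proof (rule ccontr)
  assume "\<not> ?thesis"
  \<comment> \<open>Identity theorem: a meromorphic function equals 0 either almost everywhere or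
    almost nowhere.\<close>
  hence "\<forall>\<^sub>\<approx>z. poly q (h z) = 0"
    using meromorphic_imp_constant_or_avoid[OF meromorphic_on_poly[OF h_mero], of q 0] by auto
  hence "\<forall>\<^sub>F z in at 0. poly q (h z) = 0" by (rule ae_at)
  moreover have "\<forall>\<^sub>F z in at 0. poly q (h z) \<noteq> 0"
  proof -
    have "bounded {x. poly q x = 0}" using poly_roots_finite[OF assms] by (rule finite_imp_bounded)
    then obtain B where B: "\<And>x. poly q x = 0 \<Longrightarrow> norm x \<le> B" by (auto simp: bounded_iff)
    have "\<forall>\<^sub>F x in at_infinity. poly q x \<noteq> 0"
      unfolding eventually_at_infinity by (intro exI[of _ "B + 1"]) (use B in force)
    thus ?thesis by (rule eventually_compose_filterlim[OF _ h_at_infinity])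
  qed
  ultimately have "\<forall>\<^sub>F z in at (0 :: complex). False" by eventually_elim simp
  thus False by simp
qed

lemma ae_poly_h_eqD:
  assumes "\<forall>\<^sub>\<approx>z. poly p (h z) = poly q (h z)"
  shows "p = q"
proof (rule ccontr)
  assume "p \<noteq> q"
  hence "\<forall>\<^sub>\<approx>z. poly (p - q) (h z) \<noteq> 0" by (intro ae_poly_h_nonzero) auto
  with assms have "\<forall>\<^sub>\<approx>z :: complex. False" by eventually_elim simp
  thus False using ae_exists by blast
qed

text \<open>A pole of \<open>f\<close> at \<open>a\<close> is cancelled by a power of \<open>h - h(a)\<close>; finitely many such factors suffice by
  periodicity.\<close>

lemma clear_poles_off_lattice:
  assumes mero: "f meromorphic_on UNIV" and per: "ae_periodic f"
  obtains q where "q \<noteq> 0" "\<And>a. a \<notin> L \<Longrightarrow> \<exists>l. (\<lambda>z. poly q (h z) * f z) \<midarrow>a\<rightarrow> l"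
proof -
  have mero_at: "f meromorphic_on {a}" for a by (rule meromorphic_at_subset[OF mero])
  \<comment> \<open>Representatives of the poles to be removed; they are finitely many because poles
    are sparse and the cell is compact.\<close>
  define P where "P = {a \<in> cell. is_pole f a \<and> a \<notin> L}"
  have "{z. is_pole f z} sparse_in UNIV"
    using meromorphic_on_imp_not_pole_cosparse[OF mero] by (simp add: eventually_cosparse)
  hence "finite (cell \<inter> {z. is_pole f z})" using compact_cell
    by (meson sparse_in_compact_finite sparse_in_subset subset_UNIV)
  hence finP: "finite P" by (rule finite_subset[rotated]) (auto simp: P_def)
  have "\<exists>n l. (\<lambda>z. (z - a) ^ n * f z) \<midarrow>a\<rightarrow> l" for a
    using meromorphic_cancel_pole[OF mero_at] by metis
  then obtain n l where nl: "\<And>a. (\<lambda>z. (z - a) ^ n a * f z) \<midarrow>a\<rightarrow> l a" by metis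
  define q where "q = (\<Prod>a\<in>P. [:- h a, 1:] ^ n a)"
  have "q \<noteq> 0" using finP by (simp add: q_def)
  moreover have "\<exists>l. (\<lambda>z. poly q (h z) * f z) \<midarrow>b\<rightarrow> l" if b: "b \<notin> L" for b
  proof -
    have h_an: "h analytic_on {b}" by (rule h_analytic[OF b])
    have h_cont: "h \<midarrow>b\<rightarrow> h b" using h_an analytic_at_imp_isCont isContD by blast
    show ?thesis
    proof (cases "is_pole f b")
      case False
      then obtain l where "f \<midarrow>b\<rightarrow> l"
        using mero_at[of b] by (auto simp: meromorphic_at_iff not_essential_def)
      hence "(\<lambda>z. poly q (h z) * f z) \<midarrow>b\<rightarrow> poly q (h b) * l"
        by (intro tendsto_intros h_cont)
      thus ?thesis by blast
    next
      case True
      obtain w where w: "w \<in> L" "b + w \<in> cell" by (rule lattice_shift_into_cell)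
      define a where "a = b + w"
      have "a \<notin> L" using b w(1) by (simp add: a_def lattice_add_iff)
      moreover have "is_pole f a"
      proof (rule ccontr)
        assume "\<not> is_pole f a"
        then obtain l where "f \<midarrow>b + w\<rightarrow> l"
          using mero_at[of a] by (auto simp: a_def meromorphic_at_iff not_essential_def)
        hence "f \<midarrow>b\<rightarrow> l" using ae_periodic_tendsto[OF per w(1), of "\<lambda>_ x. x" l b] by simp
        thus False using True unfolding is_pole_def
          by (meson at_neq_bot not_tendsto_and_filterlim_at_infinity)
      qed
      ultimately have aP: "a \<in> P" using w(2) by (simp add: P_def a_def)
      \<comment> \<open>Hence the factor of q belonging to the representative a also vanishes at
        b.\<close>
      have hab: "h a = h b" using h_period[OF w(1)] by (simp add: a_def)
      define q' where "q' = (\<Prod>a\<in>P - {a}. [:- h a, 1:] ^ n a)"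
      have q: "q = [:- h a, 1:] ^ n a * q'" unfolding q_def q'_def by (rule prod.remove[OF finP aP])
      have "(\<lambda>z. ((z + w) - a) ^ n a * f z) \<midarrow>b\<rightarrow> l a"
        using ae_periodic_tendsto[OF per w(1), of "\<lambda>z x. (z - a) ^ n a * x" "l a" b] nl[of a]
        by (simp add: a_def)
      hence 1: "(\<lambda>z. (z - b) ^ n a * f z) \<midarrow>b\<rightarrow> l a" by (simp add: a_def)
      have "(h has_field_derivative deriv h b) (at b)"
        using h_an analytic_on_imp_differentiable_at DERIV_deriv_iff_field_differentiable by blast
      \<comment> \<open>The difference quotient has a finite limit, so h - h(b) absorbs a factor z -
        b, whether or not the derivative vanishes.\<close>
      hence 2: "(\<lambda>z. (h z - h b) / (z - b)) \<midarrow>b\<rightarrow> deriv h b" by (simp add: DERIV_def LIM_offset_zero_iff has_field_derivative_iff)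
      have "(\<lambda>z. ((h z - h b) / (z - b)) ^ n a * poly q' (h z) * ((z - b) ^ n a * f z))
          \<midarrow>b\<rightarrow> deriv h b ^ n a * poly q' (h b) * l a"
        by (intro tendsto_intros 1 2 h_cont)
      moreover have "\<forall>\<^sub>F z in at b. ((h z - h b) / (z - b)) ^ n a * poly q' (h z) * ((z - b) ^ n a * f z)
          = poly q (h z) * f z"
        using eventually_neq_at_within[of b b UNIV]
        by eventually_elim (simp add: q hab power_divide poly_power)
      ultimately have "(\<lambda>z. poly q (h z) * f z) \<midarrow>b\<rightarrow> deriv h b ^ n a * poly q' (h b) * l a"
        by (rule Lim_transform_eventually)
      thus ?thesis by blast
    qed
  qed
  ultimately show ?thesis using that by blast
qed

end

text \<open>Comparing leading terms in \<open>h_rotate\<close> gives \<zeta> ^ d = 1. Together with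
  \<open>\<zeta>_order\<close> this makes \<zeta> a primitive d-th root of unity, where d is the
  pole order of h.\<close>

locale lattice_generator = lattice_function +
  fixes \<zeta> :: complex
  assumes \<zeta>_nz: "\<zeta> \<noteq> 0" and \<zeta>_order: "\<zeta> ^ n = 1 \<Longrightarrow> d dvd n"
    and h_rotate: "\<forall>\<^sub>\<approx>z. h (\<zeta> * z) = h z"
begin

text \<open>By the rotational symmetry the pole order of \<open>g\<close> at \<open>0\<close> is a multiple of that of \<open>h\<close>, so that it can be
  lowered by subtracting a multiple of a power of \<open>h\<close>.\<close>

lemma poles_on_lattice_imp_poly:
  assumes "g meromorphic_on UNIV" "ae_periodic g" "\<And>a. a \<notin> L \<Longrightarrow> \<exists>l. g \<midarrow>a\<rightarrow> l"
    "\<forall>\<^sub>\<approx>z. g (\<zeta> * z) = g z" "(\<lambda>z. z ^ n * g z) \<midarrow>0\<rightarrow> l"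
  shows "\<exists>q. \<forall>\<^sub>\<approx>z. g z = poly q (h z)"
  using assms
proof (induction n arbitrary: g l)
  case 0
  have "\<exists>l. g \<midarrow>a\<rightarrow> l" for a
  proof (cases "a \<in> L")
    case True
    \<comment> \<open>Periodicity carries the finite limit at 0 to the lattice point a.\<close>
    have "g \<midarrow>a + - a\<rightarrow> l" using 0 by simp
    hence "g \<midarrow>a\<rightarrow> l"
      using ae_periodic_tendsto[OF 0(2) lattice_uminus[OF True], of "\<lambda>_ x. x" l a] by simp
    thus ?thesis by blast
  qed (use 0 in blast)
  then obtain c where "\<forall>\<^sub>\<approx>z. g z = c" using ae_periodic_no_poles_const 0 by blast
  thus ?case by (intro exI[of _ "[:c:]"]) simp
next
  case (Suc n)
  show ?case
  proof (cases "l = 0")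
    case True
    \<comment> \<open>A zero limit means that the pole order is below \<open>Suc n\<close>, so the
      exponent can be lowered without changing g.\<close>
    have "(\<lambda>z. z ^ n * g z) meromorphic_on {0}"
      by (intro meromorphic_intros meromorphic_at_subset[OF Suc.prems(1)])
    moreover have "(\<lambda>z. (z - 0) * (z ^ n * g z)) \<midarrow>0\<rightarrow> 0"
      using Suc.prems(5) True by (simp add: mult.assoc)
    ultimately obtain l' where "(\<lambda>z. z ^ n * g z) \<midarrow>0\<rightarrow> l'" using meromorphic_removable by blast
    thus ?thesis using Suc by blast
  next
    case False
    have "filterlim (\<lambda>z. \<zeta> * z) (at 0) (at 0)"
    proof -
      have "(\<lambda>z. \<zeta> * z) \<midarrow>0\<rightarrow> \<zeta> * 0" by (intro tendsto_intros)
      moreover have "\<forall>\<^sub>F z in at 0. \<zeta> * z \<noteq> 0"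
        using eventually_neq_at_within[of 0 0 UNIV] by eventually_elim (simp add: \<zeta>_nz)
      ultimately show ?thesis by (simp add: filterlim_at)
    qed
    \<comment> \<open>The same limit taken along \<zeta> z: by invariance of g it equals \<zeta> ^
      (n + 1) l, so l \<noteq> 0 forces the exponent to be a multiple of d.\<close>
    hence "(\<lambda>z. (\<zeta> * z) ^ Suc n * g (\<zeta> * z)) \<midarrow>0\<rightarrow> l" by (rule filterlim_compose[OF Suc.prems(5)])
    moreover have "\<forall>\<^sub>F z in at 0. (\<zeta> * z) ^ Suc n * g (\<zeta> * z) = \<zeta> ^ Suc n * (z ^ Suc n * g z)"
      using ae_at[OF Suc.prems(4), of 0] by eventually_elim (simp add: power_mult_distrib)
    ultimately have "(\<lambda>z. \<zeta> ^ Suc n * (z ^ Suc n * g z)) \<midarrow>0\<rightarrow> l" by (rule Lim_transform_eventually)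
    moreover have "(\<lambda>z. \<zeta> ^ Suc n * (z ^ Suc n * g z)) \<midarrow>0\<rightarrow> \<zeta> ^ Suc n * l"
      by (intro tendsto_mult tendsto_const Suc.prems(5))
    ultimately have "\<zeta> ^ Suc n * l = l" using LIM_unique by blast
    hence "\<zeta> ^ Suc n = 1" using False by simp
    then obtain m where m: "Suc n = d * m" using \<zeta>_order by (metis dvdE)
    \<comment> \<open>Chosen so that b h^m and g have the same leading coefficient at 0.\<close>
    define b where "b = l / c ^ m"
    define g' where "g' = (\<lambda>z. g z - b * h z ^ m)"
    have lim1: "(\<lambda>z. z ^ Suc n * g z - b * (z ^ d * h z) ^ m) \<midarrow>0\<rightarrow> l - b * c ^ m"
      by (intro tendsto_intros Suc.prems(5) h_limit)
    have lim2: "z ^ Suc n * g z - b * (z ^ d * h z) ^ m = (z - 0) * (z ^ n * g' z)" for z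
    proof -
      have eq: "(z ^ d * h z) ^ m = z ^ Suc n * h z ^ m" unfolding m by (simp add: power_mult_distrib power_mult)
      show ?thesis unfolding eq g'_def by (simp add: algebra_simps)
    qed
    have "l - b * c ^ m = 0" using c_nz by (simp add: b_def)
    hence lim: "(\<lambda>z. (z - 0) * (z ^ n * g' z)) \<midarrow>0\<rightarrow> 0" using lim1 unfolding lim2 by simp
    have mero: "g' meromorphic_on UNIV" unfolding g'_def by (intro meromorphic_intros Suc.prems h_mero)
    have "(\<lambda>z. z ^ n * g' z) meromorphic_on {0}" by (intro meromorphic_intros meromorphic_at_subset[OF mero])
    then obtain l' where l': "(\<lambda>z. z ^ n * g' z) \<midarrow>0\<rightarrow> l'" using meromorphic_removable lim by blast
    have "ae_periodic g'" unfolding ae_periodic_def g'_def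
    proof
      fix w assume w: "w \<in> L"
      hence "\<forall>\<^sub>\<approx>z. g (z + w) = g z" using Suc.prems(2) by (simp add: ae_periodic_def)
      thus "\<forall>\<^sub>\<approx>z. g (z + w) - b * h (z + w) ^ m = g z - b * h z ^ m"
        by eventually_elim (simp add: h_period[OF w])
    qed
    moreover have "\<exists>l. g' \<midarrow>a\<rightarrow> l" if a: "a \<notin> L" for a
    proof -
      obtain l where "g \<midarrow>a\<rightarrow> l" using Suc.prems(3)[OF a] by blast
      moreover have "h \<midarrow>a\<rightarrow> h a" using h_analytic[OF a] analytic_at_imp_isCont isContD by blast
      ultimately have "g' \<midarrow>a\<rightarrow> l - b * h a ^ m" unfolding g'_def by (intro tendsto_intros)
      thus ?thesis by blast
    qed
    moreover have "\<forall>\<^sub>\<approx>z. g' (\<zeta> * z) = g' z"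
      using Suc.prems(4) h_rotate by eventually_elim (simp add: g'_def)
    ultimately obtain q where "\<forall>\<^sub>\<approx>z. g' z = poly q (h z)" using Suc.IH[OF mero _ _ _ l'] by blast
    hence "\<forall>\<^sub>\<approx>z. g z = poly (q + monom b m) (h z)"
      by eventually_elim (simp add: g'_def poly_monom algebra_simps)
    thus ?thesis by blast
  qed
qed

theorem invariant_imp_rational:
  assumes "f meromorphic_on UNIV" "ae_periodic f" "\<forall>\<^sub>\<approx>z. f (\<zeta> * z) = f z"
  obtains p q where "q \<noteq> 0" "\<forall>\<^sub>\<approx>z. f z = poly p (h z) / poly q (h z)"
proof -
  obtain q where q: "q \<noteq> 0" "\<And>a. a \<notin> L \<Longrightarrow> \<exists>l. (\<lambda>z. poly q (h z) * f z) \<midarrow>a\<rightarrow> l"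
    using clear_poles_off_lattice[OF assms(1,2)] by metis
  let ?g = "\<lambda>z. poly q (h z) * f z"
  have mero: "?g meromorphic_on UNIV" by (intro meromorphic_intros meromorphic_on_poly h_mero assms)
  have per: "ae_periodic ?g" using assms(2) unfolding ae_periodic_def
    by (auto simp: h_period elim: eventually_mono)
  have rot: "\<forall>\<^sub>\<approx>z. ?g (\<zeta> * z) = ?g z" using assms(3) h_rotate by eventually_elim simp
  obtain n l where "(\<lambda>z. (z - 0) ^ n * ?g z) \<midarrow>0\<rightarrow> l"
    using meromorphic_cancel_pole[OF meromorphic_at_subset[OF mero]] by metis
  hence "(\<lambda>z. z ^ n * ?g z) \<midarrow>0\<rightarrow> l" by simp
  from poles_on_lattice_imp_poly[OF mero per q(2) rot this]
  obtain p where "\<forall>\<^sub>\<approx>z. ?g z = poly p (h z)" by blast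
  hence "\<forall>\<^sub>\<approx>z. f z = poly p (h z) / poly q (h z)"
    using ae_poly_h_nonzero[OF q(1)] by eventually_elim (simp add: field_simps)
  thus ?thesis using that q(1) by blast
qed

end


section \<open>Maps to the sphere and the modified action\<close>

text \<open>Poles and limits depend only on the filter of punctured neighbourhoods. Working with
  homeomorphisms includes the reflexions, which are not holomorphic.\<close>

lemma filtermap_at_homeomorphism:
  fixes g g' :: "complex \<Rightarrow> complex"
  assumes "isCont g z" "isCont g' (g z)" "\<And>x. g' (g x) = x" "\<And>x. g (g' x) = x"
  shows "filtermap g (at z) = at (g z)"
proof (rule antisym)
  have "inj g" "inj g'" using assms(3,4) by (metis injI)+
  have lim: "filterlim k (at (k x)) (at x)" if "isCont k x" "inj k" for k :: "complex \<Rightarrow> complex" and x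
  proof (rule filterlim_atI)
    show "\<forall>\<^sub>F y in at x. k y \<noteq> k x"
      using eventually_neq_at_within[of x x UNIV] by (rule eventually_mono) (use that(2) in \<open>auto dest: injD\<close>)
  qed (use that(1) in \<open>rule isContD\<close>)
  show "filtermap g (at z) \<le> at (g z)"
    using lim[OF assms(1) \<open>inj g\<close>] by (simp add: filterlim_def)
  have "filtermap g' (at (g z)) \<le> at (g' (g z))"
    using lim[OF assms(2) \<open>inj g'\<close>] by (simp add: filterlim_def)
  hence "filtermap g (filtermap g' (at (g z))) \<le> filtermap g (at z)"
    using assms(3) by (simp add: filtermap_mono)
  thus "at (g z) \<le> filtermap g (at z)" by (simp add: filtermap_filtermap assms(4))
qed

lemma filtermap_at_affine:
  assumes "a \<noteq> 0"
  shows "filtermap (\<lambda>z :: complex. a * z + b) (at z) = at (a * z + b)"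
  by (rule filtermap_at_homeomorphism[where g' = "\<lambda>z. (z - b) / a"])
    (use assms in \<open>auto intro!: continuous_intros simp: field_simps\<close>)

lemma filtermap_at_cnj_affine:
  assumes "a \<noteq> 0"
  shows "filtermap (\<lambda>z. a * cnj z + b) (at z) = at (a * cnj z + b)"
  by (rule filtermap_at_homeomorphism[where g' = "\<lambda>z. cnj ((z - b) / a)"])
    (use assms in \<open>auto intro!: continuous_intros simp: field_simps\<close>)

lemma sphere_map_analytic: "f analytic_on {z} \<Longrightarrow> sphere_map f z = Fin (f z)"
  by (auto simp: sphere_map_def dest: analytic_at_imp_no_pole)

text \<open>Poles and removed singularities are determined by punctured neighbourhoods, hence
  equality at every point.\<close>

lemma sphere_map_cong:
  assumes "\<forall>\<^sub>\<approx>z. f z = g z"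
  shows "sphere_map f = sphere_map g"
proof
  fix z
  have ev: "\<forall>\<^sub>F z in at z. f z = g z" using ae_at[OF assms] .
  show "sphere_map f z = sphere_map g z"
    unfolding sphere_map_def using is_pole_cong[OF ev refl] remove_sings_cong[OF ev refl] by simp
qed

lemma ae_sphere_map: "f meromorphic_on UNIV \<Longrightarrow> \<forall>\<^sub>\<approx>z. sphere_map f z = Fin (f z)"
  using meromorphic_on_imp_analytic_cosparse[of f UNIV]
  by (auto elim!: eventually_mono intro: sphere_map_analytic)

lemma sphere_map_compose:
  assumes "filtermap g (at z) = at (g z)"
  shows "sphere_map (\<lambda>z. f (g z)) z = sphere_map f (g z)"
proof -
  have "is_pole (\<lambda>z. f (g z)) z \<longleftrightarrow> is_pole f (g z)"
    unfolding is_pole_def assms[symmetric] by (simp add: filterlim_filtermap)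
  thus ?thesis using remove_sings_compose[OF assms, of f] by (simp add: sphere_map_def o_def)
qed

lemma sphere_map_cnj: "sphere_map (\<lambda>z. cnj (f z)) z = sphere_cnj (sphere_map f z)"
proof -
  have pole: "is_pole (\<lambda>z. cnj (f z)) z \<longleftrightarrow> is_pole f z"
    unfolding is_pole_def filterlim_at_infinity_conv_norm_at_top by simp
  have lim: "(\<lambda>z. cnj (f z)) \<midarrow>z\<rightarrow> cnj l \<longleftrightarrow> f \<midarrow>z\<rightarrow> l" for l by (rule lim_cnj)
  have "remove_sings (\<lambda>z. cnj (f z)) z = cnj (remove_sings f z)"
  proof (cases "\<exists>l. f \<midarrow>z\<rightarrow> l")
    case True
    then obtain l where l: "f \<midarrow>z\<rightarrow> l" by blast
    thus ?thesis using lim[of l] remove_sings_eqI[OF l] by auto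
  next
    case False
    hence "\<not> (\<exists>l. (\<lambda>z. cnj (f z)) \<midarrow>z\<rightarrow> l)" using lim by (metis complex_cnj_cnj)
    thus ?thesis using False by (simp add: remove_sings_def)
  qed
  thus ?thesis by (simp add: sphere_map_def pole)
qed

lemma sense_preserving_affine: "norm \<rho> = 1 \<Longrightarrow> sense_preserving (\<lambda>z. \<rho> * z + w)"
  unfolding sense_preserving_def by blast

lemma sense_reversing_affine: "norm \<rho> = 1 \<Longrightarrow> sense_reversing (\<lambda>z. \<rho> * cnj z + w)"
  unfolding sense_reversing_def by blast

text \<open>\<open>modified_action\<close> tests for sense-preserving maps first, so a reflexion
  must be shown to fail that test. The points 0, 1 and \<i> suffice.\<close>

lemma not_sense_preserving_cnj: "\<rho> \<noteq> 0 \<Longrightarrow> \<not> sense_preserving (\<lambda>z. \<rho> * cnj z + w)"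
proof
  assume \<rho>: "\<rho> \<noteq> 0" and "sense_preserving (\<lambda>z. \<rho> * cnj z + w)"
  then obtain a b where "(\<lambda>z. \<rho> * cnj z + w) = (\<lambda>z. a * z + b)" by (auto simp: sense_preserving_def)
  hence eq: "\<rho> * cnj z + w = a * z + b" for z by metis
  have "w = b" using eq[of 0] by simp
  moreover have "\<rho> = a" using eq[of 1] calculation by simp
  ultimately show False using eq[of \<i>] \<rho> by simp
qed

text \<open>When P is a group of rotations stable under conjugation, and \<Lambda> is preserved by P
  and by conjugation, this lists the elements of the semidirect product of \<Lambda> with the point
  group generated by P and \<open>cnj\<close>.\<close>

definition motions :: "complex set \<Rightarrow> complex set \<Rightarrow> (complex \<Rightarrow> complex) set" where
  "motions \<Lambda> P = {\<lambda>z. \<rho> * z + w | \<rho> w. \<rho> \<in> P \<and> w \<in> \<Lambda>} \<union> {\<lambda>z. \<rho> * cnj z + w | \<rho> w. \<rho> \<in> P \<and> w \<in> \<Lambda>}"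

definition ae_invariant :: "complex set \<Rightarrow> complex set \<Rightarrow> (complex \<Rightarrow> complex) \<Rightarrow> bool" where
  "ae_invariant \<Lambda> P f \<longleftrightarrow> (\<forall>w\<in>\<Lambda>. \<forall>\<^sub>\<approx>z. f (z + w) = f z) \<and> (\<forall>\<rho>\<in>P. \<forall>\<^sub>\<approx>z. f (\<rho> * z) = f z)
     \<and> (\<forall>\<^sub>\<approx>z. cnj (f (cnj z)) = f z)"

text \<open>Bridge between equality of sphere-valued maps at all points and equality of
  complex-valued functions almost everywhere.\<close>

lemma modified_action_preserving_iff:
  assumes "f meromorphic_on UNIV" "norm \<rho> = 1"
  shows "modified_action (\<lambda>z. \<rho> * z + w) (sphere_map f) = sphere_map f \<longleftrightarrow> (\<forall>\<^sub>\<approx>z. f (\<rho> * z + w) = f z)"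
proof -
  have \<rho>: "\<rho> \<noteq> 0" using assms(2) by auto
  have eq: "modified_action (\<lambda>z. \<rho> * z + w) (sphere_map f) = (\<lambda>z. sphere_map f (\<rho> * z + w))"
    using sense_preserving_affine[OF assms(2)] by (simp add: modified_action_def)
  show ?thesis
  proof
    assume "modified_action (\<lambda>z. \<rho> * z + w) (sphere_map f) = sphere_map f"
    hence *: "sphere_map f (\<rho> * z + w) = sphere_map f z" for z unfolding eq by metis
    show "\<forall>\<^sub>\<approx>z. f (\<rho> * z + w) = f z"
      using ae_sphere_map[OF assms(1)] ae_affine[OF ae_sphere_map[OF assms(1)] \<rho>, of w]
      by eventually_elim (metis * sphere.inject(1))
  next
    assume "\<forall>\<^sub>\<approx>z. f (\<rho> * z + w) = f z"
    hence "sphere_map (\<lambda>z. f (\<rho> * z + w)) = sphere_map f" by (rule sphere_map_cong)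
    thus "modified_action (\<lambda>z. \<rho> * z + w) (sphere_map f) = sphere_map f"
      using sphere_map_compose[OF filtermap_at_affine[OF \<rho>], of f w] by (auto simp: eq fun_eq_iff)
  qed
qed

lemma modified_action_reversing_iff:
  assumes "f meromorphic_on UNIV" "norm \<rho> = 1"
  shows "modified_action (\<lambda>z. \<rho> * cnj z + w) (sphere_map f) = sphere_map f
    \<longleftrightarrow> (\<forall>\<^sub>\<approx>z. cnj (f (\<rho> * cnj z + w)) = f z)"
proof -
  have \<rho>: "\<rho> \<noteq> 0" using assms(2) by auto
  have eq: "modified_action (\<lambda>z. \<rho> * cnj z + w) (sphere_map f) = (\<lambda>z. sphere_cnj (sphere_map f (\<rho> * cnj z + w)))"
    using not_sense_preserving_cnj[OF \<rho>] by (simp add: modified_action_def)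
  show ?thesis
  proof
    assume "modified_action (\<lambda>z. \<rho> * cnj z + w) (sphere_map f) = sphere_map f"
    hence *: "sphere_cnj (sphere_map f (\<rho> * cnj z + w)) = sphere_map f z" for z unfolding eq by metis
    have "\<forall>\<^sub>\<approx>z. sphere_map f (\<rho> * cnj z + w) = Fin (f (\<rho> * cnj z + w))"
      using ae_cnj[OF ae_affine[OF ae_sphere_map[OF assms(1)] \<rho>, of w]] .
    with ae_sphere_map[OF assms(1)] show "\<forall>\<^sub>\<approx>z. cnj (f (\<rho> * cnj z + w)) = f z"
      by eventually_elim (metis * sphere.inject sphere_cnj.simps(1))
  next
    assume "\<forall>\<^sub>\<approx>z. cnj (f (\<rho> * cnj z + w)) = f z"
    hence "sphere_map (\<lambda>z. cnj (f (\<rho> * cnj z + w))) = sphere_map f" by (rule sphere_map_cong)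
    thus "modified_action (\<lambda>z. \<rho> * cnj z + w) (sphere_map f) = sphere_map f"
      using sphere_map_compose[OF filtermap_at_cnj_affine[OF \<rho>], of f w]
        sphere_map_cnj[of "\<lambda>z. f (\<rho> * cnj z + w)"] by (auto simp: eq fun_eq_iff)
  qed
qed

text \<open>Every motion is a product of a translation, a rotation and possibly \<open>cnj\<close>,
  so invariance under these three kinds can be composed.\<close>

lemma invariant_meromorphic_motions:
  assumes P: "1 \<in> P" "\<And>\<rho>. \<rho> \<in> P \<Longrightarrow> norm \<rho> = 1" and "0 \<in> \<Lambda>"
  shows "invariant_meromorphic (motions \<Lambda> P) = {sphere_map f | f. f meromorphic_on UNIV \<and> ae_invariant \<Lambda> P f}"
proof -
  have "(\<forall>g\<in>motions \<Lambda> P. modified_action g (sphere_map f) = sphere_map f) \<longleftrightarrow> ae_invariant \<Lambda> P f"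
    if f: "f meromorphic_on UNIV" for f
  proof
    assume *: "\<forall>g\<in>motions \<Lambda> P. modified_action g (sphere_map f) = sphere_map f"
    have 1: "\<forall>\<^sub>\<approx>z. f (\<rho> * z + w) = f z" if "\<rho> \<in> P" "w \<in> \<Lambda>" for \<rho> w
      using *[rule_format, of "\<lambda>z. \<rho> * z + w"] modified_action_preserving_iff[OF f P(2)[OF that(1)], of w] that
      by (auto simp: motions_def)
    have "(\<lambda>z. 1 * cnj z + 0) \<in> motions \<Lambda> P" unfolding motions_def using P(1) assms(3) by blast
    hence 2: "\<forall>\<^sub>\<approx>z. cnj (f (1 * cnj z + 0)) = f z"
      using * modified_action_reversing_iff[OF f, of 1 0] by simp
    show "ae_invariant \<Lambda> P f" unfolding ae_invariant_def
    proof (intro conjI ballI)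
      show "\<forall>\<^sub>\<approx>z. f (z + w) = f z" if "w \<in> \<Lambda>" for w using 1[OF P(1) that] by simp
      show "\<forall>\<^sub>\<approx>z. f (\<rho> * z) = f z" if "\<rho> \<in> P" for \<rho> using 1[OF that assms(3)] by simp
    qed (use 2 in simp)
  next
    assume inv: "ae_invariant \<Lambda> P f"
    have 1: "\<forall>\<^sub>\<approx>z. f (\<rho> * z + w) = f z" if "\<rho> \<in> P" "w \<in> \<Lambda>" for \<rho> w
    proof -
      have \<rho>: "\<rho> \<noteq> 0" using P(2)[OF that(1)] by auto
      have "\<forall>\<^sub>\<approx>z. f (z + w) = f z" using inv that by (simp add: ae_invariant_def)
      hence "\<forall>\<^sub>\<approx>z. f (\<rho> * z + w) = f (\<rho> * z)" by (rule ae_scale[OF _ \<rho>])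
      moreover have "\<forall>\<^sub>\<approx>z. f (\<rho> * z) = f z" using inv that by (simp add: ae_invariant_def)
      ultimately show ?thesis by eventually_elim simp
    qed
    show "\<forall>g\<in>motions \<Lambda> P. modified_action g (sphere_map f) = sphere_map f"
    proof
      fix g assume "g \<in> motions \<Lambda> P"
      then consider \<rho> w where "\<rho> \<in> P" "w \<in> \<Lambda>" "g = (\<lambda>z. \<rho> * z + w)"
        | \<rho> w where "\<rho> \<in> P" "w \<in> \<Lambda>" "g = (\<lambda>z. \<rho> * cnj z + w)" by (auto simp: motions_def)
      thus "modified_action g (sphere_map f) = sphere_map f"
      proof cases
        case 1
        thus ?thesis using modified_action_preserving_iff[OF f P(2)[OF 1(1)]] \<open>\<And>w \<rho>. \<rho> \<in> P \<Longrightarrow> w \<in> \<Lambda> \<Longrightarrow> \<forall>\<^sub>\<approx>z. f (\<rho> * z + w) = f z\<close>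
          by simp
      next
        case 2
        have "\<forall>\<^sub>\<approx>z. f (\<rho> * cnj z + w) = f (cnj z)" using ae_cnj[OF 1[OF 2(1,2)]] .
        moreover have "\<forall>\<^sub>\<approx>z. cnj (f (cnj z)) = f z" using inv by (simp add: ae_invariant_def)
        ultimately have "\<forall>\<^sub>\<approx>z. cnj (f (\<rho> * cnj z + w)) = f z" by eventually_elim simp
        thus ?thesis using modified_action_reversing_iff[OF f P(2)[OF 2(1)]] 2(3) by simp
      qed
    qed
  qed
  thus ?thesis unfolding invariant_meromorphic_def meromorphic_to_sphere_def by auto
qed


section \<open>Real rational functions\<close>

lemma islimpt_Reals: "w \<in> \<real> \<Longrightarrow> (w :: complex) islimpt \<real>"
  unfolding islimpt_approachable
proof (intro allI impI)
  fix e :: real assume w: "w \<in> \<real>" and e: "e > 0"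
  show "\<exists>x\<in>\<real>. x \<noteq> w \<and> dist x w < e"
    by (rule bexI[of _ "w + of_real (e / 2)"]) (use w e in \<open>auto simp: dist_norm norm_divide\<close>)
qed

lemma poly_map_cnj_Reals: "w \<in> \<real> \<Longrightarrow> poly (map_poly cnj p) w = cnj (poly p w)"
  using poly_cnj[of p w] by (metis Reals_cnj_iff)

lemma map_poly_cnj_eq_0_iff [simp]: "map_poly cnj p = 0 \<longleftrightarrow> p = 0"
  by (metis complex_cnj_zero complex_cnj_zero_iff map_poly_0 map_poly_eq_0_iff)

lemma analytic_on_poly: "f analytic_on A \<Longrightarrow> (\<lambda>z. poly p (f z)) analytic_on A"
  by (induction p) (auto intro!: analytic_intros)

text \<open>Instead of normalising the fraction so that its coefficients are real, we use that it equals its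
  conjugate.\<close>

lemma real_rational_iff:
  "R \<in> real_rational \<longleftrightarrow>
     (\<exists>p q. q \<noteq> 0 \<and> p * map_poly cnj q = map_poly cnj p * q \<and> R = (\<lambda>w. poly p w / poly q w))"
proof
  assume "R \<in> real_rational"
  then obtain p q where q: "q \<noteq> 0" and R: "R = (\<lambda>w. poly p w / poly q w)" and rl: "real_for_real R"
    by (auto simp: real_rational_def rational_fun_def)
  \<comment> \<open>On the real line \<open>map_poly cnj\<close> conjugates values, so reality of p
    / q makes this polynomial vanish wherever q does not. Infinitely many zeros then make it the
    zero polynomial.\<close>
  have zero: "poly (p * map_poly cnj q - map_poly cnj p * q) w = 0" if w: "w \<in> \<real>" "poly q w \<noteq> 0" for w
  proof -
    have "R analytic_on {w}" unfolding R using w(2)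
      by (intro analytic_on_divide analytic_on_poly) (auto intro: analytic_intros)
    hence "sphere_map R w = Fin (R w)" by (rule sphere_map_analytic)
    hence "R w \<in> \<real>" using rl w(1) unfolding real_for_real_def by auto
    hence "cnj (R w) = R w" by (simp add: Reals_cnj_iff)
    moreover have "cnj w = w" using w(1) by (simp add: Reals_cnj_iff)
    ultimately show ?thesis using w by (simp add: R field_simps)
  qed
  have "p * map_poly cnj q - map_poly cnj p * q = 0"
  proof (rule ccontr)
    assume ne: "p * map_poly cnj q - map_poly cnj p * q \<noteq> 0"
    have "\<real> \<subseteq> {w. poly (p * map_poly cnj q - map_poly cnj p * q) w = 0} \<union> {w. poly q w = 0}"
      using zero by blast
    moreover have "finite \<dots>" using poly_roots_finite[OF ne] poly_roots_finite[OF q] by blast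
    ultimately have "finite (\<real> :: complex set)" by (rule finite_subset)
    from islimpt_finite[OF this, of 0] islimpt_Reals[OF Reals_0] show False by contradiction
  qed
  thus "\<exists>p q. q \<noteq> 0 \<and> p * map_poly cnj q = map_poly cnj p * q \<and> R = (\<lambda>w. poly p w / poly q w)"
    using q R by (intro exI[of _ p] exI[of _ q]) simp
next
  assume "\<exists>p q. q \<noteq> 0 \<and> p * map_poly cnj q = map_poly cnj p * q \<and> R = (\<lambda>w. poly p w / poly q w)"
  then obtain p q where q: "q \<noteq> 0" and pq: "p * map_poly cnj q = map_poly cnj p * q"
    and R: "R = (\<lambda>w. poly p w / poly q w)" by blast
  \<comment> \<open>Where q vanishes, R takes the value 0 by division by zero, which is real as
    well.\<close>
  have real: "R t \<in> \<real>" if "t \<in> \<real>" for t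
  proof (cases "poly q t = 0")
    case False
    have "poly p t * cnj (poly q t) = cnj (poly p t) * poly q t"
      using arg_cong[OF pq, of "\<lambda>r. poly r t"] poly_map_cnj_Reals[OF that]
      unfolding poly_mult by simp
    hence "cnj (R t) = R t" using False by (simp add: R field_simps)
    thus ?thesis by (simp add: Reals_cnj_iff)
  qed (simp add: R)
  have mero: "R meromorphic_on UNIV" unfolding R by (intro meromorphic_on_rational meromorphic_intros)
  have "sphere_map R w \<in> insert Infty (Fin ` \<real>)" if w: "w \<in> \<real>" for w
  proof (cases "is_pole R w")
    case False
    then obtain l where l: "R \<midarrow>w\<rightarrow> l"
      using meromorphic_at_subset[OF mero, of "{w}"] by (auto simp: meromorphic_at_iff not_essential_def)
    \<comment> \<open>At a removable singularity the value is a limit along the real axis of real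
      numbers, and the reals are closed.\<close>
    hence "(R \<longlongrightarrow> l) (at w within \<real>)" by (rule Lim_at_imp_Lim_at_within)
    moreover have "\<forall>\<^sub>F t in at w within \<real>. R t \<in> \<real>"
      using real by (auto simp: eventually_at_filter)
    moreover have "at w within \<real> \<noteq> bot" using islimpt_Reals[OF w] by (simp add: trivial_limit_within)
    ultimately have "l \<in> \<real>" using Lim_in_closed_set[OF closed_complex_Reals] by blast
    thus ?thesis using False remove_sings_eqI[OF l] by (simp add: sphere_map_def)
  qed (simp add: sphere_map_def)
  thus "R \<in> real_rational" using q by (auto simp: real_rational_def rational_fun_def real_for_real_def R)
qed

text \<open>The polynomial identity extends reality on the axis to Schwarz reflection in the plane,
  away from the zeros of the two denominators.\<close>

lemma real_rational_cnj:
  assumes "R \<in> real_rational"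
  obtains p q where "q \<noteq> 0" "R = (\<lambda>w. poly p w / poly q w)"
    "\<And>x. poly q x \<noteq> 0 \<Longrightarrow> poly (map_poly cnj q) x \<noteq> 0 \<Longrightarrow> cnj (R (cnj x)) = R x"
proof -
  from assms obtain p q where q: "q \<noteq> 0" and pq: "p * map_poly cnj q = map_poly cnj p * q"
    and R: "R = (\<lambda>w. poly p w / poly q w)" by (auto simp: real_rational_iff)
  have "cnj (R (cnj x)) = R x" if "poly q x \<noteq> 0" "poly (map_poly cnj q) x \<noteq> 0" for x
  proof -
    have "poly p x * poly (map_poly cnj q) x = poly (map_poly cnj p) x * poly q x"
      using arg_cong[OF pq, of "\<lambda>r. poly r x"] by simp
    moreover have "cnj (R (cnj x)) = poly (map_poly cnj p) x / poly (map_poly cnj q) x"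
      using poly_cnj[of p "cnj x"] poly_cnj[of q "cnj x"] unfolding R complex_cnj_divide complex_cnj_cnj by argo
    ultimately show ?thesis using that frac_eq_eq unfolding R by metis
  qed
  thus ?thesis using that q R by blast
qed

lemma real_rational_meromorphic:
  assumes "R \<in> real_rational" "h meromorphic_on A"
  shows "(\<lambda>z. R (h z)) meromorphic_on A"
  using assms by (auto simp: real_rational_def rational_fun_def intro: meromorphic_on_rational)

lemma (in lattice_function) ae_real_rational_cnj:
  assumes "\<forall>\<^sub>\<approx>z. h (cnj z) = cnj (h z)" "R \<in> real_rational"
  shows "\<forall>\<^sub>\<approx>z. cnj (R (h (cnj z))) = R (h z)"
proof -
  obtain p q where q: "q \<noteq> 0"
    and R: "\<And>x. poly q x \<noteq> 0 \<Longrightarrow> poly (map_poly cnj q) x \<noteq> 0 \<Longrightarrow> cnj (R (cnj x)) = R x"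
    using real_rational_cnj[OF assms(2)] by metis
  have "\<forall>\<^sub>\<approx>z. poly (map_poly cnj q) (h z) \<noteq> 0" using q by (intro ae_poly_h_nonzero) simp
  with ae_poly_h_nonzero[OF q] assms(1) show ?thesis
    by eventually_elim (simp add: R)
qed

locale real_lattice_generator = lattice_generator +
  assumes h_cnj: "\<forall>\<^sub>\<approx>z. h (cnj z) = cnj (h z)"
begin

theorem invariant_imp_real_rational:
  assumes "f meromorphic_on UNIV" "ae_periodic f" "\<forall>\<^sub>\<approx>z. f (\<zeta> * z) = f z" "\<forall>\<^sub>\<approx>z. cnj (f (cnj z)) = f z"
  obtains R where "R \<in> real_rational" "\<forall>\<^sub>\<approx>z. f z = R (h z)"
proof -
  obtain p q where q: "q \<noteq> 0" and f: "\<forall>\<^sub>\<approx>z. f z = poly p (h z) / poly q (h z)"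
    using invariant_imp_rational[OF assms(1-3)] by metis
  have q': "map_poly cnj q \<noteq> 0" using q by simp
  \<comment> \<open>Invariance under conjugation gives p(h) / q(h) a second expression with
    conjugated coefficients. As h is transcendental, the cross-multiplied identity passes to the
    polynomials.\<close>
  have "\<forall>\<^sub>\<approx>z. poly (p * map_poly cnj q) (h z) = poly (map_poly cnj p * q) (h z)"
    using assms(4) f ae_cnj[OF f] ae_poly_h_nonzero[OF q] ae_poly_h_nonzero[OF q'] h_cnj
  proof eventually_elim
    case (elim z)
    have "f z = poly (map_poly cnj p) (h z) / poly (map_poly cnj q) (h z)"
      using elim(1,3,6) by (metis complex_cnj_cnj complex_cnj_divide poly_cnj)
    thus ?case using elim by (simp add: field_simps)
  qed
  hence "p * map_poly cnj q = map_poly cnj p * q" by (rule ae_poly_h_eqD)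
  hence "(\<lambda>w. poly p w / poly q w) \<in> real_rational" using q real_rational_iff by blast
  thus ?thesis using f by (rule that)
qed

theorem invariant_meromorphic_eq:
  assumes P: "1 \<in> P" "\<zeta> \<in> P" "\<And>\<rho>. \<rho> \<in> P \<Longrightarrow> norm \<rho> = 1"
    and rot: "\<And>\<rho>. \<rho> \<in> P \<Longrightarrow> \<forall>\<^sub>\<approx>z. h (\<rho> * z) = h z"
  shows "invariant_meromorphic (motions L P) = {sphere_map (\<lambda>z. R (h z)) | R. R \<in> real_rational}"
proof (subst invariant_meromorphic_motions[OF P(1) _ lattice_0], fact P(3), intro equalityI subsetI)
  fix F assume "F \<in> {sphere_map f | f. f meromorphic_on UNIV \<and> ae_invariant L P f}"
  then obtain f where f: "F = sphere_map f" "f meromorphic_on UNIV" "ae_invariant L P f" by blast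
  have "ae_periodic f" "\<forall>\<^sub>\<approx>z. f (\<zeta> * z) = f z" "\<forall>\<^sub>\<approx>z. cnj (f (cnj z)) = f z"
    using f(3) P(2) by (auto simp: ae_invariant_def ae_periodic_def)
  then obtain R where R: "R \<in> real_rational" "\<forall>\<^sub>\<approx>z. f z = R (h z)"
    by (rule invariant_imp_real_rational[OF f(2)])
  have "F = sphere_map (\<lambda>z. R (h z))" using sphere_map_cong[OF R(2)] f(1) by simp
  with R(1) show "F \<in> {sphere_map (\<lambda>z. R (h z)) | R. R \<in> real_rational}" by blast
next
  fix F assume "F \<in> {sphere_map (\<lambda>z. R (h z)) | R. R \<in> real_rational}"
  then obtain R where R: "R \<in> real_rational" "F = sphere_map (\<lambda>z. R (h z))" by blast
  have "ae_invariant L P (\<lambda>z. R (h z))"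
    unfolding ae_invariant_def
  proof (intro conjI ballI)
    show "\<forall>\<^sub>\<approx>z. R (h (\<rho> * z)) = R (h z)" if "\<rho> \<in> P" for \<rho>
      using rot[OF that] by eventually_elim simp
  qed (use ae_real_rational_cnj[OF h_cnj R(1)] in \<open>simp_all add: h_period\<close>)
  moreover have "(\<lambda>z. R (h z)) meromorphic_on UNIV" by (rule real_rational_meromorphic[OF R(1) h_mero])
  ultimately show "F \<in> {sphere_map f | f. f meromorphic_on UNIV \<and> ae_invariant L P f}"
    using R(2) by blast
qed

end


section \<open>The groups\<close>

text \<open>The flag r records whether the sense is reversed; composition then has a single formula,
  in which the flags add modulo 2.\<close>

definition motion :: "complex \<Rightarrow> bool \<Rightarrow> complex \<Rightarrow> complex \<Rightarrow> complex" where
  "motion \<rho> r w z = \<rho> * (if r then cnj z else z) + w"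

lemma motions_eq: "motions \<Lambda> P = {motion \<rho> r w | \<rho> r w. \<rho> \<in> P \<and> w \<in> \<Lambda>}"
proof -
  have 1: "(\<lambda>z. \<rho> * z + w) = motion \<rho> False w" for \<rho> w by (simp add: motion_def fun_eq_iff)
  have 2: "(\<lambda>z. \<rho> * cnj z + w) = motion \<rho> True w" for \<rho> w by (simp add: motion_def fun_eq_iff)
  show ?thesis unfolding motions_def 1 2 by (auto, metis (full_types))
qed

lemma motion_comp:
  "motion \<rho> r w \<circ> motion \<sigma> s x = motion (\<rho> * (if r then cnj \<sigma> else \<sigma>)) (r \<noteq> s) (\<rho> * (if r then cnj x else x) + w)"
  by (auto simp: motion_def fun_eq_iff algebra_simps)

lemma motion_comp_inverse:
  fixes \<rho> w :: complex and r :: bool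
  assumes "\<rho> \<noteq> 0"
  defines "g \<equiv> motion (if r then cnj (inverse \<rho>) else inverse \<rho>) r (- (if r then cnj (inverse \<rho> * w) else inverse \<rho> * w))"
  shows "motion \<rho> r w \<circ> g = id" "g \<circ> motion \<rho> r w = id"
  using assms(1) by (auto simp: g_def motion_def fun_eq_iff field_simps)

lemma carrier_BijGroup_UNIV: "carrier (BijGroup UNIV) = {f. bij f}"
  by (auto simp: BijGroup_def Bij_def)

lemma one_BijGroup_UNIV: "\<one>\<^bsub>BijGroup UNIV\<^esub> = id"
  by (simp add: BijGroup_def fun_eq_iff)

lemma mult_BijGroup_UNIV: "bij f \<Longrightarrow> bij g \<Longrightarrow> f \<otimes>\<^bsub>BijGroup UNIV\<^esub> g = f \<circ> g"
  by (simp add: BijGroup_def Bij_def compose_def fun_eq_iff)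

lemma inv_BijGroup_UNIV:
  assumes "f \<circ> g = id" "g \<circ> f = id"
  shows "inv\<^bsub>BijGroup UNIV\<^esub> f = g"
proof (rule group.inv_equality[OF group_BijGroup])
  have "bij f" "bij g" using assms o_bij by blast+
  thus "g \<otimes>\<^bsub>BijGroup UNIV\<^esub> f = \<one>\<^bsub>BijGroup UNIV\<^esub>" "f \<in> carrier (BijGroup UNIV)" "g \<in> carrier (BijGroup UNIV)"
    by (simp_all add: mult_BijGroup_UNIV one_BijGroup_UNIV carrier_BijGroup_UNIV assms)
qed

text \<open>P is the rotation part of the point group. Its elements have norm 1, so closure under
  \<open>cnj\<close> provides the inverses; it also lets the reflexion normalise the
  rotations.\<close>

locale symmetric_lattice = plane_lattice +
  fixes P :: "complex set"
  assumes one_in_P: "1 \<in> P" and P_mult: "\<rho> \<in> P \<Longrightarrow> \<sigma> \<in> P \<Longrightarrow> \<rho> * \<sigma> \<in> P"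
    and P_cnj: "\<rho> \<in> P \<Longrightarrow> cnj \<rho> \<in> P" and P_norm: "\<rho> \<in> P \<Longrightarrow> norm \<rho> = 1"
    and P_L: "\<rho> \<in> P \<Longrightarrow> w \<in> L \<Longrightarrow> \<rho> * w \<in> L" and cnj_L: "w \<in> L \<Longrightarrow> cnj w \<in> L"
begin

lemma P_nz: "\<rho> \<in> P \<Longrightarrow> \<rho> \<noteq> 0"
  using P_norm by force

lemma P_inverse: "\<rho> \<in> P \<Longrightarrow> inverse \<rho> \<in> P"
  using P_cnj[of \<rho>] P_norm[of \<rho>] P_nz[of \<rho>] inverse_unique[of \<rho> "cnj \<rho>"]
  by (simp add: complex_norm_square[symmetric])

lemma P_L_iff: "\<rho> \<in> P \<Longrightarrow> \<rho> * w \<in> L \<longleftrightarrow> w \<in> L"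
  using P_L[of \<rho> w] P_L[OF P_inverse, of \<rho> "\<rho> * w"] P_nz[of \<rho>] by (auto simp: mult.assoc[symmetric])

lemma cnj_L_iff: "cnj w \<in> L \<longleftrightarrow> w \<in> L"
  using cnj_L[of w] cnj_L[of "cnj w"] by auto

lemma motion_in_motions: "\<rho> \<in> P \<Longrightarrow> w \<in> L \<Longrightarrow> motion \<rho> r w \<in> motions L P"
  unfolding motions_eq by blast

lemma bij_motion: "\<rho> \<in> P \<Longrightarrow> bij (motion \<rho> r w)"
  using motion_comp_inverse[OF P_nz] o_bij by metis

lemma subgroup_motions: "subgroup (motions L P) (BijGroup UNIV)"
proof (rule group.subgroupI[OF group_BijGroup])
  show "motions L P \<subseteq> carrier (BijGroup UNIV)"
    using bij_motion by (auto simp: motions_eq carrier_BijGroup_UNIV)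
  show "motions L P \<noteq> {}" using motion_in_motions[OF one_in_P lattice_0] by blast
next
  fix f assume "f \<in> motions L P"
  then obtain \<rho> r w where f: "f = motion \<rho> r w" "\<rho> \<in> P" "w \<in> L" by (auto simp: motions_eq)
  define g where "g = motion (if r then cnj (inverse \<rho>) else inverse \<rho>) r (- (if r then cnj (inverse \<rho> * w) else inverse \<rho> * w))"
  have "inv\<^bsub>BijGroup UNIV\<^esub> f = g"
    unfolding f(1) g_def by (intro inv_BijGroup_UNIV motion_comp_inverse P_nz f(2))
  moreover have "g \<in> motions L P" unfolding g_def using f
    by (intro motion_in_motions lattice_uminus) (simp_all add: P_inverse P_cnj P_L cnj_L del: complex_cnj_inverse complex_cnj_mult)
  ultimately show "inv\<^bsub>BijGroup UNIV\<^esub> f \<in> motions L P" by simp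
  fix f' assume "f' \<in> motions L P"
  then obtain \<sigma> s x where f': "f' = motion \<sigma> s x" "\<sigma> \<in> P" "x \<in> L" by (auto simp: motions_eq)
  have "f \<otimes>\<^bsub>BijGroup UNIV\<^esub> f' = f \<circ> f'" using f f' bij_motion by (simp add: mult_BijGroup_UNIV)
  also have "\<dots> \<in> motions L P" unfolding f(1) f'(1) motion_comp using f f'
    by (intro motion_in_motions lattice_add) (simp_all add: P_mult P_cnj P_L cnj_L)
  finally show "f \<otimes>\<^bsub>BijGroup UNIV\<^esub> f' \<in> motions L P" .
qed

text \<open>The condition \<open>gen\<close> expresses that P is the multiplicative closure of the
  given rotations. In a concrete case it is met by writing the elements of P as products.\<close>

lemma motion_group_eq:
  assumes "rots \<subseteq> P" 
    and gen: "\<And>S. 1 \<in> S \<Longrightarrow> rots \<subseteq> S \<Longrightarrow> (\<And>\<rho> \<sigma>. \<rho> \<in> S \<Longrightarrow> \<sigma> \<in> S \<Longrightarrow> \<rho> * \<sigma> \<in> S) \<Longrightarrow> P \<subseteq> S"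
  shows "motion_group L rots = motions L P"
proof
  let ?gens = "(\<lambda>w z. z + w) ` L \<union> (\<lambda>\<rho> z. \<rho> * z) ` rots \<union> {cnj}"
  have gens: "?gens \<subseteq> motions L P"
  proof -
    have "(\<lambda>z. z + w) = motion 1 False w" "(\<lambda>z. \<rho> * z) = motion \<rho> False 0" "cnj = motion 1 True 0" for w \<rho>
      by (auto simp: motion_def fun_eq_iff)
    moreover have "motion 1 False w \<in> motions L P" if "w \<in> L" for w
      using motion_in_motions[OF one_in_P that] .
    moreover have "motion \<rho> False 0 \<in> motions L P" if "\<rho> \<in> rots" for \<rho>
      using motion_in_motions[of \<rho> 0 False] assms(1) that by auto
    moreover have "motion 1 True 0 \<in> motions L P" using motion_in_motions[OF one_in_P lattice_0] .
    ultimately show ?thesis by auto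
  qed
  show "motion_group L rots \<subseteq> motions L P"
    unfolding motion_group_def by (rule group.generate_subgroup_incl[OF group_BijGroup gens subgroup_motions])
  have car: "?gens \<subseteq> carrier (BijGroup UNIV)"
    using gens subgroup_motions by (meson subgroup.subset subset_trans)
  have comp: "f \<circ> g \<in> motion_group L rots" if "f \<in> motion_group L rots" "g \<in> motion_group L rots" for f g
  proof -
    have "bij f" "bij g" using that group.generate_in_carrier[OF group_BijGroup car]
      unfolding motion_group_def carrier_BijGroup_UNIV by blast+
    thus ?thesis using generate.eng[of f "BijGroup UNIV" ?gens g] that
      unfolding motion_group_def by (simp add: mult_BijGroup_UNIV)
  qed
  \<comment> \<open>The rotations about 0 in the generated group; \<open>gen\<close> applies to this
    set.\<close>
  define S where "S = {\<rho>. (\<lambda>z. \<rho> * z) \<in> motion_group L rots}"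
  have "P \<subseteq> S"
  proof (rule gen)
    have "id \<in> motion_group L rots"
      using generate.one[of "BijGroup UNIV" ?gens] unfolding motion_group_def one_BijGroup_UNIV .
    moreover have "(\<lambda>z. 1 * z) = (id :: complex \<Rightarrow> complex)" by auto
    ultimately show "1 \<in> S" unfolding S_def mem_Collect_eq by (simp only:)
    show "rots \<subseteq> S" unfolding S_def motion_group_def by (auto intro!: generate.incl)
    show "\<rho> * \<sigma> \<in> S" if "\<rho> \<in> S" "\<sigma> \<in> S" for \<rho> \<sigma>
    proof -
      have "(\<lambda>z. \<rho> * \<sigma> * z) = (\<lambda>z. \<rho> * z) \<circ> (\<lambda>z. \<sigma> * z)" by (auto simp: mult.assoc)
      thus ?thesis using comp that unfolding S_def mem_Collect_eq by (simp only:)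
    qed
  qed
  show "motions L P \<subseteq> motion_group L rots"
  proof
    fix f assume "f \<in> motions L P"
    then obtain \<rho> r w where f: "f = motion \<rho> r w" "\<rho> \<in> P" "w \<in> L" by (auto simp: motions_eq)
    have t: "(\<lambda>z. z + w) \<in> motion_group L rots" "cnj \<in> motion_group L rots"
      using f(3) unfolding motion_group_def by (auto intro!: generate.incl)
    have \<rho>: "(\<lambda>z. \<rho> * z) \<in> motion_group L rots" using \<open>P \<subseteq> S\<close> f(2) by (auto simp: S_def)
    have "f = (\<lambda>z. z + w) \<circ> (\<lambda>z. \<rho> * z) \<circ> (if r then cnj else id)"
      by (auto simp: f(1) motion_def fun_eq_iff)
    moreover have "(\<lambda>z. z + w) \<circ> (\<lambda>z. \<rho> * z) \<circ> (if r then cnj else id) \<in> motion_group L rots"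
      using comp[OF t(1) \<rho>] comp[OF comp[OF t(1) \<rho>] t(2)] by (cases r) simp_all
    ultimately show "f \<in> motion_group L rots" by simp
  qed
qed

lemma wallpaper_group_motions: "wallpaper_group (motions L P)"
  unfolding wallpaper_group_def
proof (intro conjI)
  show "\<forall>g\<in>motions L P. rigid_motion g"
    using P_norm by (auto simp: motions_def rigid_motion_def intro: sense_preserving_affine sense_reversing_affine)
  have "(\<lambda>z. z + w) \<in> motions L P" if "w \<in> L" for w
    using motion_in_motions[OF one_in_P that, of False] by (simp add: motion_def[abs_def])
  thus "\<exists>u v. nonparallel u v \<and> (\<lambda>z. z + u) \<in> motions L P \<and> (\<lambda>z. z + v) \<in> motions L P"
    using np lattice_basis1 lattice_basis2 by blast
qed (rule subgroup_motions)

text \<open>The frame A is a real linear isomorphism onto the plane that takes the integer points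
  and their centring translates to the lattice. The rest is a matching of linear parts, needed in
  both directions.\<close>

lemma wallpaper_type_motions:
  fixes a b :: complex
  defines "A \<equiv> affine_frame 0 a b"
  assumes ab: "nonparallel a b"
    and L: "L = {A (c + (of_int m, of_int n)) | c m n. c \<in> centring T}"
    and P1: "\<And>\<rho> r. \<rho> \<in> P \<Longrightarrow> \<exists>h\<in>general_positions T. \<forall>x y. motion \<rho> r 0 (A (x, y)) = A (h (x, y))"
    and P2: "\<And>h. h \<in> general_positions T \<Longrightarrow> \<exists>\<rho>\<in>P. \<exists>r. \<forall>x y. motion \<rho> r 0 (A (x, y)) = A (h (x, y))"
  shows "wallpaper_group_of_type T (motions L P)"
proof -
  have A_add: "A (xy + xy') = A xy + A xy'" for xy xy'
    by (auto simp: A_def affine_frame_def case_prod_unfold algebra_simps)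
  have A_surj: "\<exists>xy. z = A xy" for z
  proof -
    obtain s t :: real where "z = of_real s * a + of_real t * b" by (rule nonparallel_span[OF ab])
    thus ?thesis by (intro exI[of _ "(s, t)"]) (simp add: A_def affine_frame_def)
  qed
  have mot: "motion \<rho> r w z = motion \<rho> r 0 z + w" for \<rho> r w z by (simp add: motion_def)
  have "motions L P = {g. \<exists>h\<in>standard_group T. g \<circ> A = A \<circ> h}"
  proof (intro equalityI subsetI)
    fix g assume "g \<in> motions L P"
    then obtain \<rho> r w where g: "g = motion \<rho> r w" "\<rho> \<in> P" "w \<in> L" by (auto simp: motions_eq)
    obtain h where h: "h \<in> general_positions T" "\<And>x y. motion \<rho> r 0 (A (x, y)) = A (h (x, y))"
      using P1[OF g(2), of r] by blast
    obtain c m n where w: "c \<in> centring T" "w = A (c + (of_int m, of_int n))" using g(3) unfolding L by blast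
    have "(\<lambda>xy. h xy + c + (of_int m, of_int n)) \<in> standard_group T"
      unfolding standard_group_def using h(1) w(1) by blast
    moreover have "g \<circ> A = A \<circ> (\<lambda>xy. h xy + c + (of_int m, of_int n))"
    proof
      fix xy :: "real \<times> real"
      have "g (A xy) = motion \<rho> r 0 (A xy) + w" unfolding g(1) by (rule mot)
      also have "\<dots> = A (h xy) + A (c + (of_int m, of_int n))" using h(2) w(2) by (cases xy) simp
      finally show "(g \<circ> A) xy = (A \<circ> (\<lambda>xy. h xy + c + (of_int m, of_int n))) xy"
        by (simp add: A_add add.assoc)
    qed
    ultimately show "g \<in> {g. \<exists>h\<in>standard_group T. g \<circ> A = A \<circ> h}" by blast
  next
    fix g assume "g \<in> {g. \<exists>h\<in>standard_group T. g \<circ> A = A \<circ> h}"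
    then obtain h c m n where h: "h \<in> general_positions T" "c \<in> centring T"
      and g: "g \<circ> A = A \<circ> (\<lambda>xy. h xy + c + (of_int m, of_int n))" unfolding standard_group_def by blast
    obtain \<rho> r where \<rho>: "\<rho> \<in> P" "\<And>x y. motion \<rho> r 0 (A (x, y)) = A (h (x, y))" using P2[OF h(1)] by blast
    define w where "w = A (c + (of_int m, of_int n))"
    \<comment> \<open>A is onto, so g is determined by its composition with A.\<close>
    have "g z = motion \<rho> r w z" for z
    proof -
      obtain x y where z: "z = A (x, y)" using A_surj[of z] by auto
      have "g z = A (h (x, y) + c + (of_int m, of_int n))" using fun_cong[OF g, of "(x, y)"] z by simp
      also have "\<dots> = motion \<rho> r 0 z + w" by (simp add: w_def z \<rho>(2) A_add add.assoc)
      finally show ?thesis by (subst mot)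
    qed
    hence "g = motion \<rho> r w" by blast
    moreover have "w \<in> L" unfolding L w_def using h(2) by blast
    ultimately show "g \<in> motions L P" using motion_in_motions[OF \<rho>(1)] by simp
  qed
  thus ?thesis unfolding wallpaper_group_of_type_def A_def
    using wallpaper_group_motions ab by blast
qed

end

lemma lattice_eq_primitive:
  assumes "T \<noteq> cm" "T \<noteq> c2mm"
  shows "lattice a b = {affine_frame 0 a b (c + (of_int m, of_int n)) | c m n. c \<in> centring T}"
  using assms by (auto simp: lattice_def centring_def affine_frame_def)

text \<open>The conventional rectangle has sides 2 b and 2 a; the parity of k + l decides between
  its corners and its centre. The side 2 b comes first because the listed mirror reverses the first
  coordinate, and b will be imaginary.\<close>

lemma lattice_eq_centred:
  assumes "T = cm \<or> T = c2mm"
  shows "lattice (a + b) (a - b) = {affine_frame 0 (2 * b) (2 * a) (c + (of_int m, of_int n)) | c m n. c \<in> centring T}"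
proof (intro equalityI subsetI)
  have cen: "(0, 0) \<in> centring T" "(1 / 2, 1 / 2) \<in> centring T" using assms by (auto simp: centring_def)
  fix w assume "w \<in> lattice (a + b) (a - b)"
  then obtain k l :: int where w: "w = of_int k * (a + b) + of_int l * (a - b)" by (auto simp: lattice_def)
  show "w \<in> {affine_frame 0 (2 * b) (2 * a) (c + (of_int m, of_int n)) | c m n. c \<in> centring T}"
  proof (cases "even (k + l)")
    case True
    then obtain n where n: "k = 2 * n - l" by (auto simp: dvd_def algebra_simps)
    have "w = affine_frame 0 (2 * b) (2 * a) ((0, 0) + (of_int (n - l), of_int n))"
      by (simp add: w n affine_frame_def algebra_simps)
    thus ?thesis using cen by blast
  next
    case False
    then obtain n where "k + l = 2 * n + 1" by (rule oddE)
    hence n: "k = 2 * n + 1 - l" by simp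
    have "w = affine_frame 0 (2 * b) (2 * a) ((1 / 2, 1 / 2) + (of_int (n - l), of_int n))"
      by (simp add: w n affine_frame_def algebra_simps)
    thus ?thesis using cen by blast
  qed
next
  fix w assume "w \<in> {affine_frame 0 (2 * b) (2 * a) (c + (of_int m, of_int n)) | c m n. c \<in> centring T}"
  then obtain c m n where "c \<in> centring T" "w = affine_frame 0 (2 * b) (2 * a) (c + (of_int m, of_int n))" by blast
  moreover have "c = (0, 0) \<or> c = (1 / 2, 1 / 2)" using calculation(1) assms by (auto simp: centring_def)
  ultimately consider m n where "w = affine_frame 0 (2 * b) (2 * a) ((0, 0) + (of_int m, of_int n))"
    | m n where "w = affine_frame 0 (2 * b) (2 * a) ((1 / 2, 1 / 2) + (of_int m, of_int n))"
    by blast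
  thus "w \<in> lattice (a + b) (a - b)"
  proof cases
    case 1
    hence "w = of_int (n + m) * (a + b) + of_int (n - m) * (a - b)"
      by (simp add: affine_frame_def algebra_simps)
    thus ?thesis unfolding lattice_def by blast
  next
    case 2
    hence "w = of_int (n + m + 1) * (a + b) + of_int (n - m) * (a - b)"
      by (simp add: affine_frame_def algebra_simps)
    thus ?thesis unfolding lattice_def by blast
  qed
qed


section \<open>Invariant functions in terms of \<open>\<wp>\<close>\<close>

lemma dvd_of_power_eq_1:
  fixes \<zeta> :: complex
  assumes "\<zeta> ^ d = 1" "\<And>r. 0 < r \<Longrightarrow> r < d \<Longrightarrow> \<zeta> ^ r \<noteq> 1" "d > 0" "\<zeta> ^ n = 1"
  shows "d dvd n"
proof (rule ccontr)
  assume "\<not> d dvd n"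
  hence "0 < n mod d" "n mod d < d" using assms(3) by (auto simp: dvd_eq_mod_eq_0)
  moreover have "\<zeta> ^ n = \<zeta> ^ (d * (n div d) + n mod d)" by simp
  hence "\<zeta> ^ n = \<zeta> ^ (n mod d)" unfolding power_add power_mult by (simp add: assms(1))
  ultimately show False using assms(2,4) by metis
qed

context symmetric_lattice
begin

lemma ae_not_in_L: "\<forall>\<^sub>\<approx>z. z \<notin> L"
  using eventually_not_in_lattice[OF np] by (simp add: ae_iff)

lemma ae_wp'_rotate: "\<rho> \<in> P \<Longrightarrow> \<forall>\<^sub>\<approx>z. deriv wp (\<rho> * z) = deriv wp z / \<rho> ^ 3"
  using ae_not_in_L by (rule eventually_mono) (use wp'_rotate P_L_iff P_nz in auto)

lemma ae_wp'_cnj: "\<forall>\<^sub>\<approx>z. deriv wp (cnj z) = cnj (deriv wp z)"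
  using ae_not_in_L by (rule eventually_mono) (use wp'_cnj cnj_L_iff in auto)

text \<open>Rotation by \<zeta> multiplies \<wp> ^ k by \<zeta> ^ (-2 k), and the pole order is 2 k.
  Both requirements on \<zeta> are thus met by a primitive root of unity of order 2 k.\<close>

lemma generator_wp_power:
  assumes "k > 0" "\<zeta> \<in> P" "\<zeta> ^ (2 * k) = 1" "\<And>r. 0 < r \<Longrightarrow> r < 2 * k \<Longrightarrow> \<zeta> ^ r \<noteq> 1"
  shows "real_lattice_generator u v (\<lambda>z. wp z ^ k) (2 * k) 1 \<zeta>"
proof unfold_locales
  show "(\<lambda>z. wp z ^ k) meromorphic_on UNIV" by (intro meromorphic_intros wp_meromorphic)
  show "(\<lambda>z. wp z ^ k) analytic_on {z}" if "z \<notin> L" for z by (intro analytic_intros wp_analytic that)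
  show "wp (z + w) ^ k = wp z ^ k" if "w \<in> L" for z w by (simp add: wp_period[OF that])
  have "(\<lambda>z. (z ^ 2 * wp z) ^ k) \<midarrow>0\<rightarrow> 1 ^ k" by (intro tendsto_power wp_limit_0)
  thus "(\<lambda>z. z ^ (2 * k) * wp z ^ k) \<midarrow>0\<rightarrow> 1" by (simp add: power_mult_distrib power_mult)
  show "\<zeta> \<noteq> 0" using P_nz assms(2) .
  show "2 * k dvd n" if "\<zeta> ^ n = 1" for n using dvd_of_power_eq_1[OF assms(3,4) _ that] assms(1) by simp
  show "\<forall>\<^sub>\<approx>z. wp (\<zeta> * z) ^ k = wp z ^ k"
    using wp_rotate[of \<zeta>] P_L_iff[OF assms(2)] P_nz[OF assms(2)] assms(3)
    by (simp add: power_divide power_mult)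
  show "\<forall>\<^sub>\<approx>z. wp (cnj z) ^ k = cnj (wp z ^ k)" using wp_cnj cnj_L_iff by simp
qed (use assms(1) in auto)

lemma lattice_function_wp': "lattice_function u v (deriv wp) 3 (- 2)"
  by unfold_locales (auto intro: wp'_meromorphic wp'_analytic wp'_period wp'_limit_0)

text \<open>As for \<wp>, with weight 3 instead of 2.\<close>

lemma generator_wp'_power:
  assumes "k > 0" "\<zeta> \<in> P" "\<zeta> ^ (3 * k) = 1" "\<And>r. 0 < r \<Longrightarrow> r < 3 * k \<Longrightarrow> \<zeta> ^ r \<noteq> 1"
  shows "real_lattice_generator u v (\<lambda>z. deriv wp z ^ k) (3 * k) ((- 2) ^ k) \<zeta>"
proof unfold_locales
  show "(\<lambda>z. deriv wp z ^ k) meromorphic_on UNIV" by (intro meromorphic_intros wp'_meromorphic)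
  show "(\<lambda>z. deriv wp z ^ k) analytic_on {z}" if "z \<notin> L" for z by (intro analytic_intros wp_analytic that)
  show "deriv wp (z + w) ^ k = deriv wp z ^ k" if "w \<in> L" for z w by (simp add: wp'_period[OF that])
  have "(\<lambda>z. (z ^ 3 * deriv wp z) ^ k) \<midarrow>0\<rightarrow> (- 2) ^ k" by (intro tendsto_power wp'_limit_0)
  thus "(\<lambda>z. z ^ (3 * k) * deriv wp z ^ k) \<midarrow>0\<rightarrow> (- 2) ^ k" by (simp add: power_mult_distrib power_mult)
  show "\<zeta> \<noteq> 0" using P_nz assms(2) .
  show "3 * k dvd n" if "\<zeta> ^ n = 1" for n using dvd_of_power_eq_1[OF assms(3,4) _ that] assms(1) by simp
  show "\<forall>\<^sub>\<approx>z. deriv wp (\<zeta> * z) ^ k = deriv wp z ^ k"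
    using ae_wp'_rotate[OF assms(2)] by (rule eventually_mono) (use assms(3) in \<open>simp add: power_divide power_mult\<close>)
  show "\<forall>\<^sub>\<approx>z. deriv wp (cnj z) ^ k = cnj (deriv wp z ^ k)"
    using ae_wp'_cnj by (rule eventually_mono) simp
qed (use assms(1) in auto)

text \<open>The conditions make P the full group of 2 k-th roots of unity; the cases are k = 1 (half
  turns), k = 2 (square) and k = 3 (hexagonal).\<close>

theorem invariant_meromorphic_wp_power:
  assumes "k > 0" "\<zeta> \<in> P" "\<And>r. 0 < r \<Longrightarrow> r < 2 * k \<Longrightarrow> \<zeta> ^ r \<noteq> 1" "\<And>\<rho>. \<rho> \<in> P \<Longrightarrow> \<rho> ^ (2 * k) = 1"
  shows "invariant_meromorphic (motions L P) = {sphere_map (\<lambda>z. R (wp z ^ k)) | R. R \<in> real_rational}"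
proof -
  interpret real_lattice_generator u v "\<lambda>z. wp z ^ k" "2 * k" 1 \<zeta>
    by (intro generator_wp_power assms)
  show ?thesis
  proof (rule invariant_meromorphic_eq[OF one_in_P assms(2) P_norm])
    show "\<forall>\<^sub>\<approx>z. wp (\<rho> * z) ^ k = wp z ^ k" if "\<rho> \<in> P" for \<rho>
      using wp_rotate[of \<rho>] P_L_iff[OF that] P_nz[OF that] assms(4)[OF that]
      by (simp add: power_divide power_mult)
  qed
qed

theorem invariant_meromorphic_wp'_power:
  assumes "k > 0" "\<zeta> \<in> P" "\<And>r. 0 < r \<Longrightarrow> r < 3 * k \<Longrightarrow> \<zeta> ^ r \<noteq> 1" "\<And>\<rho>. \<rho> \<in> P \<Longrightarrow> \<rho> ^ (3 * k) = 1"
  shows "invariant_meromorphic (motions L P) = {sphere_map (\<lambda>z. R (deriv wp z ^ k)) | R. R \<in> real_rational}"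
proof -
  interpret real_lattice_generator u v "\<lambda>z. deriv wp z ^ k" "3 * k" "(- 2) ^ k" \<zeta>
    by (intro generator_wp'_power assms)
  show ?thesis
  proof (rule invariant_meromorphic_eq[OF one_in_P assms(2) P_norm])
    show "\<forall>\<^sub>\<approx>z. deriv wp (\<rho> * z) ^ k = deriv wp z ^ k" if "\<rho> \<in> P" for \<rho>
      using ae_wp'_rotate[OF that] by (rule eventually_mono)
        (use assms(4)[OF that] in \<open>simp add: power_divide power_mult\<close>)
  qed
qed

text \<open>Every lattice is symmetric under z \<mapsto> - z, so the half turn is available for
  splitting functions even if P lacks it.\<close>

lemma symmetric_lattice_pm1: "symmetric_lattice u v {1, - 1}"
  by unfold_locales (auto simp: cnj_L)

text \<open>Split \<open>f\<close> into its even part, which is \<open>R(\<wp>)\<close>, and its odd part, which is \<open>\<wp>'\<close> times an even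
  function.\<close>

theorem invariant_meromorphic_wp_wp':
  assumes P: "P = {1}"
  shows "invariant_meromorphic (motions L P) =
    {sphere_map (\<lambda>z. R (wp z) + S (wp z) * deriv wp z) | R S. R \<in> real_rational \<and> S \<in> real_rational}"
proof -
  \<comment> \<open>Even functions are invariant under this larger group, for which \<wp> itself is
    a generator with \<zeta> = -1.\<close>
  interpret pm1: symmetric_lattice u v "{1, - 1}" by (rule symmetric_lattice_pm1)
  have "real_lattice_generator u v (\<lambda>z. wp z ^ 1) (2 * 1) 1 (- 1)"
    by (rule pm1.generator_wp_power) (auto simp: less_Suc_eq numeral_2_eq_2)
  then interpret G: real_lattice_generator u v wp 2 1 "- 1" by simp
  interpret W: lattice_function u v "deriv wp" 3 "- 2" by (rule lattice_function_wp')
  have wp'_nz: "\<forall>\<^sub>\<approx>z. deriv wp z \<noteq> 0" using W.ae_poly_h_nonzero[of "[:0, 1:]"] by simp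
  have wp'_odd: "\<forall>\<^sub>\<approx>z. deriv wp (- z) = - deriv wp z" using pm1.ae_wp'_rotate[of "- 1"] by simp
  show ?thesis
  proof (subst invariant_meromorphic_motions[OF one_in_P _ lattice_0], fact P_norm, intro equalityI subsetI)
    fix F assume "F \<in> {sphere_map f | f. f meromorphic_on UNIV \<and> ae_invariant L P f}"
    then obtain f where F: "F = sphere_map f" and mero: "f meromorphic_on UNIV"
      and inv: "ae_invariant L P f" by blast
    have mero': "(\<lambda>z. f (- z)) meromorphic_on UNIV" using meromorphic_on_affine[OF mero, of "- 1" 0] by simp
    have per: "\<forall>\<^sub>\<approx>z. f (z + w) = f z" if "w \<in> L" for w using inv that by (simp add: ae_invariant_def)
    have per': "\<forall>\<^sub>\<approx>z. f (- (z + w)) = f (- z)" if "w \<in> L" for w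
      using ae_scale[OF per[OF lattice_uminus[OF that]], of "- 1"] by simp
    have cnj: "\<forall>\<^sub>\<approx>z. cnj (f (cnj z)) = f z" using inv by (simp add: ae_invariant_def)
    have cnj': "\<forall>\<^sub>\<approx>z. cnj (f (- cnj z)) = f (- z)" using ae_scale[OF cnj, of "- 1"] by simp
    define fe where "fe = (\<lambda>z. (f z + f (- z)) / 2)"
    define fo where "fo = (\<lambda>z. (f z - f (- z)) / (2 * deriv wp z))"
    have "fe meromorphic_on UNIV" unfolding fe_def by (intro meromorphic_intros mero mero')
    moreover have "ae_periodic fe" unfolding ae_periodic_def
    proof
      show "\<forall>\<^sub>\<approx>z. fe (z + w) = fe z" if "w \<in> L" for w
        using per[OF that] per'[OF that] by eventually_elim (simp add: fe_def)
    qed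
    moreover have "\<forall>\<^sub>\<approx>z. fe (- 1 * z) = fe z" by (simp add: fe_def add.commute)
    moreover have "\<forall>\<^sub>\<approx>z. cnj (fe (cnj z)) = fe z"
      using cnj cnj' by eventually_elim (simp add: fe_def)
    ultimately obtain R where R: "R \<in> real_rational" "\<forall>\<^sub>\<approx>z. fe z = R (wp z)"
      by (rule G.invariant_imp_real_rational)
    have "fo meromorphic_on UNIV" unfolding fo_def by (intro meromorphic_intros mero mero' wp'_meromorphic)
    moreover have "ae_periodic fo" unfolding ae_periodic_def
    proof
      show "\<forall>\<^sub>\<approx>z. fo (z + w) = fo z" if "w \<in> L" for w
        using per[OF that] per'[OF that] by eventually_elim (simp add: fo_def wp'_period[OF that])
    qed
    \<comment> \<open>Numerator and denominator are both odd.\<close>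
    moreover have "\<forall>\<^sub>\<approx>z. fo (- 1 * z) = fo z"
      using wp'_odd by eventually_elim (simp add: fo_def minus_divide_left)
    moreover have "\<forall>\<^sub>\<approx>z. cnj (fo (cnj z)) = fo z"
      using cnj cnj' ae_wp'_cnj by eventually_elim (simp add: fo_def)
    ultimately obtain S where S: "S \<in> real_rational" "\<forall>\<^sub>\<approx>z. fo z = S (wp z)"
      by (rule G.invariant_imp_real_rational)
    have "\<forall>\<^sub>\<approx>z. f z = R (wp z) + S (wp z) * deriv wp z"
      using R(2) S(2) wp'_nz
    proof eventually_elim
      case (elim z)
      have "f z = fe z + fo z * deriv wp z" using elim(3) by (simp add: fe_def fo_def field_simps)
      thus ?case using elim by simp
    qed
    hence "F = sphere_map (\<lambda>z. R (wp z) + S (wp z) * deriv wp z)" unfolding F by (rule sphere_map_cong)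
    thus "F \<in> {sphere_map (\<lambda>z. R (wp z) + S (wp z) * deriv wp z) | R S. R \<in> real_rational \<and> S \<in> real_rational}"
      using R(1) S(1) by blast
  next
    fix F assume "F \<in> {sphere_map (\<lambda>z. R (wp z) + S (wp z) * deriv wp z) | R S. R \<in> real_rational \<and> S \<in> real_rational}"
    then obtain R S where RS: "R \<in> real_rational" "S \<in> real_rational"
      and F: "F = sphere_map (\<lambda>z. R (wp z) + S (wp z) * deriv wp z)" by blast
    have "(\<lambda>z. R (wp z) + S (wp z) * deriv wp z) meromorphic_on UNIV"
      by (rule meromorphic_on_add meromorphic_on_mult real_rational_meromorphic[OF RS(1) wp_meromorphic]
          real_rational_meromorphic[OF RS(2) wp_meromorphic] wp'_meromorphic)+
    moreover have "ae_invariant L P (\<lambda>z. R (wp z) + S (wp z) * deriv wp z)"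
      unfolding ae_invariant_def
    proof (intro conjI ballI)
      show "\<forall>\<^sub>\<approx>z. cnj (R (wp (cnj z)) + S (wp (cnj z)) * deriv wp (cnj z)) = R (wp z) + S (wp z) * deriv wp z"
        using G.ae_real_rational_cnj[OF G.h_cnj RS(1)] G.ae_real_rational_cnj[OF G.h_cnj RS(2)] ae_wp'_cnj
        by eventually_elim simp
    qed (simp_all add: wp_period wp'_period P)
    ultimately show "F \<in> {sphere_map f | f. f meromorphic_on UNIV \<and> ae_invariant L P f}"
      using F by blast
  qed
qed

end


section \<open>The individual groups\<close>

lemma symmetric_latticeI:
  assumes "nonparallel u v" "1 \<in> P" "\<And>\<rho> \<sigma>. \<rho> \<in> P \<Longrightarrow> \<sigma> \<in> P \<Longrightarrow> \<rho> * \<sigma> \<in> P"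
    "\<And>\<rho>. \<rho> \<in> P \<Longrightarrow> cnj \<rho> \<in> P" "\<And>\<rho>. \<rho> \<in> P \<Longrightarrow> norm \<rho> = 1"
    "\<And>\<rho>. \<rho> \<in> P \<Longrightarrow> \<rho> * u \<in> lattice u v" "\<And>\<rho>. \<rho> \<in> P \<Longrightarrow> \<rho> * v \<in> lattice u v"
    "cnj u \<in> lattice u v" "cnj v \<in> lattice u v"
  shows "symmetric_lattice u v P"
proof unfold_locales
  show "\<rho> * w \<in> lattice u v" if "\<rho> \<in> P" "w \<in> lattice u v" for \<rho> w
  proof (rule lattice_linear[of "\<lambda>z. \<rho> * z"])
    show "Modules.additive (\<lambda>z. \<rho> * z)" by (simp add: Modules.additive_def distrib_left)
  qed (use assms(6,7) that in auto)
  show "cnj w \<in> lattice u v" if "w \<in> lattice u v" for w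
    using lattice_linear[of cnj] assms(8,9) that by (simp add: Modules.additive_def)
qed (use assms in auto)

text \<open>K is a table that pairs each linear part, given by \<rho> and the flag r, with its
  coordinate expression h. Exhausting the table on both sides gives the two directions of the
  matching.\<close>

lemma (in symmetric_lattice) wallpaper_type_motionsI:
  assumes "nonparallel a b"
    and "L = {affine_frame 0 a b (c + (of_int m, of_int n)) | c m n. c \<in> centring T}"
    and K: "\<And>\<rho> r h x y. (\<rho>, r, h) \<in> K \<Longrightarrow>
      motion \<rho> r 0 (affine_frame 0 a b (x, y)) = affine_frame 0 a b (h (x, y))"
    and K1: "P \<times> UNIV \<subseteq> (\<lambda>(\<rho>, r, h). (\<rho>, r)) ` K" and K2: "general_positions T = (\<lambda>(\<rho>, r, h). h) ` K"
    and K3: "fst ` K \<subseteq> P"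
  shows "wallpaper_group_of_type T (motions L P)"
proof (rule wallpaper_type_motions[OF assms(1,2)])
  fix \<rho> r assume "\<rho> \<in> P"
  hence "(\<rho>, r) \<in> (\<lambda>(\<rho>, r, h). (\<rho>, r)) ` K" using K1 by blast
  then obtain h where "(\<rho>, r, h) \<in> K" by auto
  thus "\<exists>h\<in>general_positions T. \<forall>x y. motion \<rho> r 0 (affine_frame 0 a b (x, y)) = affine_frame 0 a b (h (x, y))"
    using K unfolding K2 by force
next
  fix h assume "h \<in> general_positions T"
  then obtain \<rho> r where "(\<rho>, r, h) \<in> K" unfolding K2 by auto
  thus "\<exists>\<rho>\<in>P. \<exists>r. \<forall>x y. motion \<rho> r 0 (affine_frame 0 a b (x, y)) = affine_frame 0 a b (h (x, y))"
    using K K3 by force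
qed

subsection \<open>Rectangular, rhombic and square lattices\<close>

context
  fixes \<alpha> \<beta> :: real
  assumes nz: "\<alpha> \<noteq> 0" "\<beta> \<noteq> 0"
begin

lemma rectangular_symmetric:
  assumes "P = {1} \<or> P = {1, - 1}"
  shows "symmetric_lattice (of_real \<alpha>) (of_real \<beta> * \<i>) P"
  using assms nz lattice_basis1 lattice_basis2
  by (intro symmetric_latticeI) (auto simp: nonparallel_iff)

lemma rhombic_symmetric:
  assumes "P = {1} \<or> P = {1, - 1}"
  shows "symmetric_lattice (of_real \<alpha> + of_real \<beta> * \<i>) (of_real \<alpha> - of_real \<beta> * \<i>) P"
  using assms nz lattice_basis1 lattice_basis2
    lattice_uminus[OF lattice_basis1[of "of_real \<alpha> + of_real \<beta> * \<i>" "of_real \<alpha> - of_real \<beta> * \<i>"]]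
    lattice_uminus[OF lattice_basis2[of "of_real \<alpha> - of_real \<beta> * \<i>" "of_real \<alpha> + of_real \<beta> * \<i>"]]
  by (intro symmetric_latticeI) (auto simp: nonparallel_iff algebra_simps)

lemma square_symmetric: "symmetric_lattice (of_real \<alpha>) (of_real \<alpha> * \<i>) {1, \<i>, - 1, - \<i>}"
proof -
  have "\<i> * of_real \<alpha> \<in> lattice (of_real \<alpha>) (of_real \<alpha> * \<i>)"
    using lattice_basis2[of "of_real \<alpha> * \<i>" "of_real \<alpha>"] by (simp add: mult.commute)
  moreover have "\<i> * (of_real \<alpha> * \<i>) = - of_real \<alpha>" by (simp add: algebra_simps)
  ultimately show ?thesis
    using nz lattice_basis1 lattice_basis2
    by (intro symmetric_latticeI) (auto simp: nonparallel_iff)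
qed

lemma type_rectangular:
  assumes "T = pm \<and> P = {1} \<or> T = p2mm \<and> P = {1, - 1}"
  shows "wallpaper_group_of_type T (motions (lattice (of_real \<alpha>) (of_real \<beta> * \<i>)) P)"
proof -
  interpret symmetric_lattice "of_real \<alpha>" "of_real \<beta> * \<i>" P using rectangular_symmetric assms by blast
  \<comment> \<open>The imaginary generator comes first because the listed mirror reverses the first
    coordinate, as \<open>cnj\<close> reverses the imaginary direction.\<close>
  have np': "nonparallel (of_real \<beta> * \<i>) (of_real \<alpha>)" using np nonparallel_commute by blast
  have L: "L = {affine_frame 0 (of_real \<beta> * \<i>) (of_real \<alpha>) (c + (of_int m, of_int n)) | c m n. c \<in> centring T}"
    using lattice_eq_primitive[of T] assms by (subst lattice_commute) blast
  from assms show ?thesis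
  proof
    assume T: "T = pm \<and> P = {1}"
    show ?thesis
      by (rule wallpaper_type_motionsI[OF np' L, where K = "{(1, False, \<lambda>(x, y). (x, y)), (1, True, \<lambda>(x, y). (- x, y))}"])
        (auto simp: T motion_def affine_frame_def UNIV_bool)
  next
    assume T: "T = p2mm \<and> P = {1, - 1}"
    show ?thesis
      by (rule wallpaper_type_motionsI[OF np' L, where K = "{(1, False, \<lambda>(x, y). (x, y)), (1, True, \<lambda>(x, y). (- x, y)),
         (- 1, False, \<lambda>(x, y). (- x, - y)), (- 1, True, \<lambda>(x, y). (x, - y))}"])
        (auto simp: T motion_def affine_frame_def UNIV_bool)
  qed
qed

lemma type_rhombic:
  assumes "T = cm \<and> P = {1} \<or> T = c2mm \<and> P = {1, - 1}"
  shows "wallpaper_group_of_type T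
    (motions (lattice (of_real \<alpha> + of_real \<beta> * \<i>) (of_real \<alpha> - of_real \<beta> * \<i>)) P)"
proof -
  interpret symmetric_lattice "of_real \<alpha> + of_real \<beta> * \<i>" "of_real \<alpha> - of_real \<beta> * \<i>" P
    using rhombic_symmetric assms by blast
  have np': "nonparallel (2 * (of_real \<beta> * \<i>)) (2 * of_real \<alpha>)" using nz by (simp add: nonparallel_iff)
  have L: "L = {affine_frame 0 (2 * (of_real \<beta> * \<i>)) (2 * of_real \<alpha>) (c + (of_int m, of_int n)) | c m n. c \<in> centring T}"
    using lattice_eq_centred[of T] assms by blast
  from assms show ?thesis
  proof
    assume T: "T = cm \<and> P = {1}"
    show ?thesis
      by (rule wallpaper_type_motionsI[OF np' L, where K = "{(1, False, \<lambda>(x, y). (x, y)), (1, True, \<lambda>(x, y). (- x, y))}"])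
        (auto simp: T motion_def affine_frame_def UNIV_bool)
  next
    assume T: "T = c2mm \<and> P = {1, - 1}"
    show ?thesis
      by (rule wallpaper_type_motionsI[OF np' L, where K = "{(1, False, \<lambda>(x, y). (x, y)), (1, True, \<lambda>(x, y). (- x, y)),
         (- 1, False, \<lambda>(x, y). (- x, - y)), (- 1, True, \<lambda>(x, y). (x, - y))}"])
        (auto simp: T motion_def affine_frame_def UNIV_bool)
  qed
qed

lemma type_square:
  "wallpaper_group_of_type p4mm (motions (lattice (of_real \<alpha>) (of_real \<alpha> * \<i>)) {1, \<i>, - 1, - \<i>})"
proof -
  interpret symmetric_lattice "of_real \<alpha>" "of_real \<alpha> * \<i>" "{1, \<i>, - 1, - \<i>}" by (rule square_symmetric)
  show ?thesis
    by (rule wallpaper_type_motionsI[OF np lattice_eq_primitive, where K = "{(1, False, \<lambda>(x, y). (x, y)),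
        (1, True, \<lambda>(x, y). (x, - y)), (- 1, False, \<lambda>(x, y). (- x, - y)), (- 1, True, \<lambda>(x, y). (- x, y)),
        (\<i>, False, \<lambda>(x, y). (- y, x)), (\<i>, True, \<lambda>(x, y). (y, x)),
        (- \<i>, False, \<lambda>(x, y). (y, - x)), (- \<i>, True, \<lambda>(x, y). (- y, - x))}"])
      (auto simp: motion_def affine_frame_def UNIV_bool algebra_simps)
qed

end


subsection \<open>Hexagonal lattices\<close>

context
  fixes \<omega> :: complex
  assumes cube: "\<omega> ^ 3 = 1" and \<omega>_ne: "\<omega> \<noteq> 1"
begin

lemma \<omega>_square: "\<omega> * \<omega> = - 1 - \<omega>"
proof -
  have "(\<omega> - 1) * (\<omega> * \<omega> + \<omega> + 1) = \<omega> ^ 3 - 1" by (simp add: algebra_simps power3_eq_cube)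
  hence "\<omega> * \<omega> + \<omega> + 1 = 0" using cube \<omega>_ne by simp
  thus ?thesis by algebra
qed

lemma \<omega>_square': "\<omega> * (\<omega> * z) = - z - \<omega> * z"
  using \<omega>_square by algebra

lemma norm_\<omega>: "norm \<omega> = 1"
proof -
  have "norm \<omega> ^ 3 = 1" using arg_cong[OF cube, of norm] by (simp add: norm_power)
  thus ?thesis using power_eq_1_iff[of "norm \<omega>" 3] by simp
qed

lemma cnj_\<omega>: "cnj \<omega> = - 1 - \<omega>"
proof -
  have "\<omega> * cnj \<omega> = 1" using norm_\<omega> by (simp add: complex_norm_square[symmetric])
  moreover have "\<omega> * (- 1 - \<omega>) = 1" using \<omega>_square by algebra
  ultimately show ?thesis by (metis mult_cancel_left mult_zero_left zero_neq_one)
qed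

lemma Im_\<omega>: "Im \<omega> \<noteq> 0"
proof
  assume "Im \<omega> = 0"
  hence "cnj \<omega> = \<omega>" by (simp add: complex_eq_iff)
  hence "2 * \<omega> = - 1" using cnj_\<omega> by (simp add: algebra_simps)
  hence "norm (2 * \<omega>) = norm (- 1 :: complex)" by simp
  thus False using norm_\<omega> by (simp add: norm_mult)
qed

text \<open>The cube and sixth roots of unity, written with -1 - \<omega> for \<omega>^2, so that
  their products with a lattice vector are visibly integer combinations of a and \<omega> a.\<close>

definition C3 :: "complex set" where "C3 = {1, \<omega>, - 1 - \<omega>}"
definition C6 :: "complex set" where "C6 = {1, \<omega>, - 1 - \<omega>, - 1, - \<omega>, 1 + \<omega>}"

lemma C3_iff: "\<rho> \<in> C3 \<longleftrightarrow> \<rho> ^ 3 = 1"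
proof -
  have "(\<rho> - 1) * ((\<rho> - \<omega>) * (\<rho> - (- 1 - \<omega>))) = \<rho> ^ 3 - 1"
    using \<omega>_square by algebra
  hence "\<rho> ^ 3 = 1 \<longleftrightarrow> (\<rho> - 1) * ((\<rho> - \<omega>) * (\<rho> - (- 1 - \<omega>))) = 0" by simp
  thus ?thesis unfolding mult_eq_0_iff C3_def by (metis eq_iff_diff_eq_0 insert_iff singletonD)
qed

lemma C6_iff: "\<rho> \<in> C6 \<longleftrightarrow> \<rho> ^ 6 = 1"
proof -
  have "\<rho> \<in> C6 \<longleftrightarrow> \<rho> \<in> C3 \<or> - \<rho> \<in> C3"
    unfolding C3_def C6_def by (auto simp: minus_equation_iff[of \<rho>])
  also have "\<dots> \<longleftrightarrow> (\<rho> ^ 3 - 1) * (\<rho> ^ 3 + 1) = 0"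
    unfolding C3_iff mult_eq_0_iff by (auto simp: minus_equation_iff add_eq_0_iff)
  also have "(\<rho> ^ 3 - 1) * (\<rho> ^ 3 + 1) = \<rho> ^ 6 - 1" by algebra
  finally show ?thesis by simp
qed

lemma \<omega>_powers: "\<omega> ^ 2 \<noteq> 1" "\<omega> \<noteq> - 1" "- (\<omega> ^ 2) \<noteq> 1"
proof -
  show 1: "\<omega> ^ 2 \<noteq> 1" using cube \<omega>_ne by (metis mult_1 power2_eq_square power3_eq_cube)
  thus "\<omega> \<noteq> - 1" by auto
  show "- (\<omega> ^ 2) \<noteq> 1"
  proof
    assume "- (\<omega> ^ 2) = 1"
    hence "\<omega> = 0" using \<omega>_square by (simp add: power2_eq_square)
    thus False using norm_\<omega> by simp
  qed
qed

lemma C6_primitive: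
  assumes "0 < r" "r < 6"
  shows "(- \<omega>) ^ r \<noteq> 1"
proof -
  have "(- \<omega>) ^ 4 = \<omega>" "(- \<omega>) ^ 5 = - (\<omega> ^ 2)" "(- \<omega>) ^ 3 = - 1" "(- \<omega>) ^ 2 = \<omega> ^ 2"
    using cube by (simp_all add: numeral_eq_Suc)
  moreover have "r = 1 \<or> r = 2 \<or> r = 3 \<or> r = 4 \<or> r = 5" using assms by auto
  moreover have "- \<omega> \<noteq> 1" using \<omega>_powers(2) by (metis minus_minus)
  ultimately show ?thesis using \<omega>_powers \<omega>_ne by auto
qed

text \<open>The roots of \<omega>^2 + \<omega> + 1. Either one may be the given \<omega>, so both
  signs have to be carried along.\<close>

lemma hexagonal_rhombus_cases:
  "2 * \<omega> = - 1 + of_real (sqrt 3) * \<i> \<or> 2 * \<omega> = - 1 - of_real (sqrt 3) * \<i>"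
proof -
  have sq: "of_real (sqrt 3) * of_real (sqrt 3) = (3 :: complex)" by (simp flip: of_real_mult)
  have "(2 * \<omega> + 1 - of_real (sqrt 3) * \<i>) * (2 * \<omega> + 1 + of_real (sqrt 3) * \<i>) = 4 * (\<omega> * \<omega>) + 4 * \<omega> + 1 + of_real (sqrt 3) * of_real (sqrt 3)"
    by (simp add: algebra_simps)
  also have "\<dots> = 0" unfolding sq \<omega>_square by simp
  finally have "2 * \<omega> + 1 - of_real (sqrt 3) * \<i> = 0 \<or> 2 * \<omega> + 1 + of_real (sqrt 3) * \<i> = 0"
    by (simp only: mult_eq_0_iff)
  thus ?thesis by (rule disj_forward) algebra+
qed

section \<open>Hexagonal lattices with a basis vector on the mirror line or perpendicular to
  it\<close>

context
  fixes a :: complex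
  assumes a_nz: "a \<noteq> 0" and cnj_a: "cnj a = a \<or> cnj a = - a"
begin

lemma hexagonal_nonparallel: "nonparallel a (\<omega> * a)"
proof -
  have "cnj a * (\<omega> * a) = of_real ((norm a)\<^sup>2) * \<omega>"
    using complex_norm_square[of a] by (simp add: mult_ac)
  moreover have "Im (of_real t * \<omega>) = t * Im \<omega>" for t by simp
  ultimately have "Im (cnj a * (\<omega> * a)) = (norm a)\<^sup>2 * Im \<omega>" by metis
  thus ?thesis using a_nz Im_\<omega> by (simp add: nonparallel_iff)
qed

lemma hexagonal_L:
  "a \<in> lattice a (\<omega> * a)" "\<omega> * a \<in> lattice a (\<omega> * a)"
  "\<omega> * (\<omega> * a) \<in> lattice a (\<omega> * a)"
proof -
  show 1: "a \<in> lattice a (\<omega> * a)" "\<omega> * a \<in> lattice a (\<omega> * a)"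
    by (rule lattice_basis1 lattice_basis2)+
  have "\<omega> * (\<omega> * a) = - a - \<omega> * a" using \<omega>_square by algebra
  thus "\<omega> * (\<omega> * a) \<in> lattice a (\<omega> * a)" using 1 by (simp add: lattice_diff)
qed

lemma hexagonal_symmetric: "P = C3 \<or> P = C6 \<Longrightarrow> symmetric_lattice a (\<omega> * a) P"
proof (rule symmetric_latticeI[OF hexagonal_nonparallel])
  let ?L = "lattice a (\<omega> * a)"
  assume P: "P = C3 \<or> P = C6"
  show "1 \<in> P" using P by (auto simp: C3_def C6_def)
  \<comment> \<open>The description as n-th roots of unity gives closure under products and
    conjugation, and norm 1, for both groups at once.\<close>
  have "C3 = {\<rho>. \<rho> ^ 3 = 1}" "C6 = {\<rho>. \<rho> ^ 6 = 1}" by (simp_all add: set_eq_iff C3_iff C6_iff)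
  then obtain n :: nat where n: "P = {\<rho>. \<rho> ^ n = 1}" "n > 0"
    using P zero_less_numeral by metis
  show "\<rho> * \<sigma> \<in> P" if "\<rho> \<in> P" "\<sigma> \<in> P" for \<rho> \<sigma>
    using that by (simp add: n power_mult_distrib)
  show "cnj \<rho> \<in> P" if "\<rho> \<in> P" for \<rho> using that by (simp add: n flip: complex_cnj_power)
  show "norm \<rho> = 1" if "\<rho> \<in> P" for \<rho>
  proof -
    have "norm \<rho> ^ n = 1" using that by (simp add: n(1) flip: norm_power)
    thus ?thesis using n(2) power_eq_1_iff[of "norm \<rho>" n] by auto
  qed
  have neg: "(- 1 - \<omega>) * z = - (z + \<omega> * z)" "(1 + \<omega>) * z = z + \<omega> * z" for z by (simp_all add: algebra_simps)
  show "\<rho> * a \<in> ?L" "\<rho> * (\<omega> * a) \<in> ?L" if "\<rho> \<in> P" for \<rho>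
    using P that hexagonal_L by (auto simp: C3_def C6_def neg lattice_add lattice_diff)
  show "cnj a \<in> ?L" using cnj_a hexagonal_L by auto
  have "cnj (\<omega> * a) = - (a + \<omega> * a) \<or> cnj (\<omega> * a) = a + \<omega> * a"
    using cnj_a by (auto simp: cnj_\<omega> algebra_simps)
  thus "cnj (\<omega> * a) \<in> ?L" using hexagonal_L by (auto simp: lattice_add lattice_diff)
qed

lemma motion_group_C3: "motion_group (lattice a (\<omega> * a)) {\<omega>} = motions (lattice a (\<omega> * a)) C3"
proof -
  interpret symmetric_lattice a "\<omega> * a" C3 by (simp add: hexagonal_symmetric)
  show ?thesis
  proof (rule motion_group_eq)
    fix S :: "complex set"
    assume S: "1 \<in> S" "{\<omega>} \<subseteq> S" "\<And>\<rho> \<sigma>. \<rho> \<in> S \<Longrightarrow> \<sigma> \<in> S \<Longrightarrow> \<rho> * \<sigma> \<in> S"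
    have "- 1 - \<omega> \<in> S" using S(3)[of \<omega> \<omega>] S(2) \<omega>_square by simp
    thus "C3 \<subseteq> S" using S by (simp add: C3_def)
  qed (simp add: C3_def)
qed

lemma motion_group_C6: "motion_group (lattice a (\<omega> * a)) {- 1, \<omega>} = motions (lattice a (\<omega> * a)) C6"
proof -
  interpret symmetric_lattice a "\<omega> * a" C6 by (simp add: hexagonal_symmetric)
  show ?thesis
  proof (rule motion_group_eq)
    fix S :: "complex set"
    assume S: "1 \<in> S" "{- 1, \<omega>} \<subseteq> S" "\<And>\<rho> \<sigma>. \<rho> \<in> S \<Longrightarrow> \<sigma> \<in> S \<Longrightarrow> \<rho> * \<sigma> \<in> S"
    have 1: "- 1 - \<omega> \<in> S" using S(3)[of \<omega> \<omega>] S(2) \<omega>_square by simp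
    have neg: "- \<rho> \<in> S" if "\<rho> \<in> S" for \<rho> using S(3)[of "- 1" \<rho>] S(2) that by simp
    show "C6 \<subseteq> S" using S neg[OF 1] neg[of \<omega>] 1 by (simp add: C6_def add.commute)
  qed (simp add: C6_def)
qed

lemma invariant_C3:
  "invariant_meromorphic (motions (lattice a (\<omega> * a)) C3)
     = {sphere_map (\<lambda>z. R (deriv (weierstrass_p (lattice a (\<omega> * a))) z)) | R. R \<in> real_rational}"
proof -
  interpret symmetric_lattice a "\<omega> * a" C3 by (simp add: hexagonal_symmetric)
  have "invariant_meromorphic (motions L C3) = {sphere_map (\<lambda>z. R (deriv wp z ^ 1)) | R. R \<in> real_rational}"
  proof (rule invariant_meromorphic_wp'_power)
    show "\<omega> \<in> C3" by (simp add: C3_def)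
    show "\<omega> ^ r \<noteq> 1" if "0 < r" "r < 3 * 1" for r
    proof -
      have "r = 1 \<or> r = 2" using that by auto
      thus ?thesis using \<omega>_powers \<omega>_ne by auto
    qed
  qed (use C3_iff in auto)
  thus ?thesis by simp
qed

text \<open>The element -\<omega> has order 6, which is the pole order of both \<wp>'^2 and
  \<wp>^3.\<close>

lemma invariant_C6:
  "invariant_meromorphic (motions (lattice a (\<omega> * a)) C6)
     = {sphere_map (\<lambda>z. R (deriv (weierstrass_p (lattice a (\<omega> * a))) z ^ 2)) | R. R \<in> real_rational}"
  "invariant_meromorphic (motions (lattice a (\<omega> * a)) C6)
     = {sphere_map (\<lambda>z. R (weierstrass_p (lattice a (\<omega> * a)) z ^ 3)) | R. R \<in> real_rational}"
proof -
  interpret symmetric_lattice a "\<omega> * a" C6 by (simp add: hexagonal_symmetric)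
  have C6: "- \<omega> \<in> C6" by (simp add: C6_def)
  show "invariant_meromorphic (motions L C6) = {sphere_map (\<lambda>z. R (deriv wp z ^ 2)) | R. R \<in> real_rational}"
    by (rule invariant_meromorphic_wp'_power[OF _ C6]) (use C6_iff C6_primitive in auto)
  show "invariant_meromorphic (motions L C6) = {sphere_map (\<lambda>z. R (wp z ^ 3)) | R. R \<in> real_rational}"
    by (rule invariant_meromorphic_wp_power[OF _ C6]) (use C6_iff C6_primitive in auto)
qed

text \<open>For real a, conjugation fixes a and sends \<omega> a to -a - \<omega> a, which is the
  coordinate map (x - y, -y). The other mirrors arise by multiplying with \<omega> and
  \<omega>^2.\<close>

lemma type_p31m:
  assumes "cnj a = a"
  shows "wallpaper_group_of_type p31m (motions (lattice a (\<omega> * a)) C3)"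
proof -
  interpret symmetric_lattice a "\<omega> * a" C3 by (simp add: hexagonal_symmetric)
  show ?thesis
  proof (rule wallpaper_type_motionsI[OF np lattice_eq_primitive])
    let ?K = "{(1, False, \<lambda>(x, y). (x, y)), (\<omega>, False, \<lambda>(x, y). (- y, x - y)), (- 1 - \<omega>, False, \<lambda>(x, y). (- x + y, - x)),
       (\<omega>, True, \<lambda>(x, y). (y, x)), (1, True, \<lambda>(x, y). (x - y, - y)), (- 1 - \<omega>, True, \<lambda>(x, y). (- x, - x + y))}
       :: (complex \<times> bool \<times> (real \<times> real \<Rightarrow> real \<times> real)) set"
    show "motion \<rho> r 0 (affine_frame 0 a (\<omega> * a) (x, y)) = affine_frame 0 a (\<omega> * a) (h (x, y))"
      if "(\<rho>, r, h) \<in> ?K" for \<rho> r h x y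
      using that by (safe; simp add: motion_def affine_frame_def assms cnj_\<omega> \<omega>_square \<omega>_square' algebra_simps)
    show "C3 \<times> UNIV \<subseteq> (\<lambda>(\<rho>, r, h). (\<rho>, r)) ` ?K" by (auto simp: C3_def UNIV_bool)
    show "general_positions p31m = (\<lambda>(\<rho>, r, h). h) ` ?K" by simp
    show "fst ` ?K \<subseteq> C3" by (simp add: C3_def)
  qed auto
qed

text \<open>For imaginary a, conjugation acquires a sign on both basis vectors, so the reversing
  entries of the table are the negatives of those for p31m.\<close>

lemma type_p3m1:
  assumes "cnj a = - a"
  shows "wallpaper_group_of_type p3m1 (motions (lattice a (\<omega> * a)) C3)"
proof -
  interpret symmetric_lattice a "\<omega> * a" C3 by (simp add: hexagonal_symmetric)
  show ?thesis
  proof (rule wallpaper_type_motionsI[OF np lattice_eq_primitive])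
    let ?K = "{(1, False, \<lambda>(x, y). (x, y)), (\<omega>, False, \<lambda>(x, y). (- y, x - y)), (- 1 - \<omega>, False, \<lambda>(x, y). (- x + y, - x)),
       (\<omega>, True, \<lambda>(x, y). (- y, - x)), (1, True, \<lambda>(x, y). (- x + y, y)), (- 1 - \<omega>, True, \<lambda>(x, y). (x, x - y))}
       :: (complex \<times> bool \<times> (real \<times> real \<Rightarrow> real \<times> real)) set"
    show "motion \<rho> r 0 (affine_frame 0 a (\<omega> * a) (x, y)) = affine_frame 0 a (\<omega> * a) (h (x, y))"
      if "(\<rho>, r, h) \<in> ?K" for \<rho> r h x y
      using that by (safe; simp add: motion_def affine_frame_def assms cnj_\<omega> \<omega>_square \<omega>_square' algebra_simps)
    show "C3 \<times> UNIV \<subseteq> (\<lambda>(\<rho>, r, h). (\<rho>, r)) ` ?K" by (auto simp: C3_def UNIV_bool)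
    show "general_positions p3m1 = (\<lambda>(\<rho>, r, h). h) ` ?K" by simp
    show "fst ` ?K \<subseteq> C3" by (simp add: C3_def)
  qed auto
qed

text \<open>As -1 is now a rotation, the mirrors of p31m and of p3m1 occur together.\<close>

lemma type_p6mm:
  assumes "cnj a = a"
  shows "wallpaper_group_of_type p6mm (motions (lattice a (\<omega> * a)) C6)"
proof -
  interpret symmetric_lattice a "\<omega> * a" C6 by (simp add: hexagonal_symmetric)
  show ?thesis
  proof (rule wallpaper_type_motionsI[OF np lattice_eq_primitive])
    let ?K = "{(1, False, \<lambda>(x, y). (x, y)), (\<omega>, False, \<lambda>(x, y). (- y, x - y)), (- 1 - \<omega>, False, \<lambda>(x, y). (- x + y, - x)),
       (- 1, False, \<lambda>(x, y). (- x, - y)), (- \<omega>, False, \<lambda>(x, y). (y, - x + y)), (1 + \<omega>, False, \<lambda>(x, y). (x - y, x)),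
       (- \<omega>, True, \<lambda>(x, y). (- y, - x)), (- 1, True, \<lambda>(x, y). (- x + y, y)), (1 + \<omega>, True, \<lambda>(x, y). (x, x - y)),
       (\<omega>, True, \<lambda>(x, y). (y, x)), (1, True, \<lambda>(x, y). (x - y, - y)), (- 1 - \<omega>, True, \<lambda>(x, y). (- x, - x + y))}
       :: (complex \<times> bool \<times> (real \<times> real \<Rightarrow> real \<times> real)) set"
    show "motion \<rho> r 0 (affine_frame 0 a (\<omega> * a) (x, y)) = affine_frame 0 a (\<omega> * a) (h (x, y))"
      if "(\<rho>, r, h) \<in> ?K" for \<rho> r h x y
      using that by (safe; simp add: motion_def affine_frame_def assms cnj_\<omega> \<omega>_square \<omega>_square' algebra_simps)
    show "C6 \<times> UNIV \<subseteq> (\<lambda>(\<rho>, r, h). (\<rho>, r)) ` ?K" by (auto simp: C6_def UNIV_bool)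
    show "general_positions p6mm = (\<lambda>(\<rho>, r, h). h) ` ?K" by simp
    show "fst ` ?K \<subseteq> C6" by (simp add: C6_def)
  qed auto
qed

end

end

section \<open>Passage from the stated bases to hexagonal bases, and assembly of the cases\<close>

lemma lattice_uminus_right: "lattice u (- v) = lattice u v"
proof (rule lattice_eqI)
  show "- v \<in> lattice u v" by (simp add: lattice_basis2)
  have "- (- v) \<in> lattice u (- v)" by (rule lattice_uminus[OF lattice_basis2])
  thus "v \<in> lattice u (- v)" by simp
qed (rule lattice_basis1)+

text \<open>The vector a is a diagonal of the rhombus, and rotation by \<omega> takes it to the
  negative of a side; the other side is then a + \<omega> a. The disjunction accounts for the two
  possible values of \<omega>.\<close>

lemma rhombus_eq_hexagonal:
  fixes \<omega> u v :: complex
  assumes "\<omega> * a = - u \<or> \<omega> * a = - v" "a = u + v"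
  shows "lattice u v = lattice a (\<omega> * a)"
proof (rule lattice_eqI[symmetric])
  note uv = lattice_basis1[of u v] lattice_basis2[of v u]
  note ab = lattice_basis1[of a "\<omega> * a"] lattice_basis2[of "\<omega> * a" a]
  show "a \<in> lattice u v" "\<omega> * a \<in> lattice u v" using assms uv by (auto intro: lattice_add)
  have "u = - (\<omega> * a) \<and> v = a + \<omega> * a \<or> v = - (\<omega> * a) \<and> u = a + \<omega> * a" using assms by auto
  thus "u \<in> lattice a (\<omega> * a)" "v \<in> lattice a (\<omega> * a)" using ab lattice_add lattice_uminus by metis+
qed

lemma motion_group_trivial:
  assumes "symmetric_lattice u v {1}"
  shows "motion_group (lattice u v) {} = motions (lattice u v) {1}"
  by (rule symmetric_lattice.motion_group_eq[OF assms]) auto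

lemma motion_group_pm1:
  assumes "symmetric_lattice u v {1, - 1}"
  shows "motion_group (lattice u v) {- 1} = motions (lattice u v) {1, - 1}"
  by (rule symmetric_lattice.motion_group_eq[OF assms]) auto

lemma invariant_pm1:
  assumes "symmetric_lattice u v {1, - 1}"
  shows "invariant_meromorphic (motions (lattice u v) {1, - 1})
    = {sphere_map (\<lambda>z. R (weierstrass_p (lattice u v) z)) | R. R \<in> real_rational}"
proof -
  have "invariant_meromorphic (motions (lattice u v) {1, - 1})
    = {sphere_map (\<lambda>z. R (weierstrass_p (lattice u v) z ^ 1)) | R. R \<in> real_rational}"
    by (rule symmetric_lattice.invariant_meromorphic_wp_power[OF assms, of 1 "- 1"])
      (auto simp: less_Suc_eq numeral_2_eq_2)
  thus ?thesis by simp
qed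

lemma motion_group_square:
  assumes "\<alpha> \<noteq> 0"
  shows "motion_group (lattice (of_real \<alpha>) (of_real \<alpha> * \<i>)) {\<i>}
    = motions (lattice (of_real \<alpha>) (of_real \<alpha> * \<i>)) {1, \<i>, - 1, - \<i>}"
proof (rule symmetric_lattice.motion_group_eq[OF square_symmetric[OF assms assms]])
  fix S :: "complex set"
  assume S: "1 \<in> S" "{\<i>} \<subseteq> S" "\<And>\<rho> \<sigma>. \<rho> \<in> S \<Longrightarrow> \<sigma> \<in> S \<Longrightarrow> \<rho> * \<sigma> \<in> S"
  have "- 1 \<in> S" using S(3)[of \<i> \<i>] S(2) by simp
  moreover have "- \<i> \<in> S" using S(3)[of "- 1" \<i>] S(2) calculation by simp
  ultimately show "{1, \<i>, - 1, - \<i>} \<subseteq> S" using S by simp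
qed simp

lemma invariant_square:
  assumes "\<alpha> \<noteq> 0"
  defines "\<Lambda> \<equiv> lattice (of_real \<alpha>) (of_real \<alpha> * \<i>)"
  shows "invariant_meromorphic (motions \<Lambda> {1, \<i>, - 1, - \<i>}) = {sphere_map (\<lambda>z. R (weierstrass_p \<Lambda> z ^ 2)) | R. R \<in> real_rational}"
  unfolding \<Lambda>_def
proof (rule symmetric_lattice.invariant_meromorphic_wp_power[OF square_symmetric[OF assms(1) assms(1)]])
  show "\<i> ^ r \<noteq> 1" if "0 < r" "r < 2 * 2" for r
  proof -
    have "r = 1 \<or> r = 2 \<or> r = 3" using that by auto
    thus ?thesis by (auto simp: power3_eq_cube complex_eq_iff)
  qed
  show "\<rho> ^ (2 * 2) = 1" if "\<rho> \<in> {1, \<i>, - 1, - \<i>}" for \<rho> using that by auto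
qed auto


theorem mainTheorem8:
  fixes \<alpha> \<beta> :: real and \<omega> :: complex
  assumes "\<alpha> \<noteq> 0" and "\<beta> \<noteq> 0" and "\<omega> ^ 3 = 1" and "\<omega> \<noteq> 1"
  shows
    "  (let \<Lambda> = lattice (of_real \<alpha>) (of_real \<beta> * \<i>); G = motion_group \<Lambda> {};
             wp = weierstrass_p \<Lambda>; wp' = deriv wp
           in wallpaper_group_of_type pm G \<and>
              invariant_meromorphic G =
                {sphere_map (\<lambda>z. R (wp z) + S (wp z) * wp' z) | R S.
                   R \<in> real_rational \<and> S \<in> real_rational})
    \<and> (let \<Lambda> = lattice (of_real \<alpha>) (of_real \<beta> * \<i>); G = motion_group \<Lambda> {- 1};
             wp = weierstrass_p \<Lambda>
           in wallpaper_group_of_type p2mm G \<and>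
              invariant_meromorphic G = {sphere_map (\<lambda>z. R (wp z)) | R. R \<in> real_rational})
    \<and> (let \<Lambda> = lattice (of_real \<alpha>) (of_real \<alpha> * \<i>); G = motion_group \<Lambda> {\<i>};
             wp = weierstrass_p \<Lambda>
           in wallpaper_group_of_type p4mm G \<and>
              invariant_meromorphic G = {sphere_map (\<lambda>z. R (wp z ^ 2)) | R. R \<in> real_rational})
    \<and> (let \<Lambda> = lattice (of_real \<alpha>) (of_real \<alpha> * \<omega>); G = motion_group \<Lambda> {\<omega>};
             wp = weierstrass_p \<Lambda>; wp' = deriv wp
           in wallpaper_group_of_type p31m G \<and>
              invariant_meromorphic G = {sphere_map (\<lambda>z. R (wp' z)) | R. R \<in> real_rational})
    \<and> (let \<Lambda> = lattice (of_real \<alpha>) (of_real \<alpha> * \<omega>); G = motion_group \<Lambda> {- 1, \<omega>};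
             wp = weierstrass_p \<Lambda>; wp' = deriv wp
           in wallpaper_group_of_type p6mm G \<and>
              invariant_meromorphic G = {sphere_map (\<lambda>z. R (wp' z ^ 2)) | R. R \<in> real_rational} \<and>
              invariant_meromorphic G = {sphere_map (\<lambda>z. S (wp z ^ 3)) | S. S \<in> real_rational})
    \<and> (let \<Lambda> = lattice (of_real \<alpha> + of_real \<beta> * \<i>) (of_real \<alpha> - of_real \<beta> * \<i>);
             G = motion_group \<Lambda> {}; wp = weierstrass_p \<Lambda>; wp' = deriv wp
           in wallpaper_group_of_type cm G \<and>
              invariant_meromorphic G =
                {sphere_map (\<lambda>z. R (wp z) + S (wp z) * wp' z) | R S.
                   R \<in> real_rational \<and> S \<in> real_rational})
    \<and> (let \<Lambda> = lattice (of_real \<alpha> + of_real \<beta> * \<i>) (of_real \<alpha> - of_real \<beta> * \<i>);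
             G = motion_group \<Lambda> {- 1}; wp = weierstrass_p \<Lambda>
           in wallpaper_group_of_type c2mm G \<and>
              invariant_meromorphic G = {sphere_map (\<lambda>z. R (wp z)) | R. R \<in> real_rational})
    \<and> (let \<Lambda> = lattice (of_real \<alpha> + of_real (\<alpha> / sqrt 3) * \<i>)
                               (of_real \<alpha> - of_real (\<alpha> / sqrt 3) * \<i>);
             G = motion_group \<Lambda> {\<omega>}; wp = weierstrass_p \<Lambda>; wp' = deriv wp
           in wallpaper_group_of_type p3m1 G \<and>
              invariant_meromorphic G = {sphere_map (\<lambda>z. R (wp' z)) | R. R \<in> real_rational})
    \<and> (let \<Lambda> = lattice (of_real \<alpha> + of_real (\<alpha> * sqrt 3) * \<i>)
                               (of_real \<alpha> - of_real (\<alpha> * sqrt 3) * \<i>);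
             G = motion_group \<Lambda> {\<omega>}; wp = weierstrass_p \<Lambda>; wp' = deriv wp
           in wallpaper_group_of_type p31m G \<and>
              invariant_meromorphic G = {sphere_map (\<lambda>z. R (wp' z)) | R. R \<in> real_rational})"
proof -
  note rect = rectangular_symmetric[OF assms(1,2)] and rhomb = rhombic_symmetric[OF assms(1,2)]
  have pm1: "{1} = {1} \<or> {1} = {1, - 1 :: complex}" "{1, - 1} = {1} \<or> {1, - 1} = {1, - 1 :: complex}" by simp_all
  \<comment> \<open>The difference of the generators \<alpha> \<plusminus> (\<alpha> / \<surd>3)
    \<i> is x \<i>, perpendicular to the mirror; the sum of the generators \<alpha> \<plusminus>
    \<alpha> \<surd>3 \<i> is y, on the mirror.\<close>
  define x y :: real where "x = 2 * \<alpha> / sqrt 3" and "y = 2 * \<alpha>"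
  have hex: "of_real y \<noteq> (0 :: complex)" "cnj (of_real y) = of_real y \<or> cnj (of_real y) = - of_real y"
    "of_real x * \<i> \<noteq> 0" "cnj (of_real x * \<i>) = of_real x * \<i> \<or> cnj (of_real x * \<i>) = - (of_real x * \<i>)"
    "of_real \<alpha> \<noteq> (0 :: complex)" "cnj (of_real \<alpha>) = of_real \<alpha> \<or> cnj (of_real \<alpha>) = - of_real \<alpha>"
    using assms(1) by (simp_all add: x_def y_def)
  have p3m1: "lattice (of_real \<alpha> + of_real (\<alpha> / sqrt 3) * \<i>) (of_real \<alpha> - of_real (\<alpha> / sqrt 3) * \<i>)
      = lattice (of_real x * \<i>) (\<omega> * (of_real x * \<i>))" (is "lattice ?u ?v = lattice ?a _")
  proof -
    have x3: "of_real x * of_real (sqrt 3) = 2 * (of_real \<alpha> :: complex)" by (simp add: x_def)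
    have x2: "2 * of_real (\<alpha> / sqrt 3) = (of_real x :: complex)" by (simp add: x_def)
    \<comment> \<open>Doubled because the explicit values are known for 2 \<omega>; the two
      alternatives belong to the two signs of the imaginary part of \<omega>.\<close>
    have "2 * (\<omega> * ?a) = - 2 * ?u \<or> 2 * (\<omega> * ?a) = 2 * ?v"
    proof -
      have ii: "\<i> * \<i> = - 1" by simp
      \<comment> \<open>The letters w, X, T, A, S stand for \<omega>, x, \<alpha> / \<surd>3,
        \<alpha>, \<surd>3. Only the polynomial relations among them matter.\<close>
      have "2 * (w * (X * \<i>)) = - 2 * (A + T * \<i>)" if "2 * w = - 1 + S * \<i>" "X * S = 2 * A" "2 * T = X"
        for w X T A S :: complex using that ii by algebra
      moreover have "2 * (w * (X * \<i>)) = 2 * (A - T * \<i>)" if "2 * w = - 1 - S * \<i>" "X * S = 2 * A" "2 * T = X"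
        for w X T A S :: complex using that ii by algebra
      ultimately show ?thesis using hexagonal_rhombus_cases[OF assms(3,4)] x3 x2 by blast
    qed
    hence "\<omega> * ?a = - ?u \<or> \<omega> * ?a = - (- ?v)" by (rule disj_forward) algebra+
    moreover have "?a = ?u + - ?v" unfolding x2[symmetric] by (simp add: algebra_simps)
    \<comment> \<open>Here a is the difference of the generators, so the rhombus is taken with sides
      \<open>?u\<close> and \<open>- ?v\<close>.\<close>
    ultimately show ?thesis
      unfolding lattice_uminus_right[of ?u ?v, symmetric] by (rule rhombus_eq_hexagonal)
  qed
  \<comment> \<open>The sum of these generators is real, so this lattice has a hexagonal basis with
    real a and belongs to p31m.\<close>
  have p31m: "lattice (of_real \<alpha> + of_real (\<alpha> * sqrt 3) * \<i>) (of_real \<alpha> - of_real (\<alpha> * sqrt 3) * \<i>)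
      = lattice (of_real y) (\<omega> * of_real y)" (is "lattice ?u ?v = lattice ?a _")
  proof -
    have eq: "\<omega> * ?a = of_real \<alpha> * (2 * \<omega>)" by (simp add: y_def)
    have "\<omega> * ?a = - ?v" if "2 * \<omega> = - 1 + of_real (sqrt 3) * \<i>"
      unfolding eq that by (simp add: algebra_simps)
    moreover have "\<omega> * ?a = - ?u" if "2 * \<omega> = - 1 - of_real (sqrt 3) * \<i>"
      unfolding eq that by (simp add: algebra_simps)
    ultimately have "\<omega> * ?a = - ?u \<or> \<omega> * ?a = - ?v"
      using hexagonal_rhombus_cases[OF assms(3,4)] by blast
    moreover have "?a = ?u + ?v" by (simp add: y_def)
    ultimately show ?thesis by (rule rhombus_eq_hexagonal)
  qed
  note C3 = motion_group_C3[OF assms(3,4)] invariant_C3[OF assms(3,4)]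
  note C6 = motion_group_C6[OF assms(3,4)] invariant_C6[OF assms(3,4)]
  have comm: "of_real \<alpha> * \<omega> = \<omega> * of_real \<alpha>" by (rule mult.commute)
  show ?thesis
    unfolding Let_def p3m1 p31m comm
    unfolding motion_group_trivial[OF rect[OF pm1(1)]] motion_group_trivial[OF rhomb[OF pm1(1)]]
      motion_group_pm1[OF rect[OF pm1(2)]] motion_group_pm1[OF rhomb[OF pm1(2)]]
      motion_group_square[OF assms(1)] C3(1)[OF hex(1,2)] C3(1)[OF hex(3,4)] C3(1)[OF hex(5,6)] C6(1)[OF hex(5,6)]
  proof (intro conjI)
    show "wallpaper_group_of_type p31m (motions (lattice (of_real \<alpha>) (\<omega> * of_real \<alpha>)) (C3 \<omega>))"
      by (rule type_p31m[OF assms(3,4) hex(5,6)]) simp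
    show "wallpaper_group_of_type p31m (motions (lattice (of_real y) (\<omega> * of_real y)) (C3 \<omega>))"
      by (rule type_p31m[OF assms(3,4) hex(1,2)]) simp
    show "wallpaper_group_of_type p3m1 (motions (lattice (of_real x * \<i>) (\<omega> * (of_real x * \<i>))) (C3 \<omega>))"
      by (rule type_p3m1[OF assms(3,4) hex(3,4)]) simp
    show "wallpaper_group_of_type p6mm (motions (lattice (of_real \<alpha>) (\<omega> * of_real \<alpha>)) (C6 \<omega>))"
      by (rule type_p6mm[OF assms(3,4) hex(5,6)]) simp
  qed (rule type_rectangular[OF assms(1,2)] type_rhombic[OF assms(1,2)] type_square[OF assms(1,1)]
      symmetric_lattice.invariant_meromorphic_wp_wp'[OF rect[OF pm1(1)] refl]
      symmetric_lattice.invariant_meromorphic_wp_wp'[OF rhomb[OF pm1(1)] refl]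
      invariant_pm1[OF rect[OF pm1(2)]] invariant_pm1[OF rhomb[OF pm1(2)]] invariant_square[OF assms(1)]
      C3(2)[OF hex(1,2)] C3(2)[OF hex(3,4)] C3(2)[OF hex(5,6)] C6(2,3)[OF hex(5,6)]; simp)+
qed

end
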